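(* Let $n\ge 2$. There exist $v\in L^{\infty}(\mathbb{R}^n_x\times\mathbb{R}_t;\mathbb{R}^n)$ and $p\in L^{\infty}(\mathbb{R}^n_x\times\mathbb{R}_t)$ solving the incompressible Euler equations without force $$\partial_t v+\operatorname{div}(v\otimes v)+\nabla p=0,\qquad \operatorname{div} v=0$$ in the sense of distributions on $\mathbb{R}^n_x\times\mathbb{R}_t$, such that $v$ is not identically zero (as an element of $L^\infty$), and $\operatorname{supp} v$ and $\operatorname{supp} p$ are compact in space-time $\mathbb{R}^n_x\times\mathbb{R}_t$.
   Context: Here $\operatorname{div}$ and $\nabla$ are taken in the space variable $x\in\mathbb{R}^n$ only; $v\otimes v$ is the matrix with entries $v_iv_j$ and $(\operatorname{div}(v\otimes v))_i=\sum_j\partial_{x_j}(v_iv_j)$. *)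

theory Defs
  imports "HOL-Analysis.Analysis"
begin

definition Linfty :: "('a::euclidean_space \<Rightarrow> 'b::real_normed_vector) \<Rightarrow> bool" where
  "Linfty f \<longleftrightarrow> f \<in> borel_measurable lborel \<and> (\<exists>C. AE z in lborel. norm (f z) \<le> C)"

text \<open>The support of an equivalence class of functions modulo null sets: the complement of
  the largest open set on which the function vanishes almost everywhere.\<close>

definition ess_supp :: "('a::euclidean_space \<Rightarrow> 'b::real_normed_vector) \<Rightarrow> 'a set" where
  "ess_supp f = - \<Union>{U. open U \<and> (AE z in lborel. z \<in> U \<longrightarrow> f z = 0)}"

abbreviation dir_deriv ::
    "'a::euclidean_space \<Rightarrow> ('a \<Rightarrow> real) \<Rightarrow> 'a \<Rightarrow> real" where
  "dir_deriv b f \<equiv> (\<lambda>z. frechet_derivative f (at z) b)"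

primrec Ck :: "nat \<Rightarrow> ('a::euclidean_space \<Rightarrow> real) \<Rightarrow> bool" where
  "Ck 0 f \<longleftrightarrow> continuous_on UNIV f"
| "Ck (Suc k) f \<longleftrightarrow> f differentiable_on UNIV \<and> (\<forall>b\<in>Basis. Ck k (dir_deriv b f))"

definition test_function :: "('a::euclidean_space \<Rightarrow> real) \<Rightarrow> bool" where
  "test_function \<phi> \<longleftrightarrow> (\<forall>k. Ck k \<phi>) \<and> compact (closure {z. \<phi> z \<noteq> 0})"

text \<open>Distributions are represented as functionals that are only ever evaluated at
  test functions.\<close>

type_synonym 'a functional = "('a \<Rightarrow> real) \<Rightarrow> real"

definition distr_of :: "('a::euclidean_space \<Rightarrow> real) \<Rightarrow> 'a functional" where
  "distr_of f = (\<lambda>\<phi>. \<integral>z. f z * \<phi> z \<partial>lborel)"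

definition distr_deriv :: "'a::euclidean_space \<Rightarrow> 'a functional \<Rightarrow> 'a functional" where
  "distr_deriv b T = (\<lambda>\<phi>. - T (dir_deriv b \<phi>))"

text \<open>Space-time is \<open>(real ^ 'n) \<times> real\<close>, with points \<open>(x, t)\<close>.\<close>

abbreviation D_t :: "((real ^ 'n) \<times> real) functional \<Rightarrow> ((real ^ 'n) \<times> real) functional" where
  "D_t \<equiv> distr_deriv (0, 1)"

abbreviation D_x ::
    "'n::finite \<Rightarrow> ((real ^ 'n) \<times> real) functional \<Rightarrow> ((real ^ 'n) \<times> real) functional" where
  "D_x j \<equiv> distr_deriv (axis j 1, 0)"

definition euler_distributional_solution ::
    "((real ^ 'n) \<times> real \<Rightarrow> real ^ 'n) \<Rightarrow> ((real ^ 'n) \<times> real \<Rightarrow> real) \<Rightarrow> bool" where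
  "euler_distributional_solution v p \<longleftrightarrow>
     (\<forall>\<phi>. test_function \<phi> \<longrightarrow>
        (\<forall>i. D_t (distr_of (\<lambda>z. v z $ i)) \<phi>
              + (\<Sum>j\<in>UNIV. D_x j (distr_of (\<lambda>z. v z $ i * v z $ j)) \<phi>)
              + D_x i (distr_of p) \<phi> = 0)
        \<and> (\<Sum>j\<in>UNIV. D_x j (distr_of (\<lambda>z. v z $ j)) \<phi>) = 0)"

end

(* The proof is by convex integration. Work with the linear system
   d_t v + div sigma = 0, div v = 0 (pressure absorbed in the symmetric matrix sigma) on the open
   space-time unit cube. A pair (v, sigma) is a strict subsolution if
   R = sigma + I/n - v (x) v is uniformly positive definite; a solution of the Euler equations with
   pressure -1/n on the cube is exactly the limiting case R = 0.
   If R has trace rho at a point, then R >= (rho/n) f (x) f for some unit vector f, and adding to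
   (v, sigma) a multiple of order rho of (f, f (x) m + m (x) f), with m the part of v orthogonal to f,
   keeps R positive. Such increments are realised, up to small errors, by rapidly oscillating compactly
   supported exact solutions of the linear system in the boxes of a fine division. This raises the
   energy by a fixed multiple of the integral of rho^2, almost orthogonally to finitely many given fields.
   Since the energy is bounded, the iteration converges strongly in L^2, rho tends to 0, and the limit
   is a solution. It is nonzero because the trace of sigma + I/n is kept above 1/2. *)

theory Submission
  imports Defs
begin

section \<open>Continuous functions of compact support\<close>

text \<open>Two requirements fix the form of the increment. With v = \<gamma> f + m, replacing v by
  v + s f changes v (x) v by s (f (x) m + m (x) f) + (2 s \<gamma> + s^2) f (x) f. The matrix
  increment cancels the first term, so the defect loses only a multiple of f (x) f, the rank-one
  matrix that R is known to dominate. Also, (f, f (x) m + m (x) f) must be the amplitude of a plane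
  wave of the linear system: the phase (e, - m . e) with e orthogonal to f works, and n >= 2
  provides e. The matrix has trace 0 because m is orthogonal to f, so the trace of sigma hardly
  moves. The obstacle is that the positivity margin shrinks by a factor 4 at each step. It may
  govern mesh size and frequency, but the energy gain must depend on rho and the dimension alone;
  otherwise the gains could be summable without rho tending to 0. Oscillation by itself suggests
  only weak convergence. Near-orthogonality to all earlier fields makes the squared distance of two
  fields essentially their energy difference, which gives the strong convergence needed to pass to
  the limit in v (x) v.\<close>

definition Cc :: "('a::euclidean_space \<Rightarrow> 'b::euclidean_space) \<Rightarrow> bool" where
  "Cc f \<longleftrightarrow> continuous_on UNIV f \<and> bounded {z. f z \<noteq> 0}"

lemma Cc_continuous: "Cc f \<Longrightarrow> continuous_on A f"
  unfolding Cc_def using continuous_on_subset by blast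

lemma Cc_ball:
  assumes "Cc f"
  obtains B where "0 < B" "\<And>z. B < norm z \<Longrightarrow> f z = 0"
proof -
  obtain B where "\<forall>z\<in>{z. f z \<noteq> 0}. norm z \<le> B"
    using assms by (auto simp: Cc_def bounded_iff)
  then have "max B 1 < norm z \<Longrightarrow> f z = 0" for z by force
  then show ?thesis using that[of "max B 1"] by auto
qed

lemma Cc_subset: "Cc f \<Longrightarrow> continuous_on UNIV g \<Longrightarrow> (\<And>z. f z = 0 \<Longrightarrow> g z = 0) \<Longrightarrow> Cc g"
  unfolding Cc_def by (auto elim!: bounded_subset)

lemma Cc_box: "continuous_on UNIV f \<Longrightarrow> (\<And>z. z \<notin> box a b \<Longrightarrow> f z = 0) \<Longrightarrow> Cc f"
  unfolding Cc_def by (auto intro: bounded_subset[OF bounded_box[of a b]])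

lemma Cc_add: "Cc f \<Longrightarrow> Cc g \<Longrightarrow> Cc (\<lambda>z. f z + g z)"
proof -
  assume "Cc f" "Cc g"
  then have "bounded ({z. f z \<noteq> 0} \<union> {z. g z \<noteq> 0})" by (simp add: Cc_def)
  then have "bounded {z. f z + g z \<noteq> 0}" by (rule bounded_subset) auto
  with \<open>Cc f\<close> \<open>Cc g\<close> show ?thesis by (auto simp: Cc_def intro: continuous_intros)
qed

lemma Cc_diff: "Cc f \<Longrightarrow> Cc g \<Longrightarrow> Cc (\<lambda>z. f z - g z)"
proof -
  assume "Cc f" "Cc g"
  then have "bounded ({z. f z \<noteq> 0} \<union> {z. g z \<noteq> 0})" by (simp add: Cc_def)
  then have "bounded {z. f z - g z \<noteq> 0}" by (rule bounded_subset) auto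
  with \<open>Cc f\<close> \<open>Cc g\<close> show ?thesis by (auto simp: Cc_def intro: continuous_intros)
qed

lemma Cc_scaleR_left: "Cc f \<Longrightarrow> continuous_on UNIV g \<Longrightarrow> Cc (\<lambda>z. f z *\<^sub>R g z)"
  by (rule Cc_subset, assumption) (auto intro!: continuous_intros intro: Cc_continuous)

lemma Cc_scaleR_const: "Cc f \<Longrightarrow> Cc (\<lambda>z. c *\<^sub>R f z)"
  using Cc_subset[of f "\<lambda>z. c *\<^sub>R f z"] continuous_on_scaleR[OF continuous_on_const Cc_continuous[of f]]
  by simp

lemma Cc_mult_left: "Cc f \<Longrightarrow> continuous_on UNIV g \<Longrightarrow> Cc (\<lambda>z. f z * g z::real)"
  using Cc_scaleR_left[of f g] by simp

lemma Cc_mult_right: "Cc f \<Longrightarrow> continuous_on UNIV g \<Longrightarrow> Cc (\<lambda>z. g z * f z::real)"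
  using Cc_scaleR_left[of f g] by (simp add: mult.commute)

lemma Cc_inner: "Cc f \<Longrightarrow> continuous_on UNIV g \<Longrightarrow> Cc (\<lambda>z. f z \<bullet> g z)"
  by (rule Cc_subset, assumption) (auto intro!: continuous_intros intro: Cc_continuous)

lemma Cc_integrable:
  assumes "Cc f"
  shows "integrable lborel f"
proof -
  obtain B where B: "\<And>z. B < norm z \<Longrightarrow> f z = 0" using Cc_ball[OF assms] by metis
  have "integrable lborel (\<lambda>z. indicator (cball 0 B) z *\<^sub>R f z)"
    using assms by (intro borel_integrable_compact) (auto intro: Cc_continuous)
  also have "(\<lambda>z. indicator (cball 0 B) z *\<^sub>R f z) = f"
    using B by (auto simp: indicator_def fun_eq_iff not_le)
  finally show ?thesis .
qed

lemma Cc_bounded: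
  assumes "Cc f"
  obtains C where "0 < C" "\<And>z. norm (f z) \<le> C"
proof -
  obtain B where B: "0 < B" "\<And>z. B < norm z \<Longrightarrow> f z = 0" using Cc_ball[OF assms] by metis
  have "bounded (f ` cball 0 B)"
    using assms by (intro compact_imp_bounded compact_continuous_image Cc_continuous) auto
  then obtain C where C: "0 < C" "\<And>z. z \<in> cball 0 B \<Longrightarrow> norm (f z) \<le> C"
    by (auto simp: bounded_pos)
  have "norm (f z) \<le> C" for z
    using C B(2)[of z] by (cases "z \<in> cball 0 B") auto
  with C(1) show ?thesis using that by blast
qed

lemma Cc_uniformly_continuous:
  assumes "Cc f" "0 < e"
  obtains d where "0 < d" "\<And>x y. dist x y < d \<Longrightarrow> dist (f x) (f y) < e"
proof -
  obtain B where B: "0 < B" "\<And>z. B < norm z \<Longrightarrow> f z = 0" using Cc_ball[OF assms(1)] by metis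
  have "uniformly_continuous_on (cball 0 (B+1)) f"
    by (intro compact_uniformly_continuous Cc_continuous assms) auto
  then obtain d where d: "0 < d" "\<And>x y. norm x \<le> B+1 \<Longrightarrow> norm y \<le> B+1 \<Longrightarrow> dist y x < d \<Longrightarrow> dist (f y) (f x) < e"
    using assms(2) unfolding uniformly_continuous_on_def by auto
  \<comment> \<open>The cap 1 matters: if one of the points leaves the ball of radius
    \<open>B + 1\<close>, both have norm above \<open>B\<close>, where \<open>f\<close>
    vanishes.\<close>
  have "dist (f x) (f y) < e" if "dist x y < min d 1" for x y
  proof (cases "norm x \<le> B + 1 \<and> norm y \<le> B + 1")
    case True then show ?thesis using d(2)[of y x] that by auto
  next
    case False
    have "norm x \<le> norm y + dist x y" "norm y \<le> norm x + dist x y"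
      by (metis dist_0_norm dist_commute dist_triangle)+
    then have "B < norm x" "B < norm y" using False that by auto
    then show ?thesis using B(2) assms(2) by auto
  qed
  then show ?thesis using d(1) by (intro that[of "min d 1"]) auto
qed

section \<open>Translation invariance, integration by parts and oscillatory integrals\<close>

lemma lborel_integral_translate:
  fixes f :: "'a::euclidean_space \<Rightarrow> 'b::{banach, second_countable_topology}"
  assumes "f \<in> borel_measurable borel"
  shows "(\<integral>z. f (z + c) \<partial>lborel) = (\<integral>z. f z \<partial>lborel)"
proof -
  have "(\<integral>z. f z \<partial>lborel) = (\<integral>z. f z \<partial>(distr lborel borel ((+) c)))"
    by (simp add: lborel_distr_plus)
  also have "\<dots> = (\<integral>z. f (c + z) \<partial>lborel)"
    using assms by (intro integral_distr) auto
  finally show ?thesis by (simp add: add.commute)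
qed

lemma Cc_measurable: "Cc f \<Longrightarrow> f \<in> borel_measurable borel"
  by (intro borel_measurable_continuous_onI Cc_continuous)

lemma has_derivative_zero_off_support:
  assumes "(G has_derivative G') (at z)" "open U" "z \<in> U" "\<And>y. y \<in> U \<Longrightarrow> G y = 0"
  shows "G' h = 0"
proof -
  have "((\<lambda>_. 0) has_derivative G') (at z)"
    using has_derivative_transform_within_open[OF assms(1,2,3)] assms(4) by auto
  then have "G' = (\<lambda>_. 0)"
    by (rule has_derivative_unique) (rule has_derivative_const)
  then show ?thesis by simp
qed

lemma Cc_has_derivative:
  assumes "\<And>z. (G has_derivative G' z) (at z)" "continuous_on UNIV (\<lambda>z. G' z h)"
    "bounded {z. G z \<noteq> 0}"
  shows "Cc (\<lambda>z. G' z h)"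
proof -
  obtain B where B: "\<forall>z\<in>{z. G z \<noteq> 0}. norm z \<le> B"
    using assms(3) by (auto simp: bounded_iff)
  have "G' z h = 0" if "B < norm z" for z
    by (rule has_derivative_zero_off_support[OF assms(1), of "- cball 0 B"]) (use B that in auto)
  then show ?thesis unfolding Cc_def using assms(2)
    by (auto simp: bounded_iff not_le[symmetric])
qed

lemma has_derivative_Cc:
  assumes "\<And>z. (G has_derivative G' z) (at z)" "bounded {z. G z \<noteq> 0}"
  shows "Cc G"
  unfolding Cc_def using assms
  by (auto intro!: continuous_at_imp_continuous_on has_derivative_continuous)

lemma has_real_derivative_along_line:
  assumes "(f has_derivative f') (at (z + t *\<^sub>R h))"
  shows "((\<lambda>t. f (z + t *\<^sub>R h)) has_real_derivative f' h) (at t)"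
proof -
  have "((\<lambda>t. f (z + t *\<^sub>R h)) has_derivative (\<lambda>r. f' (r *\<^sub>R h))) (at t)"
    by (rule has_derivative_compose[where f="\<lambda>t. z + t *\<^sub>R h" and g=f and g'=f'])
      (auto intro!: derivative_eq_intros assms)
  moreover have "f' (r *\<^sub>R h) = f' h * r" for r
    using linear_cmul[OF has_derivative_linear[OF assms]] by (simp add: mult.commute)
  ultimately show ?thesis by (simp add: has_field_derivative_def)
qed

text \<open>The difference quotients integrate to zero by translation invariance and converge boundedly
  to the directional derivative.\<close>

lemma integral_directional_derivative_zero:
  fixes G :: "'a::euclidean_space \<Rightarrow> real"
  assumes der: "\<And>z. (G has_derivative G' z) (at z)"
    and cont: "continuous_on UNIV (\<lambda>z. G' z h)"
    and supp: "bounded {z. G z \<noteq> 0}"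
  shows "(\<integral>z. G' z h \<partial>lborel) = 0"
proof -
  have cG: "Cc G" by (rule has_derivative_Cc[OF der supp])
  have cG': "Cc (\<lambda>z. G' z h)" by (rule Cc_has_derivative[OF der cont supp])
  obtain C where C: "0 < C" "\<And>z. norm (G' z h) \<le> C" using Cc_bounded[OF cG'] by metis
  obtain B where B: "0 < B" "\<And>z. B < norm z \<Longrightarrow> G z = 0" using Cc_ball[OF cG] by metis
  define s where "s k = inverse (real (Suc k))" for k
  define X where "X k z = (G (z + s k *\<^sub>R h) - G z) / s k" for k z
  have s: "0 < s k" "s k \<le> 1" for k by (auto simp: s_def inverse_le_1_iff)
  have line: "((\<lambda>t. G (z + t *\<^sub>R h)) has_real_derivative G' (z + t *\<^sub>R h) h) (at t)" for z t
    by (rule has_real_derivative_along_line[OF der])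
  have lim: "(\<lambda>k. X k z) \<longlonglongrightarrow> G' z h" for z
  proof -
    have "((\<lambda>t. (G (z + t *\<^sub>R h) - G z) / t) \<longlongrightarrow> G' z h) (at 0)"
      using line[of z 0] by (simp add: DERIV_def)
    moreover have "filterlim s (at 0) sequentially"
      unfolding s_def filterlim_at using LIMSEQ_inverse_real_of_nat by auto
    ultimately show ?thesis unfolding X_def by (rule filterlim_compose)
  qed
  have bound: "norm (X k z) \<le> C * indicator (cball 0 (B + norm h)) z" for k z
  proof (cases "norm z \<le> B + norm h")
    case True
    obtain t where "G (z + s k *\<^sub>R h) - G (z + 0 *\<^sub>R h) = (s k - 0) * G' (z + t *\<^sub>R h) h"
      using MVT2[OF s(1)[of k], of "\<lambda>t. G (z + t *\<^sub>R h)" "\<lambda>t. G' (z + t *\<^sub>R h) h"] line by auto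
    then have "X k z = G' (z + t *\<^sub>R h) h" using s(1)[of k] by (simp add: X_def)
    then show ?thesis using C True by simp
  next
    case False
    have "norm (s k *\<^sub>R h) \<le> norm h" using s[of k] by (simp add: mult_left_le_one_le)
    then have "norm (z + s k *\<^sub>R h) > B"
      using False norm_triangle_ineq4[of "z + s k *\<^sub>R h" "s k *\<^sub>R h"] by simp
    moreover have "norm z > B" using False norm_ge_zero[of h] by linarith
    ultimately show ?thesis using B False by (simp add: X_def)
  qed
  have XI: "(\<integral>z. X k z \<partial>lborel) = 0" for k
  proof -
    have "Cc (\<lambda>z. G (z + s k *\<^sub>R h))"
    proof -
      have "continuous_on UNIV (\<lambda>z. G (z + s k *\<^sub>R h))"
        by (intro continuous_on_compose2[OF Cc_continuous[OF cG, of UNIV]] continuous_intros) auto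
      moreover have "norm z \<le> B + norm (s k *\<^sub>R h)" if "G (z + s k *\<^sub>R h) \<noteq> 0" for z
        using that B(2)[of "z + s k *\<^sub>R h"] norm_triangle_ineq4[of "z + s k *\<^sub>R h" "s k *\<^sub>R h"]
        by (simp add: not_less) force
      ultimately show ?thesis unfolding Cc_def bounded_iff by blast
    qed
    then have "(\<integral>z. G (z + s k *\<^sub>R h) - G z \<partial>lborel) = 0"
      using lborel_integral_translate[OF Cc_measurable[OF cG], of "s k *\<^sub>R h"]
      by (simp add: Bochner_Integration.integral_diff Cc_integrable cG)
    then show ?thesis by (simp add: X_def)
  qed
  have "(\<lambda>k. \<integral>z. X k z \<partial>lborel) \<longlonglongrightarrow> (\<integral>z. G' z h \<partial>lborel)"
  proof (rule integral_dominated_convergence[where w="\<lambda>z. C * indicator (cball 0 (B + norm h)) z"])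
    show "(\<lambda>z. G' z h) \<in> borel_measurable lborel"
      using Cc_measurable[OF cG'] by simp
    have "(\<lambda>z. G (z + s k *\<^sub>R h)) \<in> borel_measurable borel" for k
      by (intro borel_measurable_continuous_onI continuous_on_compose2[OF Cc_continuous[OF cG, of UNIV]]
          continuous_intros) auto
    then show "X k \<in> borel_measurable lborel" for k
      unfolding X_def using Cc_measurable[OF cG] by simp
    show "integrable lborel (\<lambda>z. C * indicator (cball 0 (B + norm h)) z :: real)"
      by (intro integrable_mult_right) (auto intro!: integrable_real_indicator emeasure_bounded_finite)
  qed (use lim bound in auto)
  then show ?thesis unfolding XI using LIMSEQ_unique[OF _ tendsto_const] by metis
qed

lemma integration_by_parts_directional:
  fixes F g :: "'a::euclidean_space \<Rightarrow> real"
  assumes "\<And>z. (F has_derivative F' z) (at z)" "continuous_on UNIV (\<lambda>z. F' z h)"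
    and "\<And>z. (g has_derivative g' z) (at z)" "continuous_on UNIV (\<lambda>z. g' z h)"
    and supp: "bounded {z. F z \<noteq> 0}"
  shows "(\<integral>z. F' z h * g z \<partial>lborel) = - (\<integral>z. F z * g' z h \<partial>lborel)"
proof -
  have cF: "Cc F" by (rule has_derivative_Cc[OF assms(1) supp])
  have cF': "Cc (\<lambda>z. F' z h)" by (rule Cc_has_derivative[OF assms(1,2) supp])
  have cg: "continuous_on UNIV g"
    using assms(3) by (auto intro!: continuous_at_imp_continuous_on has_derivative_continuous)
  have "(\<integral>z. F z * g' z h + F' z h * g z \<partial>lborel) = 0"
  proof (rule integral_directional_derivative_zero)
    show "((\<lambda>z. F z * g z) has_derivative (\<lambda>h. F z * g' z h + F' z h * g z)) (at z)" for z
      by (rule has_derivative_mult[OF assms(1,3)])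
    show "continuous_on UNIV (\<lambda>z. F z * g' z h + F' z h * g z)"
      by (intro continuous_intros assms cg Cc_continuous[OF cF])
    show "bounded {z. F z * g z \<noteq> 0}" by (rule bounded_subset[OF supp]) auto
  qed
  moreover have "integrable lborel (\<lambda>z. F z * g' z h)" "integrable lborel (\<lambda>z. F' z h * g z)"
    by (intro Cc_integrable Cc_mult_left cF cF' cg assms)+
  ultimately show ?thesis by simp
qed

text \<open>Translating by half a period \<open>c\<close> flips the sign of the cosine, so the integral equals
  half of the integral of \<open>(g z - g (z + c)) cos (\<dots>)\<close>.\<close>

lemma Riemann_Lebesgue_cos:
  fixes g :: "'a::euclidean_space \<Rightarrow> real"
  assumes g: "Cc g" and "\<xi> \<noteq> 0"
  shows "((\<lambda>l. \<integral>z. g z * cos (l * (\<xi> \<bullet> z)) \<partial>lborel) \<longlongrightarrow> 0) at_top"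
proof -
  obtain C where C: "0 < C" "\<And>z. norm (g z) \<le> C" using Cc_bounded[OF g] by metis
  obtain B where B: "0 < B" "\<And>z. B < norm z \<Longrightarrow> g z = 0" using Cc_ball[OF g] by metis
  define c where "c l = (pi / l / (\<xi> \<bullet> \<xi>)) *\<^sub>R \<xi>" for l :: real
  define D where "D l z = g z - g (z + c l)" for l z
  have cont: "continuous_on UNIV (\<lambda>z. g (z + a))" for a
    by (intro continuous_on_compose2[OF Cc_continuous[OF g, of UNIV]] continuous_intros) auto
  have Ccs: "Cc (\<lambda>z. g (z + a))" for a
  proof -
    have "norm z \<le> B + norm a" if "g (z + a) \<noteq> 0" for z
      using that B(2)[of "z + a"] norm_triangle_ineq4[of "z + a" "a"] by (simp add: not_less) force
    then show ?thesis using cont unfolding Cc_def bounded_iff by blast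
  qed
  have c0: "(c \<longlongrightarrow> 0) at_top"
  proof -
    have "((\<lambda>l. pi / l / (\<xi> \<bullet> \<xi>)) \<longlongrightarrow> 0) at_top"
      using assms(2) by (intro tendsto_divide_zero tendsto_divide_0[OF tendsto_const] filterlim_at_top_imp_at_infinity filterlim_ident)
    from tendsto_scaleR[OF this tendsto_const[of \<xi>]] show ?thesis by (simp add: c_def[abs_def])
  qed
  have D: "((\<lambda>l. \<integral>z. norm (D l z) \<partial>lborel) \<longlongrightarrow> (\<integral>z. 0 \<partial>(lborel::'a measure))) at_top"
  proof (rule integral_dominated_convergence_at_top[where w="\<lambda>z. 2 * C * indicator (cball 0 (B + 1)) z"])
    have "((\<lambda>l. D l z) \<longlongrightarrow> 0) at_top" for z
    proof -
      have "continuous (at z) g" using g by (auto simp: Cc_def continuous_on_eq_continuous_at)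
      then have "((\<lambda>l. g (z + c l)) \<longlongrightarrow> g (z + 0)) at_top"
        by (intro isCont_tendsto_compose[of _ g]) (use tendsto_add[OF tendsto_const c0, of z] in auto)
      from tendsto_diff[OF tendsto_const this, of "g z"] show ?thesis by (simp add: D_def)
    qed
    then show "AE z in lborel. ((\<lambda>l. norm (D l z)) \<longlongrightarrow> 0) at_top"
      by (intro AE_I2 tendsto_norm_zero)
    have "eventually (\<lambda>l. norm (c l) < 1) at_top"
      using tendsto_norm_zero[OF c0] by (rule order_tendstoD) auto
    then show "\<forall>\<^sub>F l in at_top. AE z in lborel. norm (norm (D l z)) \<le> 2 * C * indicator (cball 0 (B + 1)) z"
    proof eventually_elim
      case (elim l)
      have "norm (D l z) \<le> 2 * C * indicator (cball 0 (B + 1)) z" for z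
      proof (cases "norm z \<le> B + 1")
        case True then show ?thesis
          using C(2)[of z] C(2)[of "z + c l"] unfolding D_def by (auto intro!: order_trans[OF norm_triangle_ineq4])
      next
        case False
        then have "norm (z + c l) > B"
          using elim norm_triangle_ineq4[of "z + c l" "c l"] by simp
        then show ?thesis using B(2)[of z] B(2)[of "z + c l"] False by (auto simp: D_def)
      qed
      then show ?case by (intro AE_I2) simp
    qed
    show "integrable lborel (\<lambda>z. 2 * C * indicator (cball 0 (B + 1)) z :: real)"
      by (intro integrable_mult_right) (auto intro!: integrable_real_indicator emeasure_bounded_finite)
    show "(\<lambda>z. norm (D l z)) \<in> borel_measurable lborel" for l
      unfolding D_def using Cc_measurable[OF g] Cc_measurable[OF Ccs] by simp
  qed auto
  then have D0: "((\<lambda>l. \<integral>z. norm (D l z) \<partial>lborel) \<longlongrightarrow> 0) at_top" by simp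
  show ?thesis
  proof (rule Lim_null_comparison[OF _ D0])
    show "\<forall>\<^sub>F l in at_top. norm (\<integral>z. g z * cos (l * (\<xi> \<bullet> z)) \<partial>lborel) \<le> (\<integral>z. norm (D l z) \<partial>lborel)"
      using eventually_gt_at_top[of 0]
    proof eventually_elim
      case (elim l)
      have cc: "continuous_on UNIV (\<lambda>z. cos (l * (\<xi> \<bullet> z)))" by (intro continuous_intros)
      have shift: "cos (l * (\<xi> \<bullet> (z + c l))) = - cos (l * (\<xi> \<bullet> z))" for z
      proof -
        have "l * (\<xi> \<bullet> (z + c l)) = l * (\<xi> \<bullet> z) + pi"
          using elim assms(2) by (simp add: c_def inner_add_right field_simps)
        then show ?thesis by simp
      qed
      let ?I = "\<integral>z. g z * cos (l * (\<xi> \<bullet> z)) \<partial>lborel"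
      have "?I = (\<integral>z. g (z + c l) * cos (l * (\<xi> \<bullet> (z + c l))) \<partial>lborel)"
        by (rule lborel_integral_translate[symmetric]) (intro Cc_measurable Cc_mult_left g cc)
      also have "\<dots> = - (\<integral>z. g (z + c l) * cos (l * (\<xi> \<bullet> z)) \<partial>lborel)"
        by (simp add: shift)
      finally have "2 * ?I = (\<integral>z. g z * cos (l * (\<xi> \<bullet> z)) - g (z + c l) * cos (l * (\<xi> \<bullet> z)) \<partial>lborel)"
        by (subst Bochner_Integration.integral_diff) (auto intro!: Cc_integrable Cc_mult_left g cc Ccs)
      also have "\<dots> = (\<integral>z. D l z * cos (l * (\<xi> \<bullet> z)) \<partial>lborel)"
        by (simp add: D_def left_diff_distrib)
      finally have "norm (2 * ?I) \<le> (\<integral>z. norm (D l z * cos (l * (\<xi> \<bullet> z))) \<partial>lborel)"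
        using integral_norm_bound by metis
      also have "\<dots> \<le> (\<integral>z. norm (D l z) \<partial>lborel)"
      proof (rule integral_mono)
        have "Cc (D l)" unfolding D_def by (intro Cc_diff g Ccs)
        then show "integrable lborel (\<lambda>z. norm (D l z * cos (l * (\<xi> \<bullet> z))))"
          "integrable lborel (\<lambda>z. norm (D l z))"
          by (intro integrable_norm Cc_integrable Cc_mult_left cc, assumption)+
      qed (auto simp: abs_mult intro: mult_left_le)
      finally show ?case by simp
    qed
  qed
qed

section \<open>Iterated directional derivatives\<close>

lemma Ck_differentiable: "Ck (Suc k) f \<Longrightarrow> f differentiable (at z)"
  by (simp add: differentiable_on_def)

lemma Ck_has_derivative: "Ck (Suc k) f \<Longrightarrow> (f has_derivative frechet_derivative f (at z)) (at z)"
  using Ck_differentiable frechet_derivative_works by blast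

lemma frechet_derivative_scale_add:
  fixes f g :: "'a::euclidean_space \<Rightarrow> real"
  assumes "f differentiable (at z)" "g differentiable (at z)"
  shows "frechet_derivative (\<lambda>z. c * f z + g z) (at z) b
    = c * frechet_derivative f (at z) b + frechet_derivative g (at z) b"
proof -
  have "((\<lambda>z. c * f z + g z) has_derivative
    (\<lambda>b. c * frechet_derivative f (at z) b + frechet_derivative g (at z) b)) (at z)"
    using assms[unfolded frechet_derivative_works] by (intro has_derivative_add has_derivative_mult_right)
  from frechet_derivative_at[OF this] show ?thesis by (rule fun_cong[symmetric])
qed

lemma Ck_scale_add: "Ck k f \<Longrightarrow> Ck k g \<Longrightarrow> Ck k (\<lambda>z. c * f z + g z)"
proof (induction k arbitrary: f g)
  case 0
  then show ?case by (auto intro!: continuous_intros)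
next
  case (Suc k)
  have "(\<lambda>z. frechet_derivative (\<lambda>z. c * f z + g z) (at z) b)
    = (\<lambda>z. c * frechet_derivative f (at z) b + frechet_derivative g (at z) b)" for b
    using Ck_differentiable[OF Suc.prems(1)] Ck_differentiable[OF Suc.prems(2)]
    by (auto simp: frechet_derivative_scale_add)
  with Suc show ?case
    by (auto simp: differentiable_on_def intro!: derivative_intros)
qed

lemma Ck_zero: "Ck k (\<lambda>z. 0)"
  by (induction k) (auto simp: frechet_derivative_const)

lemma Ck_sum:
  assumes "finite A" "\<And>i. i \<in> A \<Longrightarrow> Ck k (f i)"
  shows "Ck k (\<lambda>z. \<Sum>i\<in>A. c i * f i z)"
  using assms
proof (induction A rule: finite_induct)
  case empty
  then show ?case using Ck_zero by simp
next
  case (insert i A)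
  have "Ck k (\<lambda>z. c i * f i z + (\<Sum>i\<in>A. c i * f i z))"
    by (rule Ck_scale_add) (use insert in auto)
  then show ?case using insert by simp
qed

lemma dir_deriv_basis:
  assumes "Ck (Suc k) f"
  shows "dir_deriv a f z = (\<Sum>b\<in>Basis. (a \<bullet> b) * dir_deriv b f z)"
proof -
  have lin: "linear (frechet_derivative f (at z))"
    using Ck_has_derivative[OF assms] by (rule has_derivative_linear)
  have "dir_deriv a f z = frechet_derivative f (at z) (\<Sum>b\<in>Basis. (a \<bullet> b) *\<^sub>R b)"
    by (simp add: euclidean_representation)
  also have "\<dots> = (\<Sum>b\<in>Basis. (a \<bullet> b) * dir_deriv b f z)"
    by (simp add: linear_sum[OF lin] linear_cmul[OF lin])
  finally show ?thesis .
qed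

text \<open>\<open>Ck\<close> controls derivatives along basis vectors only, while the waves are
  built from skew space-time directions such as \<open>(m, 1)\<close>. Linearity of the derivative
  bridges the two.\<close>

lemma Ck_dir_deriv:
  assumes "Ck (Suc k) f"
  shows "Ck k (dir_deriv a f)"
proof -
  have "Ck k (\<lambda>z. \<Sum>b\<in>Basis. (a \<bullet> b) * dir_deriv b f z)"
    by (rule Ck_sum) (use assms in auto)
  moreover have "dir_deriv a f = (\<lambda>z. \<Sum>b\<in>Basis. (a \<bullet> b) * dir_deriv b f z)"
    by (rule ext) (rule dir_deriv_basis[OF assms])
  ultimately show ?thesis by simp
qed

lemma Ck_continuous: "Ck k f \<Longrightarrow> continuous_on A f"
proof -
  assume "Ck k f"
  then have "continuous_on UNIV f"
    by (cases k) (simp_all add: differentiable_imp_continuous_on)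
  then show ?thesis by (rule continuous_on_subset) simp
qed

lemma second_difference_mean_value:
  fixes f :: "'a::euclidean_space \<Rightarrow> real"
  assumes "Ck 2 f" "0 < s"
  obtains p q where "0 < p" "p < s" "0 < q" "q < s"
    "f (z + s *\<^sub>R a + s *\<^sub>R b) - f (z + s *\<^sub>R a) - (f (z + s *\<^sub>R b) - f z)
      = s * s * dir_deriv b (dir_deriv a f) (z + p *\<^sub>R a + q *\<^sub>R b)"
proof -
  have f1: "Ck (Suc (Suc 0)) f" using assms(1) by (simp add: numeral_2_eq_2)
  define g where "g t = f (z + t *\<^sub>R a + s *\<^sub>R b) - f (z + t *\<^sub>R a)" for t
  have "(g has_real_derivative dir_deriv a f (z + t *\<^sub>R a + s *\<^sub>R b) - dir_deriv a f (z + t *\<^sub>R a)) (at t)" for t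
  proof -
    have "((\<lambda>t. f ((z + s *\<^sub>R b) + t *\<^sub>R a)) has_real_derivative dir_deriv a f ((z + s *\<^sub>R b) + t *\<^sub>R a)) (at t)"
      by (rule has_real_derivative_along_line[OF Ck_has_derivative[OF f1]])
    moreover have "((\<lambda>t. f (z + t *\<^sub>R a)) has_real_derivative dir_deriv a f (z + t *\<^sub>R a)) (at t)"
      by (rule has_real_derivative_along_line[OF Ck_has_derivative[OF f1]])
    ultimately show ?thesis unfolding g_def
      by (auto intro!: derivative_eq_intros simp: add_ac)
  qed
  then obtain p where p: "0 < p" "p < s"
    "g s - g 0 = (s - 0) * (dir_deriv a f (z + p *\<^sub>R a + s *\<^sub>R b) - dir_deriv a f (z + p *\<^sub>R a))"
    using MVT2[OF assms(2), of g "\<lambda>t. dir_deriv a f (z + t *\<^sub>R a + s *\<^sub>R b) - dir_deriv a f (z + t *\<^sub>R a)"] by blast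
  have "((\<lambda>t. dir_deriv a f ((z + p *\<^sub>R a) + t *\<^sub>R b)) has_real_derivative
      dir_deriv b (dir_deriv a f) ((z + p *\<^sub>R a) + t *\<^sub>R b)) (at t)" for t
    by (rule has_real_derivative_along_line[OF Ck_has_derivative[OF Ck_dir_deriv[OF f1]]])
  then obtain q where q: "0 < q" "q < s"
    "dir_deriv a f (z + p *\<^sub>R a + s *\<^sub>R b) - dir_deriv a f (z + p *\<^sub>R a + 0 *\<^sub>R b)
      = (s - 0) * dir_deriv b (dir_deriv a f) (z + p *\<^sub>R a + q *\<^sub>R b)"
    using MVT2[OF assms(2), of "\<lambda>t. dir_deriv a f ((z + p *\<^sub>R a) + t *\<^sub>R b)"
      "\<lambda>t. dir_deriv b (dir_deriv a f) ((z + p *\<^sub>R a) + t *\<^sub>R b)"] by blast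
  show ?thesis
    by (rule that[OF p(1,2) q(1,2)]) (use p(3) q(3) in \<open>simp add: g_def algebra_simps\<close>)
qed

text \<open>The second difference over the parallelogram spanned by \<open>s a\<close> and
  \<open>s b\<close> is symmetric in \<open>a\<close> and \<open>b\<close>. Divided by the square of
  \<open>s\<close>, it tends to either mixed derivative, by two mean value theorems and
  continuity.\<close>

lemma dir_deriv_commute:
  fixes f :: "'a::euclidean_space \<Rightarrow> real"
  assumes "Ck 2 f"
  shows "dir_deriv a (dir_deriv b f) z = dir_deriv b (dir_deriv a f) z"
proof -
  define S where "S a b s = f (z + s *\<^sub>R a + s *\<^sub>R b) - f (z + s *\<^sub>R a) - (f (z + s *\<^sub>R b) - f z)" for a b and s :: real
  have lim: "(\<lambda>n. S a b (inverse (real (Suc n))) / (inverse (real (Suc n)))^2) \<longlonglongrightarrow> dir_deriv b (dir_deriv a f) z" for a b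
  proof -
    let ?s = "\<lambda>n. inverse (real (Suc n))"
    have "\<exists>p q. 0 < p \<and> p < ?s n \<and> 0 < q \<and> q < ?s n \<and>
      S a b (?s n) = ?s n * ?s n * dir_deriv b (dir_deriv a f) (z + p *\<^sub>R a + q *\<^sub>R b)" for n
      using second_difference_mean_value[OF assms, of "?s n" z a b] unfolding S_def
      by (metis inverse_positive_iff_positive of_nat_0_less_iff zero_less_Suc)
    then obtain p q where pq: "\<And>n. 0 < p n" "\<And>n. p n < ?s n" "\<And>n. 0 < q n" "\<And>n. q n < ?s n"
      "\<And>n. S a b (?s n) = ?s n * ?s n * dir_deriv b (dir_deriv a f) (z + p n *\<^sub>R a + q n *\<^sub>R b)"
      by metis
    have "p \<longlonglongrightarrow> 0" "q \<longlonglongrightarrow> 0"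
      by (rule tendsto_sandwich[OF _ _ tendsto_const LIMSEQ_inverse_real_of_nat];
          use pq(1-4) in \<open>auto intro!: always_eventually less_imp_le\<close>)+
    then have "(\<lambda>n. z + p n *\<^sub>R a + q n *\<^sub>R b) \<longlonglongrightarrow> z + 0 *\<^sub>R a + 0 *\<^sub>R b"
      by (intro tendsto_intros)
    moreover have "continuous_on UNIV (dir_deriv b (dir_deriv a f))"
      using assms by (intro Ck_continuous[of 0] Ck_dir_deriv) (simp add: numeral_2_eq_2)
    ultimately have "(\<lambda>n. dir_deriv b (dir_deriv a f) (z + p n *\<^sub>R a + q n *\<^sub>R b)) \<longlonglongrightarrow> dir_deriv b (dir_deriv a f) z"
      by (auto simp: continuous_on_eq_continuous_at intro!: isCont_tendsto_compose[where g="dir_deriv b (dir_deriv a f)"])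
    moreover have "S a b (?s n) / (?s n)^2 = dir_deriv b (dir_deriv a f) (z + p n *\<^sub>R a + q n *\<^sub>R b)" for n
      unfolding pq(5) by (simp add: power2_eq_square)
    ultimately show ?thesis by simp
  qed
  have "S a b s = S b a s" for s by (simp add: S_def add_ac)
  then show ?thesis using lim[of a b] lim[of b a] LIMSEQ_unique by auto
qed

lemma test_function_Ck: "test_function \<phi> \<Longrightarrow> Ck k \<phi>"
  by (simp add: test_function_def)

lemma test_function_linear: "test_function \<phi> \<Longrightarrow> linear (frechet_derivative \<phi> (at z))"
  using Ck_has_derivative[OF test_function_Ck] has_derivative_linear by blast

lemma test_function_dir_deriv_continuous:
  "test_function \<phi> \<Longrightarrow> continuous_on A (dir_deriv b \<phi>)"
  by (rule Ck_continuous[of 0], rule Ck_dir_deriv, erule test_function_Ck)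

text \<open>The potential is only twice differentiable, so its third derivatives cannot be permuted
  directly. Once both derivatives are moved to the test function, they stand next to its own
  derivative along \<open>c\<close>, and there all three may be permuted.\<close>

lemma integral_second_derivative_test:
  fixes \<Phi> \<phi> :: "'a::euclidean_space \<Rightarrow> real"
  assumes "\<And>z. (\<Phi> has_derivative (\<lambda>h. \<Phi>1 h z)) (at z)"
    and "\<And>h z. (\<Phi>1 h has_derivative (\<lambda>k. \<Phi>2 h k z)) (at z)"
    and "\<And>h k. continuous_on UNIV (\<Phi>2 h k)"
    and supp: "bounded {z. \<Phi> z \<noteq> 0}" and \<phi>: "test_function \<phi>"
  shows "(\<integral>z. \<Phi>2 h k z * dir_deriv c \<phi> z \<partial>lborel)
    = (\<integral>z. \<Phi> z * dir_deriv h (dir_deriv k (dir_deriv c \<phi>)) z \<partial>lborel)"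
proof -
  have ck: "Ck k (dir_deriv c \<phi>)" "Ck k (dir_deriv b (dir_deriv c \<phi>))" for b c k
    by (intro Ck_dir_deriv test_function_Ck \<phi>)+
  have cont1: "continuous_on UNIV (\<Phi>1 h)" for h
    using assms(2) by (auto intro!: continuous_at_imp_continuous_on has_derivative_continuous)
  have "Cc (\<Phi>1 h)" for h
    using Cc_has_derivative[OF assms(1) cont1 supp] .
  then have supp1: "bounded {z. \<Phi>1 h z \<noteq> 0}" for h by (simp add: Cc_def)
  have "(\<integral>z. \<Phi>2 h k z * dir_deriv c \<phi> z \<partial>lborel) = - (\<integral>z. \<Phi>1 h z * dir_deriv k (dir_deriv c \<phi>) z \<partial>lborel)"
    by (rule integration_by_parts_directional[OF assms(2,3) _ _ supp1])
      (auto intro: Ck_has_derivative[OF ck(1)] Ck_continuous[OF ck(2)])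
  also have "(\<integral>z. \<Phi>1 h z * dir_deriv k (dir_deriv c \<phi>) z \<partial>lborel)
    = - (\<integral>z. \<Phi> z * dir_deriv h (dir_deriv k (dir_deriv c \<phi>)) z \<partial>lborel)"
    by (rule integration_by_parts_directional[OF assms(1) cont1 _ _ supp])
      (auto intro: Ck_has_derivative[OF ck(2)] Ck_continuous[OF Ck_dir_deriv[OF ck(2)]])
  finally show ?thesis by simp
qed

lemma dir_deriv3_commute:
  assumes "test_function \<phi>"
  shows "dir_deriv a (dir_deriv b (dir_deriv c \<phi>)) = dir_deriv b (dir_deriv a (dir_deriv c \<phi>))"
    "dir_deriv a (dir_deriv b (dir_deriv c \<phi>)) = dir_deriv a (dir_deriv c (dir_deriv b \<phi>))"
proof -
  have ck: "Ck 2 (dir_deriv c \<phi>)" by (intro Ck_dir_deriv test_function_Ck assms)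
  show "dir_deriv a (dir_deriv b (dir_deriv c \<phi>)) = dir_deriv b (dir_deriv a (dir_deriv c \<phi>))"
    using dir_deriv_commute[OF ck] by blast
  have "dir_deriv b (dir_deriv c \<phi>) = dir_deriv c (dir_deriv b \<phi>)"
    using dir_deriv_commute[OF test_function_Ck[OF assms]] by blast
  then show "dir_deriv a (dir_deriv b (dir_deriv c \<phi>)) = dir_deriv a (dir_deriv c (dir_deriv b \<phi>))"
    by simp
qed

section \<open>Oscillating potentials\<close>

lemma has_real_derivative_pos_part_power:
  "((\<lambda>s. (max 0 s) ^ Suc (Suc n)) has_real_derivative real (Suc (Suc n)) * (max 0 s) ^ Suc n) (at s)"
proof -
  consider "s < 0" | "0 < s" | "s = 0" by linarith
  then show ?thesis
  proof cases
    case 1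
    have "((\<lambda>s. 0) has_real_derivative 0) (at s)" by simp
    then have "((\<lambda>s. (max 0 s) ^ Suc (Suc n)) has_real_derivative 0) (at s)"
      by (rule has_field_derivative_transform_within_open[of _ _ _ "{..<0}"]) (use 1 in auto)
    then show ?thesis using 1 by simp
  next
    case 2
    have "((\<lambda>s. s ^ Suc (Suc n)) has_real_derivative real (Suc (Suc n)) * s ^ Suc n) (at s)"
      using DERIV_pow[of "Suc (Suc n)" s] by simp
    then have "((\<lambda>s. (max 0 s) ^ Suc (Suc n)) has_real_derivative real (Suc (Suc n)) * s ^ Suc n) (at s)"
      by (rule has_field_derivative_transform_within_open[of _ _ _ "{0<..}"]) (use 2 in auto)
    then show ?thesis using 2 by simp
  next
    case 3
    have "((\<lambda>h. (max 0 h) ^ Suc (Suc n) / h) \<longlongrightarrow> 0) (at (0::real))"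
    proof (rule Lim_null_comparison)
      show "\<forall>\<^sub>F h in at 0. norm ((max 0 h) ^ Suc (Suc n) / h) \<le> \<bar>h\<bar> ^ Suc n"
      proof (rule always_eventually, rule allI)
        fix h :: real
        show "norm ((max 0 h) ^ Suc (Suc n) / h) \<le> \<bar>h\<bar> ^ Suc n"
          by (cases "h > 0") (simp_all add: max_absorb1 max_absorb2 del: power_Suc, simp)
      qed
      have "((\<lambda>h. \<bar>h\<bar> ^ Suc n) \<longlongrightarrow> \<bar>0::real\<bar> ^ Suc n) (at 0)"
        by (intro tendsto_intros)
      then show "((\<lambda>h. \<bar>h\<bar> ^ Suc n) \<longlongrightarrow> (0::real)) (at 0)" by simp
    qed
    then show ?thesis using 3 by (simp add: DERIV_def)
  qed
qed

lemma integrable_indicator_cbox: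
  "integrable lborel (indicator (cbox a b) :: 'a::euclidean_space \<Rightarrow> real)"
  by (rule integrable_real_indicator) (use emeasure_bounded_finite[OF bounded_cbox, of a b] in auto)

text \<open>Two derivatives suffice, since the wave fields are second derivatives of a potential and
  only have to be continuous. This permits the explicit cutoff \<open>(max 0 q) ^ 3\<close>, whose
  mass can be bounded below by a fixed fraction of the volume of the box, whatever its
  shape.\<close>

lemma bump_on_box:
  fixes a b :: "'a::euclidean_space"
  assumes ab: "\<And>i. i \<in> Basis \<Longrightarrow> a \<bullet> i < b \<bullet> i"
  obtains \<kappa> \<kappa>1 \<kappa>2 where
    "\<And>z. (\<kappa> has_derivative (\<lambda>h. \<kappa>1 h z)) (at z)"
    "\<And>h z. (\<kappa>1 h has_derivative (\<lambda>k. \<kappa>2 h k z)) (at z)"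
    "\<And>h k. continuous_on UNIV (\<kappa>2 h k)"
    "\<And>z. 0 \<le> \<kappa> z" "\<And>z. \<kappa> z \<le> 1" "\<And>z. z \<notin> box a b \<Longrightarrow> \<kappa> z = (0::real)"
    "\<And>h z. z \<notin> box a b \<Longrightarrow> \<kappa>1 h z = 0" "\<And>h k z. z \<notin> box a b \<Longrightarrow> \<kappa>2 h k z = 0"
    "(3/4)^6 / (2 * real DIM('a)) ^ DIM('a) * measure lborel (cbox a b) \<le> (\<integral>z. (\<kappa> z)\<^sup>2 \<partial>lborel)"
proof -
  \<comment> \<open>Affine coordinates that map the box to the cube of side 2 centred at 0;
    \<open>q\<close> is then positive exactly on the inscribed ellipsoid.\<close>
  define y where "y i z = (2 * (z \<bullet> i) - (a + b) \<bullet> i) / ((b - a) \<bullet> i)" for i z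
  define y' where "y' i h = 2 * (h \<bullet> i) / ((b - a) \<bullet> i)" for i h
  define q where "q z = 1 - (\<Sum>i\<in>Basis. (y i z)\<^sup>2)" for z
  define q1 where "q1 h z = - (\<Sum>i\<in>Basis. 2 * y i z * y' i h)" for h z
  define q2 where "q2 h k = - (\<Sum>i\<in>Basis. 2 * y' i k * y' i h)" for h k
  define \<kappa> where "\<kappa> z = (max 0 (q z)) ^ 3" for z
  define \<kappa>1 where "\<kappa>1 h z = 3 * (max 0 (q z))\<^sup>2 * q1 h z" for h z
  define \<kappa>2 where "\<kappa>2 h k z = 6 * max 0 (q z) * q1 k z * q1 h z + 3 * (max 0 (q z))\<^sup>2 * q2 h k" for h k z
  have l: "0 < (b - a) \<bullet> i" if "i \<in> Basis" for i using ab[OF that] by (simp add: inner_diff_left)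
  have dy: "(y i has_derivative y' i) (at z)" if "i \<in> Basis" for i z
    unfolding y_def y'_def divide_inverse
    by (auto intro!: derivative_eq_intros)
  have dq: "(q has_derivative (\<lambda>h. q1 h z)) (at z)" for z
    unfolding q_def q1_def
    by (auto intro!: derivative_eq_intros dy simp: mult_ac)
  have dq1: "(q1 h has_derivative (\<lambda>k. q2 h k)) (at z)" for h z
    unfolding q1_def q2_def
    by (auto intro!: derivative_eq_intros dy simp: mult_ac)
  have p3: "((\<lambda>s. (max 0 s) ^ 3) has_real_derivative 3 * (max 0 s)\<^sup>2) (at s)" for s :: real
    using has_real_derivative_pos_part_power[of 1 s] by (simp add: numeral_eq_Suc)
  have p2: "((\<lambda>s. (max 0 s)\<^sup>2) has_real_derivative 2 * max 0 s) (at s)" for s :: real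
    using has_real_derivative_pos_part_power[of 0 s] by (simp add: numeral_eq_Suc)
  have d0: "(\<kappa> has_derivative (\<lambda>h. \<kappa>1 h z)) (at z)" for z
    using has_derivative_compose[OF dq p3[unfolded has_field_derivative_def]]
    by (simp add: \<kappa>_def[abs_def] \<kappa>1_def)
  have d2: "((\<lambda>z. (max 0 (q z))\<^sup>2) has_derivative (\<lambda>k. 2 * max 0 (q z) * q1 k z)) (at z)" for z
    using has_derivative_compose[OF dq p2[unfolded has_field_derivative_def]] by simp
  have d1: "(\<kappa>1 h has_derivative (\<lambda>k. \<kappa>2 h k z)) (at z)" for h z
    unfolding \<kappa>1_def \<kappa>2_def
    by (rule has_derivative_eq_rhs, rule has_derivative_mult[OF has_derivative_mult_right[OF d2] dq1])
      (auto simp: algebra_simps)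
  have cq: "continuous_on UNIV q" "continuous_on UNIV (q1 h)" for h
    using dq dq1 by (auto intro!: continuous_at_imp_continuous_on has_derivative_continuous)
  have c2: "continuous_on UNIV (\<kappa>2 h k)" for h k
    unfolding \<kappa>2_def by (intro continuous_intros cq)
  have q1: "q z \<le> 1" for z by (simp add: q_def sum_nonneg)
  have k01: "0 \<le> \<kappa> z" "\<kappa> z \<le> 1" for z
    using q1[of z] by (auto simp: \<kappa>_def power_le_one)
  have q0: "q z \<le> 0" if z: "z \<notin> box a b" for z
  proof -
    obtain i where i: "i \<in> Basis" "\<not> (a \<bullet> i < z \<bullet> i \<and> z \<bullet> i < b \<bullet> i)"
      using z unfolding mem_box by blast
    have "1 \<le> \<bar>y i z\<bar>"
      using i(2) l[OF i(1)] by (auto simp: y_def inner_diff_left inner_add_left abs_if field_simps)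
    then have "1 \<le> (y i z)\<^sup>2" using abs_le_square_iff[of 1 "y i z"] by simp
    also have "\<dots> \<le> (\<Sum>i\<in>Basis. (y i z)\<^sup>2)" using i(1) by (intro member_le_sum) auto
    finally show ?thesis by (simp add: q_def)
  qed
  have supp: "\<kappa> z = 0" "\<kappa>1 h z = 0" "\<kappa>2 h k z = 0" if "z \<notin> box a b" for h k z
    using q0[OF that] by (auto simp: \<kappa>_def \<kappa>1_def \<kappa>2_def max_def)
  let ?N = "real DIM('a)"
  have N: "1 \<le> ?N" using DIM_positive[where 'a='a] by linarith
  \<comment> \<open>On the concentric box with sides shrunk by \<open>2 * ?N\<close>, each
    \<open>y i\<close> is at most \<open>1 / (2 * ?N)\<close> in absolute value, so their squares
    add up to at most 1/4 and \<open>q\<close> is at least 3/4.\<close>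
  define c where "c = (1/2) *\<^sub>R (a + b)"
  define r where "r = (1 / (4 * ?N)) *\<^sub>R (b - a)"
  have inner_box: "(3/4) ^ 3 \<le> \<kappa> z" if z: "z \<in> cbox (c - r) (c + r)" for z
  proof -
    have "\<bar>y i z\<bar> \<le> 1 / (2 * ?N)" if i: "i \<in> Basis" for i
    proof -
      have "\<bar>z \<bullet> i - c \<bullet> i\<bar> \<le> r \<bullet> i"
        using z i by (auto simp: mem_box inner_diff_left inner_add_left abs_le_iff algebra_simps)
      then have "2 * \<bar>z \<bullet> i - c \<bullet> i\<bar> / ((b - a) \<bullet> i) \<le> 2 * ((b - a) \<bullet> i / (4 * ?N)) / ((b - a) \<bullet> i)"
        using l[OF i] by (intro divide_right_mono mult_left_mono) (auto simp: r_def)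
      moreover have "\<bar>y i z\<bar> = 2 * \<bar>z \<bullet> i - c \<bullet> i\<bar> / ((b - a) \<bullet> i)"
      proof -
        have eq: "y i z = 2 * (z \<bullet> i - c \<bullet> i) / ((b - a) \<bullet> i)"
          by (simp add: y_def c_def algebra_simps)
        show ?thesis unfolding eq abs_divide abs_mult using l[OF i] by simp
      qed
      ultimately show ?thesis using l[OF i] by simp
    qed
    then have "(y i z)\<^sup>2 \<le> (1 / (2 * ?N))\<^sup>2" if "i \<in> Basis" for i
      using that abs_le_square_iff by fastforce
    then have "(\<Sum>i\<in>Basis. (y i z)\<^sup>2) \<le> ?N * (1 / (2 * ?N))\<^sup>2"
      using sum_bounded_above[of Basis "\<lambda>i. (y i z)\<^sup>2"] by force
    also have "\<dots> \<le> 1/4" using N by (simp add: power2_eq_square field_simps)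
    finally have "3/4 \<le> q z" by (simp add: q_def)
    then show ?thesis unfolding \<kappa>_def by (intro power_mono) auto
  qed
  have ck: "Cc \<kappa>"
    by (rule Cc_box[of _ a b]) (use d0 supp(1) in \<open>auto intro!: continuous_at_imp_continuous_on has_derivative_continuous\<close>)
  have le: "a \<bullet> i \<le> b \<bullet> i" "(c - r) \<bullet> i \<le> (c + r) \<bullet> i" if "i \<in> Basis" for i
  proof -
    show "a \<bullet> i \<le> b \<bullet> i" using ab[OF that] by simp
    have "0 \<le> r \<bullet> i" using l[OF that] N by (simp add: r_def)
    then show "(c - r) \<bullet> i \<le> (c + r) \<bullet> i" by (simp add: inner_diff_left inner_add_left)
  qed
  have vol: "measure lborel (cbox (c - r) (c + r)) = measure lborel (cbox a b) / (2 * ?N) ^ DIM('a)"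
  proof -
    have "measure lborel (cbox (c - r) (c + r)) = (\<Prod>i\<in>Basis. (c + r) \<bullet> i - (c - r) \<bullet> i)"
      by (subst content_cbox) (use le in auto)
    also have "\<dots> = (\<Prod>i\<in>Basis. ((b \<bullet> i - a \<bullet> i) / (2 * ?N)))"
      by (intro prod.cong) (auto simp: r_def inner_diff_left inner_add_left diff_divide_distrib)
    also have "\<dots> = measure lborel (cbox a b) / (2 * ?N) ^ DIM('a)"
      by (subst content_cbox) (use le in \<open>auto simp: prod_dividef\<close>)
    finally show ?thesis .
  qed
  have "(3/4)^6 / (2 * ?N) ^ DIM('a) * measure lborel (cbox a b)
      = (\<integral>z. (3/4)^6 * indicator (cbox (c - r) (c + r)) z \<partial>lborel)"
    by (simp add: vol)
  also have "\<dots> \<le> (\<integral>z. (\<kappa> z)\<^sup>2 \<partial>lborel)"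
  proof (rule integral_mono)
    show "integrable lborel (\<lambda>z. (3/4)^6 * indicator (cbox (c - r) (c + r)) z :: real)"
      by (intro integrable_mult_right integrable_indicator_cbox)
    show "integrable lborel (\<lambda>z. (\<kappa> z)\<^sup>2)"
      by (intro Cc_integrable Cc_subset[OF ck]) (auto intro!: continuous_intros Cc_continuous[OF ck])
    show "(3/4)^6 * indicator (cbox (c - r) (c + r)) z \<le> (\<kappa> z)\<^sup>2" for z
      using power_mono[OF inner_box[of z], of 2] by (auto simp: indicator_def power_divide)
  qed
  finally show ?thesis
    using that[OF d0 d1 c2 k01 supp] by simp
qed

text \<open>\<open>P l h k\<close> is the second derivative along \<open>h\<close> and
  \<open>k\<close> of one scalar potential, so integrals against first derivatives of test functions
  are symmetric in all three directions. For large \<open>l\<close> every derivative that falls on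
  the cutoff instead of the cosine costs a factor \<open>1 / l\<close>.\<close>

lemma modulated_potential:
  fixes \<kappa> :: "'a::euclidean_space \<Rightarrow> real"
  assumes k1: "\<And>z. (\<kappa> has_derivative (\<lambda>h. \<kappa>1 h z)) (at z)"
    and k2: "\<And>h z. (\<kappa>1 h has_derivative (\<lambda>k. \<kappa>2 h k z)) (at z)"
    and ck2: "\<And>h k. continuous_on UNIV (\<kappa>2 h k)"
    and supp: "\<And>z. z \<notin> box a b \<Longrightarrow> \<kappa> z = 0" "\<And>h z. z \<notin> box a b \<Longrightarrow> \<kappa>1 h z = 0"
      "\<And>h k z. z \<notin> box a b \<Longrightarrow> \<kappa>2 h k z = 0"
  obtains P where
    "\<And>l h k. continuous_on UNIV (P l h k)"
    "\<And>l h k z. z \<notin> box a b \<Longrightarrow> P l h k z = 0"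
    "\<And>l h k c \<phi>. test_function \<phi> \<Longrightarrow>
       (\<integral>z. P l h k z * dir_deriv c \<phi> z \<partial>lborel) = (\<integral>z. P l k h z * dir_deriv c \<phi> z \<partial>lborel)"
    "\<And>l h k c \<phi>. test_function \<phi> \<Longrightarrow>
       (\<integral>z. P l h k z * dir_deriv c \<phi> z \<partial>lborel) = (\<integral>z. P l h c z * dir_deriv k \<phi> z \<partial>lborel)"
    "\<And>h k. \<exists>C>0. \<forall>l\<ge>1. \<forall>z. \<bar>P l h k z - (\<xi> \<bullet> h) * (\<xi> \<bullet> k) * (\<kappa> z * cos (l * (\<xi> \<bullet> z)))\<bar> \<le> C / l"
proof -
  \<comment> \<open>The factor and the sign normalise the second derivatives: differentiating the
    cosine twice produces \<open>l\<^sup>2\<close> and another minus sign.\<close>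
  define \<Phi> where "\<Phi> l z = - (\<kappa> z * cos (l * (\<xi> \<bullet> z))) / l\<^sup>2" for l z
  define \<Phi>1 where "\<Phi>1 l h z = - (\<kappa>1 h z * cos (l * (\<xi> \<bullet> z)) - l * (\<xi> \<bullet> h) * (\<kappa> z * sin (l * (\<xi> \<bullet> z)))) / l\<^sup>2" for l h z
  define P where "P l h k z = - (\<kappa>2 h k z * cos (l * (\<xi> \<bullet> z)) - l * (\<xi> \<bullet> k) * (\<kappa>1 h z * sin (l * (\<xi> \<bullet> z)))
    - l * (\<xi> \<bullet> h) * (\<kappa>1 k z * sin (l * (\<xi> \<bullet> z))) - (l * (\<xi> \<bullet> h)) * (l * (\<xi> \<bullet> k)) * (\<kappa> z * cos (l * (\<xi> \<bullet> z)))) / l\<^sup>2" for l h k z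
  have dc: "((\<lambda>z. cos (l * (\<xi> \<bullet> z))) has_derivative (\<lambda>h. - (l * (\<xi> \<bullet> h)) * sin (l * (\<xi> \<bullet> z)))) (at z)" for l z
    by (auto intro!: derivative_eq_intros)
  have ds: "((\<lambda>z. sin (l * (\<xi> \<bullet> z))) has_derivative (\<lambda>h. (l * (\<xi> \<bullet> h)) * cos (l * (\<xi> \<bullet> z)))) (at z)" for l z
    by (auto intro!: derivative_eq_intros)
  have D1: "(\<Phi> l has_derivative (\<lambda>h. \<Phi>1 l h z)) (at z)" for l z
    unfolding \<Phi>_def \<Phi>1_def divide_inverse
    by (rule has_derivative_eq_rhs, rule has_derivative_mult_left[OF has_derivative_minus[OF has_derivative_mult[OF k1 dc]]])
      (auto simp: algebra_simps)
  have D2: "(\<Phi>1 l h has_derivative (\<lambda>k. P l h k z)) (at z)" for l h z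
    unfolding P_def \<Phi>1_def divide_inverse
    by (rule has_derivative_eq_rhs, rule has_derivative_mult_left[OF has_derivative_minus[OF has_derivative_diff[OF
          has_derivative_mult[OF k2 dc] has_derivative_mult_right[OF has_derivative_mult[OF k1 ds]]]]])
      (auto simp: algebra_simps)
  have ck1: "continuous_on UNIV (\<kappa>1 h)" and ck: "continuous_on UNIV \<kappa>" for h
    using k1 k2 by (auto intro!: continuous_at_imp_continuous_on has_derivative_continuous)
  have bsupp: "bounded {z. \<kappa> z \<noteq> 0}"
    using supp(1) by (auto intro!: bounded_subset[OF bounded_box[of a b]])
  have C1: "Cc (\<kappa>1 h)" for h by (rule Cc_box[OF ck1 supp(2)])
  have C2: "Cc (\<kappa>2 h k)" for h k by (rule Cc_box[OF ck2 supp(3)])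
  show ?thesis
  proof (rule that[of P])
    show cP: "continuous_on UNIV (P l h k)" for l h k
      unfolding P_def divide_inverse by (intro continuous_intros ck ck1 ck2)
    show "P l h k z = 0" if "z \<notin> box a b" for l h k z
      using supp that by (simp add: P_def)
    fix l :: real and h k c \<phi> assume \<phi>: "test_function (\<phi> :: 'a \<Rightarrow> real)"
    have "bounded {z. \<Phi> l z \<noteq> 0}"
      using bsupp by (rule bounded_subset) (auto simp: \<Phi>_def)
    note I = integral_second_derivative_test[OF D1 D2 cP this \<phi>]
    show "(\<integral>z. P l h k z * dir_deriv c \<phi> z \<partial>lborel) = (\<integral>z. P l k h z * dir_deriv c \<phi> z \<partial>lborel)"
      unfolding I using dir_deriv3_commute(1)[OF \<phi>] by metis
    show "(\<integral>z. P l h k z * dir_deriv c \<phi> z \<partial>lborel) = (\<integral>z. P l h c z * dir_deriv k \<phi> z \<partial>lborel)"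
      unfolding I using dir_deriv3_commute(2)[OF \<phi>] by metis
  next
    fix h k
    obtain A where A: "0 < A" "\<And>z. norm (\<kappa>2 h k z) \<le> A" using Cc_bounded[OF C2] by metis
    obtain B where B: "0 < B" "\<And>z. norm (\<kappa>1 h z) \<le> B" using Cc_bounded[OF C1] by metis
    obtain D where D: "0 < D" "\<And>z. norm (\<kappa>1 k z) \<le> D" using Cc_bounded[OF C1] by metis
    define C where "C = A + \<bar>\<xi> \<bullet> k\<bar> * B + \<bar>\<xi> \<bullet> h\<bar> * D"
    have "0 < C" using A(1) B(1) D(1) by (auto simp: C_def intro!: add_pos_nonneg)
    moreover have "\<bar>P l h k z - (\<xi> \<bullet> h) * (\<xi> \<bullet> k) * (\<kappa> z * cos (l * (\<xi> \<bullet> z)))\<bar> \<le> C / l" if "1 \<le> l" for l z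
    proof -
      have "P l h k z - (\<xi> \<bullet> h) * (\<xi> \<bullet> k) * (\<kappa> z * cos (l * (\<xi> \<bullet> z)))
        = - (\<kappa>2 h k z * cos (l * (\<xi> \<bullet> z))) / l\<^sup>2 + ((\<xi> \<bullet> k) * (\<kappa>1 h z * sin (l * (\<xi> \<bullet> z)))) / l
          + ((\<xi> \<bullet> h) * (\<kappa>1 k z * sin (l * (\<xi> \<bullet> z)))) / l"
        using that by (simp add: P_def field_simps power2_eq_square)
      also have "\<bar>\<dots>\<bar> \<le> \<bar>- (\<kappa>2 h k z * cos (l * (\<xi> \<bullet> z))) / l\<^sup>2\<bar> + \<bar>((\<xi> \<bullet> k) * (\<kappa>1 h z * sin (l * (\<xi> \<bullet> z)))) / l\<bar>
          + \<bar>((\<xi> \<bullet> h) * (\<kappa>1 k z * sin (l * (\<xi> \<bullet> z)))) / l\<bar>"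
        by (rule order_trans[OF abs_triangle_ineq add_right_mono[OF abs_triangle_ineq]])
      also have "\<dots> \<le> A / l + (\<bar>\<xi> \<bullet> k\<bar> * B) / l + (\<bar>\<xi> \<bullet> h\<bar> * D) / l"
      proof (intro add_mono)
        have "\<bar>\<kappa>2 h k z\<bar> * \<bar>cos (l * (\<xi> \<bullet> z))\<bar> \<le> A * 1" using A by (intro mult_mono) auto
        moreover have "l \<le> l\<^sup>2" using that by (simp add: power2_eq_square)
        ultimately have "\<bar>\<kappa>2 h k z\<bar> * \<bar>cos (l * (\<xi> \<bullet> z))\<bar> / l\<^sup>2 \<le> A / l"
          using that A(1) by (intro frac_le) auto
        then show "\<bar>- (\<kappa>2 h k z * cos (l * (\<xi> \<bullet> z))) / l\<^sup>2\<bar> \<le> A / l" by (simp add: abs_mult)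
        have "\<bar>\<kappa>1 h z\<bar> * \<bar>sin (l * (\<xi> \<bullet> z))\<bar> \<le> B * 1" using B by (intro mult_mono) auto
        then show "\<bar>((\<xi> \<bullet> k) * (\<kappa>1 h z * sin (l * (\<xi> \<bullet> z)))) / l\<bar> \<le> (\<bar>\<xi> \<bullet> k\<bar> * B) / l"
          using that by (simp add: abs_mult divide_right_mono mult_left_mono)
        have "\<bar>\<kappa>1 k z\<bar> * \<bar>sin (l * (\<xi> \<bullet> z))\<bar> \<le> D * 1" using D by (intro mult_mono) auto
        then show "\<bar>((\<xi> \<bullet> h) * (\<kappa>1 k z * sin (l * (\<xi> \<bullet> z)))) / l\<bar> \<le> (\<bar>\<xi> \<bullet> h\<bar> * D) / l"
          using that by (simp add: abs_mult divide_right_mono mult_left_mono)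
      qed
      also have "\<dots> = C / l" by (simp add: C_def add_divide_distrib)
      finally show ?thesis .
    qed
    ultimately show "\<exists>C>0. \<forall>l\<ge>1. \<forall>z. \<bar>P l h k z - (\<xi> \<bullet> h) * (\<xi> \<bullet> k) * (\<kappa> z * cos (l * (\<xi> \<bullet> z)))\<bar> \<le> C / l"
      by blast
  qed
qed

section \<open>Localized plane waves\<close>

definition outer :: "real^'n \<Rightarrow> real^'n \<Rightarrow> real^'n^'n" where
  "outer x y = (\<chi> i j. x $ i * y $ j)"

lemma outer_nth [simp]: "outer x y $ i = (x $ i) *\<^sub>R y"
  by (simp add: outer_def vec_eq_iff)

lemma norm_outer_le: "norm (outer x y) \<le> norm x * norm y"
proof -
  have "norm (outer x y) = L2_set (\<lambda>i. \<bar>x $ i\<bar> * norm y) UNIV"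
    by (simp add: norm_vec_def[of "outer x y"])
  also have "\<dots> = L2_set (\<lambda>i. \<bar>x $ i\<bar>) UNIV * norm y"
    by (rule L2_set_left_distrib[symmetric]) simp
  finally show ?thesis by (simp add: norm_vec_def[of x])
qed

text \<open>The row \<open>(\<omega> $ i, w $ i)\<close> is the space-time flux of the \<open>i\<close>-th momentum; any pressure is
  absorbed in \<open>\<omega>\<close>.\<close>

definition linear_euler :: "((real ^ 'n) \<times> real \<Rightarrow> real ^ 'n) \<Rightarrow> ((real ^ 'n) \<times> real \<Rightarrow> real ^ 'n ^ 'n) \<Rightarrow> bool" where
  "linear_euler w \<omega> \<longleftrightarrow> Cc w \<and> Cc \<omega> \<and> (\<forall>z i j. \<omega> z $ i $ j = \<omega> z $ j $ i) \<and>
    (\<forall>\<phi>. test_function \<phi> \<longrightarrow>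
      (\<forall>i. (\<integral>z. frechet_derivative \<phi> (at z) (\<omega> z $ i, w z $ i) \<partial>lborel) = 0) \<and>
      (\<integral>z. frechet_derivative \<phi> (at z) (w z, 0) \<partial>lborel) = 0)"

lemma frechet_derivative_test_continuous:
  assumes "test_function \<phi>" "continuous_on UNIV g"
  shows "continuous_on UNIV (\<lambda>z. frechet_derivative \<phi> (at z) (g z))"
proof -
  have "frechet_derivative \<phi> (at z) (g z) = (\<Sum>b\<in>Basis. (g z \<bullet> b) * dir_deriv b \<phi> z)" for z
    using dir_deriv_basis[OF test_function_Ck[OF assms(1)]] by blast
  then show ?thesis
    by (auto intro!: continuous_intros assms(2) test_function_dir_deriv_continuous[OF assms(1)])
qed

lemma frechet_derivative_test_Cc:
  assumes "test_function \<phi>" "Cc g"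
  shows "Cc (\<lambda>z. frechet_derivative \<phi> (at z) (g z))"
  by (rule Cc_subset[OF assms(2) frechet_derivative_test_continuous[OF assms(1) Cc_continuous[OF assms(2)]]])
    (simp add: linear_0[OF test_function_linear[OF assms(1)]])

lemma Cc_row: "Cc w \<Longrightarrow> Cc \<omega> \<Longrightarrow> Cc (\<lambda>z. (\<omega> z $ i, w z $ i))"
proof -
  assume w: "Cc w" and o: "Cc \<omega>"
  have "Cc (\<lambda>z. (\<omega> z, w z))"
  proof -
    have "bounded ({z. w z \<noteq> 0} \<union> {z. \<omega> z \<noteq> 0})" using w o by (simp add: Cc_def)
    then have "bounded {z. (\<omega> z, w z) \<noteq> 0}" by (rule bounded_subset) (auto simp: zero_prod_def)
    with w o show ?thesis by (auto simp: Cc_def intro!: continuous_intros)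
  qed
  moreover have "continuous_on UNIV (\<lambda>z. (\<omega> z $ i, w z $ i))"
    by (intro continuous_intros Cc_continuous w o)
  ultimately show ?thesis
    by (rule Cc_subset) (auto simp: zero_prod_def)
qed

lemma Cc_space: "Cc w \<Longrightarrow> Cc (\<lambda>z. (w z, 0::real))"
  by (rule Cc_subset, assumption) (auto intro!: continuous_intros intro: Cc_continuous simp: zero_prod_def)

lemma linear_euler_add:
  assumes "linear_euler w \<omega>" "linear_euler w' \<omega>'"
  shows "linear_euler (\<lambda>z. w z + w' z) (\<lambda>z. \<omega> z + \<omega>' z)"
proof -
  have c: "Cc w" "Cc \<omega>" "Cc w'" "Cc \<omega>'" using assms by (auto simp: linear_euler_def)
  have "(\<integral>z. frechet_derivative \<phi> (at z) ((\<omega> z + \<omega>' z) $ i, (w z + w' z) $ i) \<partial>lborel) = 0"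
    if \<phi>: "test_function \<phi>" for \<phi> i
  proof -
    have "frechet_derivative \<phi> (at z) ((\<omega> z + \<omega>' z) $ i, (w z + w' z) $ i)
      = frechet_derivative \<phi> (at z) (\<omega> z $ i, w z $ i) + frechet_derivative \<phi> (at z) (\<omega>' z $ i, w' z $ i)" for z
      using linear_add[OF test_function_linear[OF \<phi>], of z "(\<omega> z $ i, w z $ i)" "(\<omega>' z $ i, w' z $ i)"] by simp
    then show ?thesis
      using assms \<phi> by (simp add: linear_euler_def Bochner_Integration.integral_add
          Cc_integrable[OF frechet_derivative_test_Cc[OF \<phi> Cc_row]])
  qed
  moreover have "(\<integral>z. frechet_derivative \<phi> (at z) (w z + w' z, 0) \<partial>lborel) = 0"
    if \<phi>: "test_function \<phi>" for \<phi>
  proof -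
    have "frechet_derivative \<phi> (at z) (w z + w' z, 0)
      = frechet_derivative \<phi> (at z) (w z, 0) + frechet_derivative \<phi> (at z) (w' z, 0)" for z
      using linear_add[OF test_function_linear[OF \<phi>], of z "(w z, 0)" "(w' z, 0)"] by simp
    then show ?thesis
      using assms \<phi> by (simp add: linear_euler_def Bochner_Integration.integral_add
          Cc_integrable[OF frechet_derivative_test_Cc[OF \<phi> Cc_space]])
  qed
  ultimately show ?thesis using assms c by (auto simp: linear_euler_def intro!: Cc_add)
qed

lemma linear_euler_scale:
  assumes "linear_euler w \<omega>"
  shows "linear_euler (\<lambda>z. c *\<^sub>R w z) (\<lambda>z. c *\<^sub>R \<omega> z)"
proof -
  have c: "Cc w" "Cc \<omega>" using assms by (auto simp: linear_euler_def)
  have "Cc (\<lambda>z. c *\<^sub>R w z)" "Cc (\<lambda>z. c *\<^sub>R \<omega> z)"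
    by (intro Cc_scaleR_const c)+
  moreover have "frechet_derivative \<phi> (at z) ((c *\<^sub>R \<omega> z) $ i, (c *\<^sub>R w z) $ i)
      = c * frechet_derivative \<phi> (at z) (\<omega> z $ i, w z $ i)"
    "frechet_derivative \<phi> (at z) (c *\<^sub>R w z, 0) = c * frechet_derivative \<phi> (at z) (w z, 0)"
    if "test_function \<phi>" for \<phi> z i
    using linear_cmul[OF test_function_linear[OF that], of z c "(\<omega> z $ i, w z $ i)"]
      linear_cmul[OF test_function_linear[OF that], of z c "(w z, 0)"] by (simp_all add: scaleR_Pair)
  ultimately show ?thesis using assms by (simp add: linear_euler_def)
qed

lemma linear_euler_zero: "linear_euler (\<lambda>_. 0 :: real^'n) (\<lambda>_. 0)"
proof -
  have "dir_deriv (0, 0) \<phi> = (\<lambda>z. 0)" if "test_function \<phi>" for \<phi> :: "(real^'n) \<times> real \<Rightarrow> real"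
    using linear_0[OF test_function_linear[OF that]] by (auto simp: zero_prod_def)
  then show ?thesis by (simp add: linear_euler_def Cc_def)
qed

lemma linear_euler_sum:
  assumes "finite A" "\<And>k. k \<in> A \<Longrightarrow> linear_euler (w k) (\<omega> k)"
  shows "linear_euler (\<lambda>z. \<Sum>k\<in>A. w k z) (\<lambda>z. \<Sum>k\<in>A. \<omega> k z)"
  using assms by (induction A rule: finite_induct) (auto intro: linear_euler_zero linear_euler_add)

text \<open>A divergence-free wave with velocity amplitude \<open>f\<close> has to oscillate in a
  spatial direction orthogonal to \<open>f\<close>.\<close>

lemma exists_unit_orthogonal:
  assumes "2 \<le> CARD('n::finite)"
  obtains e :: "real^'n" where "norm e = 1" "e \<bullet> f = 0"
proof -
  have "2 \<le> DIM(real^'n)" using assms by simp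
  then obtain y :: "real^'n" where "y \<noteq> 0" "orthogonal f y" using orthogonal_to_vector_exists by metis
  then show ?thesis
    by (intro that[of "y /\<^sub>R norm y"]) (auto simp: orthogonal_def inner_commute)
qed

text \<open>With \<open>F = (f,0)\<close>, \<open>E = (e,0)\<close>, \<open>M = (m,1)\<close>, the space-time matrix is the symmetrised product of the
  first-order operators \<open>F \<partial>\<^sub>E - E \<partial>\<^sub>F\<close> and \<open>M \<partial>\<^sub>E - E \<partial>\<^sub>M\<close> applied to a scalar potential; each factor is
  annihilated by the space-time divergence, and the first one has no time component.\<close>

lemma potential_linear_euler:
  fixes P :: "(real^'n) \<times> real \<Rightarrow> (real^'n) \<times> real \<Rightarrow> (real^'n) \<times> real \<Rightarrow> real" and f e m :: "real^'n"
  assumes cont: "\<And>h k. continuous_on UNIV (P h k)"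
    and supp: "\<And>h k z. z \<notin> box a b \<Longrightarrow> P h k z = 0"
    and sym1: "\<And>h k c \<phi>. test_function \<phi> \<Longrightarrow>
       (\<integral>z. P h k z * dir_deriv c \<phi> z \<partial>lborel) = (\<integral>z. P k h z * dir_deriv c \<phi> z \<partial>lborel)"
    and sym2: "\<And>h k c \<phi>. test_function \<phi> \<Longrightarrow>
       (\<integral>z. P h k z * dir_deriv c \<phi> z \<partial>lborel) = (\<integral>z. P h c z * dir_deriv k \<phi> z \<partial>lborel)"
  defines "F \<equiv> (f, 0)" and "E \<equiv> (e, 0)" and "M \<equiv> (m, 1)"
  shows "linear_euler (\<lambda>z. P E E z *\<^sub>R f - P E F z *\<^sub>R e)
    (\<lambda>z. P E E z *\<^sub>R (outer f m + outer m f) - P E M z *\<^sub>R (outer f e + outer e f)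
      - P E F z *\<^sub>R (outer e m + outer m e) + (2 * P F M z) *\<^sub>R outer e e)"
    (is "linear_euler ?w ?\<omega>")
proof -
  have row: "(?\<omega> z $ i, ?w z $ i) =
      P E E z *\<^sub>R (f $ i *\<^sub>R M + m $ i *\<^sub>R F) - P E M z *\<^sub>R (f $ i *\<^sub>R E + e $ i *\<^sub>R F)
      - P E F z *\<^sub>R (e $ i *\<^sub>R M + m $ i *\<^sub>R E) + (2 * P F M z) *\<^sub>R (e $ i *\<^sub>R E)" for z i
    by (simp add: F_def E_def M_def scaleR_Pair)
  have int: "integrable lborel (\<lambda>z. P h k z * dir_deriv c \<phi> z)" if "test_function \<phi>" for h k c \<phi>
    by (intro Cc_integrable Cc_mult_left Cc_box[OF cont supp] test_function_dir_deriv_continuous that)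
  have "(\<integral>z. frechet_derivative \<phi> (at z) (?\<omega> z $ i, ?w z $ i) \<partial>lborel) = 0" if \<phi>: "test_function \<phi>" for \<phi> i
  proof -
    note lin = test_function_linear[OF \<phi>]
    have "frechet_derivative \<phi> (at z) (?\<omega> z $ i, ?w z $ i) =
        f $ i * (P E E z * dir_deriv M \<phi> z) + m $ i * (P E E z * dir_deriv F \<phi> z)
        - f $ i * (P E M z * dir_deriv E \<phi> z) - e $ i * (P E M z * dir_deriv F \<phi> z)
        - e $ i * (P E F z * dir_deriv M \<phi> z) - m $ i * (P E F z * dir_deriv E \<phi> z)
        + 2 * e $ i * (P F M z * dir_deriv E \<phi> z)" for z
      unfolding row by (simp add: linear_add[OF lin] linear_diff[OF lin] linear_cmul[OF lin] algebra_simps)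
    \<comment> \<open>By the weak symmetry of the three directions, the coefficients of
      \<open>f $ i\<close>, \<open>m $ i\<close> and \<open>e $ i\<close> cancel separately. For
      \<open>e $ i\<close> the balance is -1 - 1 + 2, which explains the factor 2 in front of
      \<open>P F M\<close>.\<close>
    moreover have "(\<integral>z. P E E z * dir_deriv M \<phi> z \<partial>lborel) = (\<integral>z. P E M z * dir_deriv E \<phi> z \<partial>lborel)"
      "(\<integral>z. P E E z * dir_deriv F \<phi> z \<partial>lborel) = (\<integral>z. P E F z * dir_deriv E \<phi> z \<partial>lborel)"
      "(\<integral>z. P E M z * dir_deriv F \<phi> z \<partial>lborel) = (\<integral>z. P E F z * dir_deriv M \<phi> z \<partial>lborel)"
      "(\<integral>z. P F M z * dir_deriv E \<phi> z \<partial>lborel) = (\<integral>z. P E F z * dir_deriv M \<phi> z \<partial>lborel)"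
      using sym1[OF \<phi>] sym2[OF \<phi>] by metis+
    ultimately show ?thesis by (simp add: int[OF \<phi>])
  qed
  moreover have "(\<integral>z. frechet_derivative \<phi> (at z) (?w z, 0) \<partial>lborel) = 0" if \<phi>: "test_function \<phi>" for \<phi>
  proof -
    note lin = test_function_linear[OF \<phi>]
    have "(?w z, 0) = P E E z *\<^sub>R F - P E F z *\<^sub>R E" for z
      by (simp add: F_def E_def scaleR_Pair)
    then have "frechet_derivative \<phi> (at z) (?w z, 0) = P E E z * dir_deriv F \<phi> z - P E F z * dir_deriv E \<phi> z" for z
      by (simp add: linear_diff[OF lin] linear_cmul[OF lin])
    moreover have "(\<integral>z. P E E z * dir_deriv F \<phi> z \<partial>lborel) = (\<integral>z. P E F z * dir_deriv E \<phi> z \<partial>lborel)"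
      using sym2[OF \<phi>] by metis
    ultimately show ?thesis by (simp add: int[OF \<phi>])
  qed
  moreover have "Cc ?w" "Cc ?\<omega>"
    by (rule Cc_box[of _ a b]; auto intro!: continuous_intros cont simp: supp)+
  moreover have "?\<omega> z $ i $ j = ?\<omega> z $ j $ i" for z i j by (simp add: algebra_simps)
  ultimately show ?thesis by (simp add: linear_euler_def)
qed

text \<open>A single high frequency serves all the claims: the cutoff errors decay like its inverse,
  the mean of the squared cosine gives the energy, and the Riemann-Lebesgue lemma gives
  near-orthogonality to the finitely many members of \<open>H\<close>.\<close>

lemma localized_wave:
  fixes a b :: "(real^'n) \<times> real" and f m :: "real^'n"
  assumes card: "2 \<le> CARD('n)"
    and ab: "\<And>i. i \<in> Basis \<Longrightarrow> a \<bullet> i < b \<bullet> i"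
    and f: "norm f = 1" "m \<bullet> f = 0" and \<delta>: "0 < \<delta>" and \<epsilon>: "0 < \<epsilon>"
    and H: "finite H" "\<And>g. g \<in> H \<Longrightarrow> Cc (g :: (real^'n) \<times> real \<Rightarrow> real^'n)"
  defines "N \<equiv> DIM((real^'n) \<times> real)"
  obtains w \<omega> where "linear_euler w \<omega>"
    "\<And>z. z \<notin> box a b \<Longrightarrow> w z = 0" "\<And>z. z \<notin> box a b \<Longrightarrow> \<omega> z = 0"
    "\<And>z. \<exists>s. \<bar>s\<bar> \<le> 1 \<and> norm (w z - (s * \<delta>) *\<^sub>R f) \<le> \<epsilon> \<and> norm (\<omega> z - (s * \<delta>) *\<^sub>R (outer f m + outer m f)) \<le> \<epsilon>"
    "\<delta>\<^sup>2 * ((3/4)^6 / (4 * (2 * real N) ^ N)) * measure lborel (cbox a b) \<le> (\<integral>z. w z \<bullet> w z \<partial>lborel)"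
    "\<And>g. g \<in> H \<Longrightarrow> \<bar>\<integral>z. w z \<bullet> g z \<partial>lborel\<bar> \<le> \<epsilon>"
proof -
  obtain e :: "real^'n" where e: "norm e = 1" "e \<bullet> f = 0" using exists_unit_orthogonal[OF card] by metis
  have ee: "e \<bullet> e = 1" "f \<bullet> f = 1" "f \<bullet> e = 0" using e f by (auto simp: norm_eq_sqrt_inner inner_commute)
  \<comment> \<open>The phase \<open>\<xi>\<close> is orthogonal to \<open>F\<close> and
    \<open>M\<close> and has product 1 with \<open>E\<close>. Hence only \<open>P l E E\<close> has
    a nonvanishing leading term, and the unwanted terms containing \<open>e\<close> in the potential
    construction are of order \<open>1 / l\<close>.\<close>
  define F E M \<xi> where "F = (f, 0::real)" and "E = (e, 0::real)" and "M = (m, 1::real)" and "\<xi> = (e, - (m \<bullet> e))"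
  have \<xi>: "\<xi> \<bullet> E = 1" "\<xi> \<bullet> F = 0" "\<xi> \<bullet> M = 0" "\<xi> \<noteq> 0"
    using ee by (auto simp: \<xi>_def E_def F_def M_def e inner_commute zero_prod_def)
  obtain \<kappa> \<kappa>1 \<kappa>2 where \<kappa>: 
    "\<And>z. (\<kappa> has_derivative (\<lambda>h. \<kappa>1 h z)) (at z)"
    "\<And>h z. (\<kappa>1 h has_derivative (\<lambda>k. \<kappa>2 h k z)) (at z)"
    "\<And>h k. continuous_on UNIV (\<kappa>2 h k)"
    "\<And>z. 0 \<le> \<kappa> z" "\<And>z. \<kappa> z \<le> 1" "\<And>z. z \<notin> box a b \<Longrightarrow> \<kappa> z = (0::real)"
    "\<And>h z. z \<notin> box a b \<Longrightarrow> \<kappa>1 h z = 0" "\<And>h k z. z \<notin> box a b \<Longrightarrow> \<kappa>2 h k z = 0"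
    "(3/4)^6 / (2 * real N) ^ N * measure lborel (cbox a b) \<le> (\<integral>z. (\<kappa> z)\<^sup>2 \<partial>lborel)"
    unfolding N_def by (rule bump_on_box[of a b, OF ab]) blast+
  obtain P where P:
    "\<And>l h k. continuous_on UNIV (P l h k)"
    "\<And>l h k z. z \<notin> box a b \<Longrightarrow> P l h k z = 0"
    "\<And>l h k c \<phi>. test_function \<phi> \<Longrightarrow>
       (\<integral>z. P l h k z * dir_deriv c \<phi> z \<partial>lborel) = (\<integral>z. P l k h z * dir_deriv c \<phi> z \<partial>lborel)"
    "\<And>l h k c \<phi>. test_function \<phi> \<Longrightarrow>
       (\<integral>z. P l h k z * dir_deriv c \<phi> z \<partial>lborel) = (\<integral>z. P l h c z * dir_deriv k \<phi> z \<partial>lborel)"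
    "\<And>h k. \<exists>C>0. \<forall>l\<ge>1. \<forall>z. \<bar>P l h k z - (\<xi> \<bullet> h) * (\<xi> \<bullet> k) * (\<kappa> z * cos (l * (\<xi> \<bullet> z)))\<bar> \<le> C / l"
    by (rule modulated_potential[where \<kappa>=\<kappa> and \<xi>=\<xi> and a=a and b=b, OF \<kappa>(1,2,3,6,7,8)]) (assumption | rule that)+
  define w where "w l z = \<delta> *\<^sub>R (P l E E z *\<^sub>R f - P l E F z *\<^sub>R e)" for l z
  define \<omega> where "\<omega> l z = \<delta> *\<^sub>R (P l E E z *\<^sub>R (outer f m + outer m f) - P l E M z *\<^sub>R (outer f e + outer e f)
      - P l E F z *\<^sub>R (outer e m + outer m e) + (2 * P l F M z) *\<^sub>R outer e e)" for l z
  have le: "linear_euler (w l) (\<omega> l)" for l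
    unfolding w_def \<omega>_def E_def F_def M_def
    by (intro linear_euler_scale potential_linear_euler P)
  define u where "u l z = \<kappa> z * cos (l * (\<xi> \<bullet> z))" for l z
  obtain C1 where C1: "0 < C1" "\<And>l z. 1 \<le> l \<Longrightarrow> \<bar>P l E E z - u l z\<bar> \<le> C1 / l"
    using P(5)[of E E] \<xi> by (auto simp: u_def)
  obtain C2 where C2: "0 < C2" "\<And>l z. 1 \<le> l \<Longrightarrow> \<bar>P l E F z\<bar> \<le> C2 / l"
    using P(5)[of E F] \<xi> by auto
  obtain C3 where C3: "0 < C3" "\<And>l z. 1 \<le> l \<Longrightarrow> \<bar>P l E M z\<bar> \<le> C3 / l"
    using P(5)[of E M] \<xi> by auto
  obtain C4 where C4: "0 < C4" "\<And>l z. 1 \<le> l \<Longrightarrow> \<bar>P l F M z\<bar> \<le> C4 / l"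
    using P(5)[of F M] \<xi> by auto
  define K1 where "K1 = \<delta> * (C1 + C2)"
  define K2 where "K2 = \<delta> * (C1 * norm (outer f m + outer m f) + C3 * norm (outer f e + outer e f)
    + C2 * norm (outer e m + outer m e) + 2 * C4 * norm (outer e e))"
  have u1: "\<bar>u l z\<bar> \<le> 1" for l z
    using \<kappa>(4)[of z] \<kappa>(5)[of z] abs_cos_le_one[of "l * (\<xi> \<bullet> z)"]
    by (simp add: u_def abs_mult mult_le_one)
  have w_err: "norm (w l z - (u l z * \<delta>) *\<^sub>R f) \<le> K1 / l" if l: "1 \<le> l" for l z
  proof -
    have "w l z - (u l z * \<delta>) *\<^sub>R f = \<delta> *\<^sub>R ((P l E E z - u l z) *\<^sub>R f - P l E F z *\<^sub>R e)"
      by (simp add: w_def algebra_simps)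
    also have "norm \<dots> \<le> \<delta> * (\<bar>P l E E z - u l z\<bar> + \<bar>P l E F z\<bar>)"
      using \<delta> e f norm_triangle_ineq4[of "(P l E E z - u l z) *\<^sub>R f" "P l E F z *\<^sub>R e"] by simp
    also have "\<dots> \<le> \<delta> * (C1 / l + C2 / l)"
      using \<delta> C1(2)[OF l] C2(2)[OF l] by (intro mult_left_mono add_mono) auto
    finally show ?thesis by (simp add: K1_def add_divide_distrib[symmetric])
  qed
  have \<omega>_err: "norm (\<omega> l z - (u l z * \<delta>) *\<^sub>R (outer f m + outer m f)) \<le> K2 / l" if l: "1 \<le> l" for l z
  proof -
    let ?A = "outer f m + outer m f" and ?B = "outer f e + outer e f" and ?C = "outer e m + outer m e"
    have "\<omega> l z - (u l z * \<delta>) *\<^sub>R ?A = \<delta> *\<^sub>R ((P l E E z - u l z) *\<^sub>R ?A - P l E M z *\<^sub>R ?B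
        - P l E F z *\<^sub>R ?C + (2 * P l F M z) *\<^sub>R outer e e)"
      by (simp add: \<omega>_def scaleR_left_diff_distrib scaleR_right_diff_distrib scaleR_add_right mult.commute)
    also have "norm \<dots> \<le> \<delta> * (\<bar>P l E E z - u l z\<bar> * norm ?A + \<bar>P l E M z\<bar> * norm ?B
        + \<bar>P l E F z\<bar> * norm ?C + 2 * \<bar>P l F M z\<bar> * norm (outer e e))"
    proof -
      have tri: "norm (x - y - z + v) \<le> norm x + norm y + norm z + norm v" for x y z v :: "real^'n^'n"
        by (intro norm_triangle_le add_right_mono norm_triangle_le_diff) simp
      show ?thesis using \<delta> by (auto intro!: mult_left_mono order_trans[OF tri])
    qed
    also have "\<dots> \<le> \<delta> * (C1 / l * norm ?A + C3 / l * norm ?B + C2 / l * norm ?C + 2 * (C4 / l) * norm (outer e e))"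
      using \<delta> C1(2)[OF l] C2(2)[OF l] C3(2)[OF l] C4(2)[OF l]
      by (intro mult_left_mono add_mono mult_right_mono) auto
    finally show ?thesis by (simp add: K2_def add_divide_distrib[symmetric])
  qed
  have small: "\<forall>\<^sub>F l in at_top. K / l < r" if "0 < r" for K r :: real
  proof -
    have "((\<lambda>l. K / l) \<longlongrightarrow> 0) at_top"
      by (intro tendsto_divide_0[OF tendsto_const] filterlim_at_top_imp_at_infinity filterlim_ident)
    then show ?thesis using that by (rule order_tendstoD)
  qed
  have ck: "continuous_on UNIV \<kappa>"
    using \<kappa>(1) by (auto intro!: continuous_at_imp_continuous_on has_derivative_continuous)
  have Ck: "Cc \<kappa>" by (rule Cc_box[OF ck \<kappa>(6)])
  have Cu: "Cc (u l)" for l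
    unfolding u_def by (intro Cc_mult_left Ck continuous_intros)
  have Cw: "Cc (w l)" for l using le by (auto simp: linear_euler_def)
  define A where "A = (\<integral>z. (\<kappa> z)\<^sup>2 \<partial>lborel)"
  have vol: "0 < measure lborel (cbox a b)" using ab by (simp add: content_pos_lt)
  have "0 < real N" by (simp add: N_def)
  then have A: "0 < A" using \<kappa>(9) vol by (auto simp: A_def intro!: less_le_trans[OF _ \<kappa>(9)] mult_pos_pos divide_pos_pos)
  have energy: "\<forall>\<^sub>F l in at_top. \<delta>\<^sup>2 * (A / 4) \<le> (\<integral>z. w l z \<bullet> w l z \<partial>lborel)"
  proof -
    have Ck2: "Cc (\<lambda>z. (\<kappa> z)\<^sup>2)" by (rule Cc_subset[OF Ck]) (auto intro!: continuous_intros ck)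
    \<comment> \<open>The oscillating half of the squared cosine; it has twice the phase.\<close>
    define R where "R l = (\<integral>z. (\<kappa> z)\<^sup>2 * cos (l * ((2 *\<^sub>R \<xi>) \<bullet> z)) \<partial>lborel)" for l
    have "(R \<longlongrightarrow> 0) at_top" unfolding R_def by (rule Riemann_Lebesgue_cos[OF Ck2]) (use \<xi> in simp)
    then have "\<forall>\<^sub>F l in at_top. - (A / 4) < R l" by (rule order_tendstoD) (use A in simp)
    moreover have "\<forall>\<^sub>F l in at_top. 2 * C1 * measure lborel (cbox a b) / l < A / 8"
      by (rule small) (use A in simp)
    ultimately show ?thesis using eventually_ge_at_top[of 1]
    proof eventually_elim
      case (elim l)
      have "u l z * u l z = (1/2) * (\<kappa> z)\<^sup>2 + (1/2) * ((\<kappa> z)\<^sup>2 * cos (l * ((2 *\<^sub>R \<xi>) \<bullet> z)))" for z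
      proof -
        have "cos (l * ((2 *\<^sub>R \<xi>) \<bullet> z)) = 2 * (cos (l * (\<xi> \<bullet> z)))\<^sup>2 - 1"
          using cos_double_cos[of "l * (\<xi> \<bullet> z)"] by (simp add: mult.left_commute)
        then have "(1/2) * (\<kappa> z)\<^sup>2 + (1/2) * ((\<kappa> z)\<^sup>2 * cos (l * ((2 *\<^sub>R \<xi>) \<bullet> z))) = (\<kappa> z)\<^sup>2 * (cos (l * (\<xi> \<bullet> z)))\<^sup>2"
          by (simp only:) (simp add: algebra_simps)
        then show ?thesis by (simp add: u_def power2_eq_square mult_ac)
      qed
      then have uu: "(\<integral>z. u l z * u l z \<partial>lborel) = (1/2) * A + (1/2) * R l"
        by (simp add: A_def R_def Cc_integrable[OF Ck2] Cc_integrable[OF Cc_mult_left[OF Ck2]] continuous_intros)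
      let ?I = "\<lambda>z. indicator (cbox a b) z :: real"
      have iI: "integrable lborel ?I" by (rule integrable_indicator_cbox)
      have iuu: "integrable lborel (\<lambda>z. u l z * u l z)"
        by (intro Cc_integrable Cc_mult_left Cu Cc_continuous)
      have iww: "integrable lborel (\<lambda>z. w l z \<bullet> w l z)"
        by (intro Cc_integrable Cc_inner Cw Cc_continuous)
      \<comment> \<open>From \<open>A / 2\<close>, the oscillating term takes at most
        \<open>A / 8\<close> and the error in the amplitude at most another
        \<open>A / 8\<close>.\<close>
      have "\<delta>\<^sup>2 * (A / 4) \<le> \<delta>\<^sup>2 * ((1/2) * A + (1/2) * R l - 2 * C1 / l * measure lborel (cbox a b))"
        using elim A by (intro mult_left_mono) auto
      also have "\<dots> = (\<integral>z. \<delta>\<^sup>2 * (u l z * u l z - 2 * C1 / l * ?I z) \<partial>lborel)"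
        using iI iuu uu by simp
      also have "\<dots> \<le> (\<integral>z. w l z \<bullet> w l z \<partial>lborel)"
      proof (rule integral_mono)
        show "\<delta>\<^sup>2 * (u l z * u l z - 2 * C1 / l * ?I z) \<le> w l z \<bullet> w l z" for z
        proof (cases "z \<in> box a b")
          case True
          then have I: "?I z = 1" using box_subset_cbox[of a b] by auto
          \<comment> \<open>Expanding the square of \<open>u l z - p\<close> gives
            \<open>p * p\<close> at least \<open>u l z * u l z - 2 * (u l z * (u l z - p))\<close>,
            and \<open>u\<close> is bounded by 1, so the loss is at most
            \<open>2 * C1 / l\<close>.\<close>
          define p where "p = P l E E z"
          have "\<bar>u l z * (u l z - p)\<bar> \<le> 1 * (C1 / l)"
            unfolding abs_mult using u1[of l z] C1(2)[of l z] elim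
            by (intro mult_mono) (auto simp: p_def abs_minus_commute)
          then have "u l z * u l z - 2 * C1 / l \<le> p * p"
          proof -
            have "u l z * u l z - u l z * p \<le> C1 / l"
              using \<open>\<bar>u l z * (u l z - p)\<bar> \<le> 1 * (C1 / l)\<close> by (simp add: right_diff_distrib abs_le_iff)
            moreover have "2 * (u l z * p) \<le> u l z * u l z + p * p"
              using zero_le_square[of "u l z - p"] by (simp add: algebra_simps)
            moreover have "2 * C1 / l = 2 * (C1 / l)" by simp
            ultimately show ?thesis by linarith
          qed
          moreover have "w l z \<bullet> w l z = \<delta>\<^sup>2 * (p * p + P l E F z * P l E F z)"
            using ee by (simp add: w_def p_def inner_diff_left inner_diff_right power2_eq_square e algebra_simps)
          moreover have "u l z * u l z - 2 * C1 / l * ?I z \<le> p * p + P l E F z * P l E F z"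
            using calculation(1) zero_le_square[of "P l E F z"] unfolding I by linarith
          ultimately show ?thesis using mult_left_mono[of _ _ "\<delta>\<^sup>2"] by simp
        next
          case False
          have "0 \<le> \<delta>\<^sup>2 * (2 * C1 / l * ?I z)" using C1 elim by simp
          then show ?thesis using False P(2)[OF False] \<kappa>(6)[OF False] by (simp add: u_def w_def)
        qed
      qed (use iI iuu iww in simp_all)
      finally show ?case .
    qed
  qed
  have inner: "\<forall>\<^sub>F l in at_top. \<forall>g\<in>H. \<bar>\<integral>z. w l z \<bullet> g z \<partial>lborel\<bar> \<le> \<epsilon>"
  proof (intro eventually_ball_finite H(1) ballI)
    fix g assume "g \<in> H"
    then have g: "Cc g" by (rule H(2))
    \<comment> \<open>The amplitude of the leading part of \<open>w l z \<bullet> g z\<close>; what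
      remains is bounded by \<open>K1 / l\<close> times the norm of \<open>g z\<close>.\<close>
    define G where "G z = \<delta> * (\<kappa> z * (f \<bullet> g z))" for z
    have CG: "Cc G" unfolding G_def
      by (intro Cc_mult_right[of _ "\<lambda>_. \<delta>"] Cc_mult_left Ck continuous_intros Cc_continuous g)
    define R where "R l = (\<integral>z. G z * cos (l * (\<xi> \<bullet> z)) \<partial>lborel)" for l
    have "((\<lambda>l. \<bar>R l\<bar>) \<longlongrightarrow> 0) at_top"
      unfolding R_def using Riemann_Lebesgue_cos[OF CG \<xi>(4)] by (rule tendsto_rabs_zero)
    then have "\<forall>\<^sub>F l in at_top. \<bar>R l\<bar> < \<epsilon> / 2" by (rule order_tendstoD) (use \<epsilon> in simp)
    moreover have "\<forall>\<^sub>F l in at_top. K1 * (\<integral>z. norm (g z) \<partial>lborel) / l < \<epsilon> / 2"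
      by (rule small) (use \<epsilon> in simp)
    ultimately show "\<forall>\<^sub>F l in at_top. \<bar>\<integral>z. w l z \<bullet> g z \<partial>lborel\<bar> \<le> \<epsilon>"
      using eventually_ge_at_top[of 1]
    proof eventually_elim
      case (elim l)
      have ig: "integrable lborel (\<lambda>z. norm (g z))" by (intro integrable_norm Cc_integrable g)
      have iR: "integrable lborel (\<lambda>z. G z * cos (l * (\<xi> \<bullet> z)))"
        by (intro Cc_integrable Cc_mult_left CG continuous_intros)
      have iw: "integrable lborel (\<lambda>z. w l z \<bullet> g z)"
        by (intro Cc_integrable Cc_inner Cw Cc_continuous g)
      have eq: "w l z \<bullet> g z - G z * cos (l * (\<xi> \<bullet> z)) = (w l z - (u l z * \<delta>) *\<^sub>R f) \<bullet> g z" for z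
        by (simp add: G_def u_def inner_diff_left mult_ac)
      have "\<bar>(\<integral>z. w l z \<bullet> g z \<partial>lborel) - R l\<bar> = \<bar>\<integral>z. w l z \<bullet> g z - G z * cos (l * (\<xi> \<bullet> z)) \<partial>lborel\<bar>"
        using iR iw by (simp add: R_def)
      also have "\<dots> \<le> (\<integral>z. \<bar>w l z \<bullet> g z - G z * cos (l * (\<xi> \<bullet> z))\<bar> \<partial>lborel)"
        by (rule integral_abs_bound)
      also have "\<dots> \<le> (\<integral>z. K1 / l * norm (g z) \<partial>lborel)"
      proof (rule integral_mono)
        show "\<bar>w l z \<bullet> g z - G z * cos (l * (\<xi> \<bullet> z))\<bar> \<le> K1 / l * norm (g z)" for z
          unfolding eq using w_err[of l z] elim
          by (intro order_trans[OF Cauchy_Schwarz_ineq2] mult_right_mono) auto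
      qed (use iR iw ig in auto)
      also have "\<dots> = K1 * (\<integral>z. norm (g z) \<partial>lborel) / l" by simp
      finally show ?case using elim by linarith
    qed
  qed
  have "\<forall>\<^sub>F l in at_top. 1 \<le> l \<and> K1 / l < \<epsilon> \<and> K2 / l < \<epsilon> \<and> \<delta>\<^sup>2 * (A / 4) \<le> (\<integral>z. w l z \<bullet> w l z \<partial>lborel) \<and>
      (\<forall>g\<in>H. \<bar>\<integral>z. w l z \<bullet> g z \<partial>lborel\<bar> \<le> \<epsilon>)"
    by (intro eventually_conj eventually_ge_at_top small \<epsilon> energy inner)
  then obtain l where l: "1 \<le> l" "K1 / l < \<epsilon>" "K2 / l < \<epsilon>" "\<delta>\<^sup>2 * (A / 4) \<le> (\<integral>z. w l z \<bullet> w l z \<partial>lborel)"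
      "\<And>g. g \<in> H \<Longrightarrow> \<bar>\<integral>z. w l z \<bullet> g z \<partial>lborel\<bar> \<le> \<epsilon>"
    using eventually_happens'[OF trivial_limit_at_top_linorder] by blast
  show ?thesis
  proof (rule that[of "w l" "\<omega> l"])
    show "\<exists>s. \<bar>s\<bar> \<le> 1 \<and> norm (w l z - (s * \<delta>) *\<^sub>R f) \<le> \<epsilon> \<and> norm (\<omega> l z - (s * \<delta>) *\<^sub>R (outer f m + outer m f)) \<le> \<epsilon>" for z
      using u1[of l z] w_err[OF l(1), of z] \<omega>_err[OF l(1), of z] l(2,3)
      by (intro exI[of _ "u l z"]) auto
    have "\<delta>\<^sup>2 * ((3/4)^6 / (4 * (2 * real N) ^ N)) * measure lborel (cbox a b)
        = \<delta>\<^sup>2 * (((3/4)^6 / (2 * real N) ^ N * measure lborel (cbox a b)) / 4)" by simp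
    also have "\<dots> \<le> \<delta>\<^sup>2 * (A / 4)"
      using \<kappa>(9) by (intro mult_left_mono) (auto simp: A_def)
    finally show "\<delta>\<^sup>2 * ((3/4)^6 / (4 * (2 * real N) ^ N)) * measure lborel (cbox a b) \<le> (\<integral>z. w l z \<bullet> w l z \<partial>lborel)"
      using l(4) by linarith
  qed (use le P(2) l(5) in \<open>auto simp: w_def \<omega>_def\<close>)
qed

section \<open>Positive matrices and perturbations of the defect\<close>

definition quad :: "real^'n^'n \<Rightarrow> real^'n \<Rightarrow> real" where
  "quad A x = x \<bullet> (A *v x)"

lemma quad_diff: "quad (A - B) x = quad A x - quad B x"
  by (simp add: quad_def matrix_vector_mult_diff_rdistrib inner_diff_right)

lemma outer_mult_vec: "outer x y *v z = (y \<bullet> z) *\<^sub>R x"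
  by (simp add: vec_eq_iff matrix_vector_mul_component inner_commute mult.commute)

lemma norm_matrix_vector_mult_le: "norm ((A::real^'n^'m) *v x) \<le> norm A * norm x"
proof -
  have "norm (A *v x) \<le> L2_set (\<lambda>i. norm (A $ i) * norm x) UNIV"
    unfolding norm_vec_def[of "A *v x"]
    by (rule L2_set_mono) (simp_all add: matrix_vector_mul_component Cauchy_Schwarz_ineq2)
  also have "\<dots> = norm A * norm x"
    by (simp add: L2_set_left_distrib norm_vec_def[of A])
  finally show ?thesis .
qed

lemma abs_quad_le: "\<bar>quad A x\<bar> \<le> norm A * (x \<bullet> x)"
proof -
  have "\<bar>quad A x\<bar> \<le> norm x * norm (A *v x)"
    unfolding quad_def by (rule Cauchy_Schwarz_ineq2)
  also have "\<dots> \<le> norm x * (norm A * norm x)"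
    by (intro mult_left_mono norm_matrix_vector_mult_le) simp
  finally show ?thesis by (simp add: power2_norm_eq_inner[symmetric] power2_eq_square mult_ac)
qed

lemma trace_outer: "trace (outer x y) = x \<bullet> y"
  by (simp add: trace_def inner_vec_def)

lemma trace_scaleR: "trace (c *\<^sub>R A) = c * trace (A::real^'n^'n)"
  by (simp add: trace_def sum_distrib_left)

lemma abs_trace_le: "\<bar>trace (A::real^'n^'n)\<bar> \<le> CARD('n) * norm A"
proof -
  have "\<bar>trace A\<bar> \<le> (\<Sum>i\<in>UNIV. \<bar>A $ i $ i\<bar>)" unfolding trace_def by (rule sum_abs)
  also have "\<dots> \<le> (\<Sum>i\<in>(UNIV::'n set). norm A)"
    by (intro sum_mono order_trans[OF component_le_norm_cart Finite_Cartesian_Product.norm_nth_le])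
  finally show ?thesis by simp
qed

definition defect :: "real^'n \<Rightarrow> real^'n^'n \<Rightarrow> real^'n^'n" where
  "defect v \<sigma> = \<sigma> + mat (1 / CARD('n)) - outer v v"

lemma trace_defect: "trace (defect (v::real^'n) \<sigma>) = 1 + trace \<sigma> - v \<bullet> v"
  by (simp add: defect_def trace_add trace_sub trace_outer) (simp add: trace_def mat_def)

text \<open>The quadratic term is handled by telescoping: v' (x) v' - v (x) v = (v' - v) (x) v' + v
  (x) (v' - v).\<close>

lemma quad_defect_perturb:
  "quad (defect v \<sigma>) x - (norm (\<sigma>' - \<sigma>) + norm (v' - v) * (norm v' + norm v)) * (x \<bullet> x) \<le> quad (defect v' \<sigma>') x"
proof -
  have "defect v' \<sigma>' - defect v \<sigma> = (\<sigma>' - \<sigma>) - (outer (v' - v) v' + outer v (v' - v))"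
    by (simp add: defect_def vec_eq_iff algebra_simps)
  then have "norm (defect v' \<sigma>' - defect v \<sigma>) \<le> norm (\<sigma>' - \<sigma>) + (norm (v' - v) * norm v' + norm v * norm (v' - v))"
    by (auto intro!: order_trans[OF norm_triangle_ineq4] order_trans[OF norm_triangle_ineq] add_mono norm_outer_le)
  then have "norm (defect v' \<sigma>' - defect v \<sigma>) * (x \<bullet> x) \<le> (norm (\<sigma>' - \<sigma>) + norm (v' - v) * (norm v' + norm v)) * (x \<bullet> x)"
    by (intro mult_right_mono) (auto simp: algebra_simps)
  then show ?thesis
    using abs_quad_le[of "defect v' \<sigma>' - defect v \<sigma>" x] by (simp add: quad_diff abs_le_iff)
qed

text \<open>Some diagonal entry \<open>r\<close> is at least the average
  \<open>trace R / CARD('n)\<close>. For the corresponding basis vector \<open>e\<close>, the vector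
  \<open>g = R *v e\<close> satisfies the Cauchy-Schwarz inequality of the form
  \<open>quad R\<close>. Since the norm of \<open>g\<close> is at least \<open>r\<close>,
  normalising \<open>g\<close> can only improve the constant.\<close>

lemma positive_matrix_direction:
  fixes R :: "real^'n^'n"
  assumes sym: "\<And>i j. R $ i $ j = R $ j $ i" and \<eta>: "0 < \<eta>" and pos: "\<And>x. \<eta> * (x \<bullet> x) \<le> quad R x"
  obtains f where "norm f = 1" "\<And>x. trace R / CARD('n) * (f \<bullet> x)\<^sup>2 \<le> quad R x"
proof -
  obtain i where i: "trace R / CARD('n) \<le> R $ i $ i"
  proof (rule ccontr)
    assume *: "\<not> thesis"
    have "trace R < (\<Sum>i\<in>(UNIV::'n set). trace R / CARD('n))"
      unfolding trace_def[of R] by (rule sum_strict_mono) (use * that in \<open>auto simp: trace_def not_le[symmetric]\<close>)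
    then show False by simp
  qed
  define e where "e = (axis i 1 :: real^'n)"
  define g where "g = R *v e"
  define r where "r = R $ i $ i"
  have ge: "g \<bullet> e = r" by (simp add: g_def e_def r_def inner_axis matrix_vector_mul_component)
  have qe: "quad R e = r" using ge by (simp add: quad_def g_def inner_commute)
  have r: "0 < r" using pos[of e] \<eta> unfolding qe by (simp add: e_def)
  have "g = R $ i"
    by (simp add: vec_eq_iff g_def e_def matrix_vector_mul_component inner_axis) (metis sym)
  then have gx: "e \<bullet> (R *v x) = g \<bullet> x" for x
    by (simp add: e_def inner_axis' matrix_vector_mul_component)
  have CS: "(g \<bullet> x)\<^sup>2 \<le> quad R x * r" for x
  proof -
    \<comment> \<open>The usual proof of Cauchy-Schwarz: positivity is applied to \<open>r\<close>
      times the component of \<open>x\<close> that is orthogonal to \<open>e\<close> with respect to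
      the form \<open>R\<close>.\<close>
    have "0 \<le> \<eta> * ((r *\<^sub>R x - (g \<bullet> x) *\<^sub>R e) \<bullet> (r *\<^sub>R x - (g \<bullet> x) *\<^sub>R e))" using \<eta> by simp
    also have "\<dots> \<le> quad R (r *\<^sub>R x - (g \<bullet> x) *\<^sub>R e)" by (rule pos)
    also have "\<dots> = r * (r * quad R x - (g \<bullet> x)\<^sup>2)"
      using gx[of x] qe by (simp add: quad_def matrix_vector_mult_diff_distrib matrix_vector_mult_scaleR
          inner_diff_left inner_diff_right g_def[symmetric] ge inner_commute algebra_simps power2_eq_square)
    finally show ?thesis using r by (simp add: zero_le_mult_iff mult.commute)
  qed
  have "norm e = 1" by (simp add: e_def)
  then have ng: "r \<le> norm g" using norm_cauchy_schwarz[of g e] ge by simp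
  show ?thesis
  proof (rule that[of "g /\<^sub>R norm g"])
    show "norm (g /\<^sub>R norm g) = 1" using less_le_trans[OF r ng] by simp
    fix x
    have "trace R / CARD('n) * ((g /\<^sub>R norm g) \<bullet> x)\<^sup>2 \<le> r * ((g /\<^sub>R norm g) \<bullet> x)\<^sup>2"
      using i by (intro mult_right_mono) (auto simp: r_def)
    also have "\<dots> = r * ((g \<bullet> x)\<^sup>2 / (norm g)\<^sup>2)"
      by (simp add: power_mult_distrib divide_inverse mult.commute power_inverse)
    also have "\<dots> \<le> r * (quad R x * r / r\<^sup>2)"
      using r ng CS[of x] by (intro mult_left_mono frac_le power_mono) (auto intro: order_trans[OF zero_le_power2])
    also have "\<dots> = quad R x" using r by (simp add: power2_eq_square)
    finally show "trace R / CARD('n) * ((g /\<^sub>R norm g) \<bullet> x)\<^sup>2 \<le> quad R x" .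
  qed
qed

text \<open>Energy gained per unit volume and per squared trace. The first factor comes from the
  amplitude \<open>trace / (8 n)\<close>; \<open>(3/4)^6 / (2 * real N) ^ N\<close> bounds the mean
  of the squared cutoff from below; of the remaining 1/4, one half is the mean of the squared cosine
  and one half is given up to errors. The margin \<open>\<eta>\<close> does not enter.\<close>

definition gain :: "nat \<Rightarrow> nat \<Rightarrow> real" where
  "gain n N = (1 / (8 * real n))\<^sup>2 * ((3/4)^6 / (4 * (2 * real N) ^ N))"

lemma box_perturbation:
  fixes v0 :: "real^'n" and \<sigma>0 :: "real^'n^'n" and a b :: "(real^'n) \<times> real"
  assumes card: "2 \<le> CARD('n)"
    and sym: "\<And>i j. \<sigma>0 $ i $ j = \<sigma>0 $ j $ i"
    and \<eta>: "0 < \<eta>" "\<eta> \<le> 1/2" and pos: "\<And>x. \<eta> * (x \<bullet> x) \<le> quad (defect v0 \<sigma>0) x"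
    and tr: "\<bar>trace \<sigma>0\<bar> \<le> 1/2"
    and ab: "\<And>i. i \<in> Basis \<Longrightarrow> a \<bullet> i < b \<bullet> i" and \<epsilon>: "0 < \<epsilon>"
    and H: "finite H" "\<And>g. g \<in> H \<Longrightarrow> Cc (g :: (real^'n) \<times> real \<Rightarrow> real^'n)"
  obtains w \<omega> where "linear_euler w \<omega>"
    "\<And>z. z \<notin> box a b \<Longrightarrow> w z = 0" "\<And>z. z \<notin> box a b \<Longrightarrow> \<omega> z = 0"
    "\<And>z v \<sigma> x. norm (v - v0) \<le> \<eta> / (40 * real CARD('n)) \<Longrightarrow> norm (\<sigma> - \<sigma>0) \<le> \<eta> / (40 * real CARD('n))
      \<Longrightarrow> \<eta> / 4 * (x \<bullet> x) \<le> quad (defect (v + w z) (\<sigma> + \<omega> z)) x"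
    "\<And>z. \<bar>trace (\<omega> z)\<bar> \<le> \<eta> / 40"
    "gain CARD('n) DIM((real^'n) \<times> real) * (trace (defect v0 \<sigma>0))\<^sup>2 * measure lborel (cbox a b)
      \<le> (\<integral>z. w z \<bullet> w z \<partial>lborel)"
    "\<And>g. g \<in> H \<Longrightarrow> \<bar>\<integral>z. w z \<bullet> g z \<partial>lborel\<bar> \<le> \<epsilon>"
proof -
  let ?n = "real CARD('n)" and ?R = "defect v0 \<sigma>0"
  have n: "2 \<le> ?n" using card by linarith
  have symR: "?R $ i $ j = ?R $ j $ i" for i j
    by (simp add: defect_def sym mat_def)
  obtain f where f: "norm f = 1" "\<And>x. trace ?R / ?n * (f \<bullet> x)\<^sup>2 \<le> quad ?R x"
    using positive_matrix_direction[of ?R, OF symR \<eta>(1) pos] by metis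
  define \<mu> where "\<mu> = trace ?R / ?n"
  \<comment> \<open>With \<open>\<gamma>\<close> at most 5/4 in absolute value and
    \<open>\<delta>\<close> at most 1/8, the coefficient \<open>\<tau>\<close> of the rank-one loss
    is at most \<open>5/16 * \<mu> + \<mu> / 64\<close>, which is below
    \<open>\<mu> / 2\<close>.\<close>
  define \<delta> where "\<delta> = \<mu> / 8"
  define \<gamma> where "\<gamma> = v0 \<bullet> f"
  define m where "m = v0 - \<gamma> *\<^sub>R f"
  \<comment> \<open>The perturbation of the form will total \<open>10 * e1\<close>, within
    \<open>\<eta> / 4\<close>. The factor \<open>?n\<close> compensates the loss in passing from the
    norm of a matrix to its trace.\<close>
  define e1 where "e1 = \<eta> / (40 * ?n)"
  have diag: "\<eta> \<le> ?R $ i $ i" for i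
    using pos[of "axis i 1"] by (simp add: quad_def inner_axis' matrix_vector_mul_component inner_axis)
  have trR: "0 < trace ?R"
    unfolding trace_def by (rule sum_pos) (use diag \<eta> in \<open>auto intro: less_le_trans\<close>)
  then have \<mu>0: "0 < \<mu>" using n by (simp add: \<mu>_def)
  have trR2: "trace ?R \<le> 3/2" "v0 \<bullet> v0 \<le> 3/2"
    using abs_le_D1[OF tr] trR inner_ge_zero[of v0] unfolding trace_defect by linarith+
  have "\<mu> \<le> (3/2) / 2" unfolding \<mu>_def using trR2 n trR by (intro frac_le) auto
  then have \<mu>1: "\<mu> \<le> 3/4" by simp
  have nv0: "norm v0 \<le> 5/4"
    by (rule power2_le_imp_le) (use trR2(2) in \<open>simp_all add: power2_norm_eq_inner power_divide\<close>)
  have ff: "f \<bullet> f = 1" using f(1) by (simp add: norm_eq_sqrt_inner)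
  have mf: "m \<bullet> f = 0" by (simp add: m_def inner_diff_left \<gamma>_def ff)
  have \<gamma>: "\<bar>\<gamma>\<bar> \<le> 5/4" using Cauchy_Schwarz_ineq2[of v0 f] nv0 f by (simp add: \<gamma>_def)
  have \<delta>: "0 < \<delta>" "\<delta> \<le> 1/8" using \<mu>0 \<mu>1 by (auto simp: \<delta>_def)
  have e1: "0 < e1" "e1 \<le> \<eta> / 80" "e1 \<le> 1/160" "?n * e1 = \<eta> / 40"
  proof -
    show "0 < e1" using \<eta> n by (simp add: e1_def)
    show e: "e1 \<le> \<eta> / 80" unfolding e1_def using \<eta> n by (intro divide_left_mono) auto
    then show "e1 \<le> 1/160" using \<eta> by simp
    show "?n * e1 = \<eta> / 40" using n by (simp add: e1_def)
  qed
  obtain w \<omega> where w: "linear_euler w \<omega>"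
    "\<And>z. z \<notin> box a b \<Longrightarrow> w z = 0" "\<And>z. z \<notin> box a b \<Longrightarrow> \<omega> z = 0"
    "\<And>z. \<exists>s. \<bar>s\<bar> \<le> 1 \<and> norm (w z - (s * \<delta>) *\<^sub>R f) \<le> min \<epsilon> e1 \<and> norm (\<omega> z - (s * \<delta>) *\<^sub>R (outer f m + outer m f)) \<le> min \<epsilon> e1"
    "\<delta>\<^sup>2 * ((3/4)^6 / (4 * (2 * real DIM((real^'n) \<times> real)) ^ DIM((real^'n) \<times> real))) * measure lborel (cbox a b) \<le> (\<integral>z. w z \<bullet> w z \<partial>lborel)"
    "\<And>g. g \<in> H \<Longrightarrow> \<bar>\<integral>z. w z \<bullet> g z \<partial>lborel\<bar> \<le> min \<epsilon> e1"
    by (rule localized_wave[where a=a and b=b and f=f and m=m and \<delta>=\<delta> and \<epsilon>="min \<epsilon> e1" and H=H, OF card ab f(1) mf \<delta>(1) _ H])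
      (use \<epsilon> e1 in \<open>simp | assumption | rule that\<close>)+
  show ?thesis
  proof (rule that[of w \<omega>, OF w(1-3)])
    fix z v \<sigma> x
    assume near: "norm (v - v0) \<le> \<eta> / (40 * ?n)" "norm (\<sigma> - \<sigma>0) \<le> \<eta> / (40 * ?n)"
    obtain s where s: "\<bar>s\<bar> \<le> 1" "norm (w z - (s * \<delta>) *\<^sub>R f) \<le> e1"
      "norm (\<omega> z - (s * \<delta>) *\<^sub>R (outer f m + outer m f)) \<le> e1"
      using w(4)[of z] by auto
    define v2 where "v2 = v0 + (s * \<delta>) *\<^sub>R f"
    define \<sigma>2 where "\<sigma>2 = \<sigma>0 + (s * \<delta>) *\<^sub>R (outer f m + outer m f)"
    define \<tau> where "\<tau> = 2 * (s * \<delta>) * \<gamma> + (s * \<delta>)\<^sup>2"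
    have d2: "defect v2 \<sigma>2 = ?R - \<tau> *\<^sub>R outer f f"
      by (simp add: defect_def v2_def \<sigma>2_def \<tau>_def m_def vec_eq_iff algebra_simps power2_eq_square)
    have "quad (\<tau> *\<^sub>R outer f f) x = \<tau> * (f \<bullet> x)\<^sup>2"
      by (simp add: quad_def scaleR_matrix_vector_assoc[symmetric] outer_mult_vec inner_commute power2_eq_square)
    then have q2: "quad (defect v2 \<sigma>2) x = quad ?R x - \<tau> * (f \<bullet> x)\<^sup>2"
      by (simp add: d2 quad_diff)
    have sd: "\<bar>s * \<delta>\<bar> \<le> \<delta>" using s(1) \<delta> by (simp add: abs_mult mult_left_le_one_le)
    have "\<tau> \<le> \<mu> / 2"
    proof -
      have "2 * (s * \<delta>) * \<gamma> \<le> 2 * (\<bar>s * \<delta>\<bar> * \<bar>\<gamma>\<bar>)" by (simp add: abs_mult[symmetric])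
      also have "\<dots> \<le> 2 * (\<delta> * (5/4))" using sd \<gamma> \<delta> by (intro mult_left_mono mult_mono) auto
      finally have 1: "2 * (s * \<delta>) * \<gamma> \<le> 5/16 * \<mu>" by (simp add: \<delta>_def)
      have "(s * \<delta>)\<^sup>2 \<le> \<delta>\<^sup>2" using sd by (simp add: abs_le_square_iff[symmetric])
      also have "\<dots> \<le> \<delta> * (1/8)" unfolding power2_eq_square using \<delta> by (intro mult_left_mono) auto
      finally have 2: "(s * \<delta>)\<^sup>2 \<le> \<mu> / 64" by (simp add: \<delta>_def)
      show ?thesis using 1 2 \<mu>0 unfolding \<tau>_def by linarith
    qed
    then have "\<tau> * (f \<bullet> x)\<^sup>2 \<le> \<mu> / 2 * (f \<bullet> x)\<^sup>2" by (intro mult_right_mono) auto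
    also have "\<dots> \<le> quad ?R x / 2" using f(2)[of x] by (simp add: \<mu>_def)
    finally have Q: "\<eta> / 2 * (x \<bullet> x) \<le> quad (defect v2 \<sigma>2) x"
      using pos[of x] q2 by simp
    have n1: "norm (v + w z - v2) \<le> 2 * e1"
    proof -
      have "v + w z - v2 = (v - v0) + (w z - (s * \<delta>) *\<^sub>R f)" by (simp add: v2_def)
      also have "norm \<dots> \<le> e1 + e1" using near(1) s(2) by (intro norm_triangle_mono) (auto simp: e1_def)
      finally show ?thesis by simp
    qed
    have n2: "norm (\<sigma> + \<omega> z - \<sigma>2) \<le> 2 * e1"
    proof -
      have "\<sigma> + \<omega> z - \<sigma>2 = (\<sigma> - \<sigma>0) + (\<omega> z - (s * \<delta>) *\<^sub>R (outer f m + outer m f))" by (simp add: \<sigma>2_def)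
      also have "norm \<dots> \<le> e1 + e1" using near(2) s(3) by (intro norm_triangle_mono) (auto simp: e1_def)
      finally show ?thesis by simp
    qed
    have nv2: "norm v2 \<le> 3/2"
      using norm_triangle_ineq[of v0 "(s * \<delta>) *\<^sub>R f"] nv0 sd \<delta> f(1) by (simp add: v2_def)
    have nv1: "norm (v + w z) \<le> 2"
      using norm_triangle_ineq2[of "v + w z" v2] n1 nv2 e1(3) by linarith
    have "norm (\<sigma> + \<omega> z - \<sigma>2) + norm (v + w z - v2) * (norm (v + w z) + norm v2) \<le> 2 * e1 + 2 * e1 * 4"
      using n1 n2 nv1 nv2 e1 by (intro add_mono mult_mono) auto
    also have "\<dots> \<le> \<eta> / 4" using e1(2) \<eta> by simp
    finally have "(norm (\<sigma> + \<omega> z - \<sigma>2) + norm (v + w z - v2) * (norm (v + w z) + norm v2)) * (x \<bullet> x) \<le> \<eta> / 4 * (x \<bullet> x)"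
      by (intro mult_right_mono) auto
    then show "\<eta> / 4 * (x \<bullet> x) \<le> quad (defect (v + w z) (\<sigma> + \<omega> z)) x"
      using Q quad_defect_perturb[of v2 \<sigma>2 x "\<sigma> + \<omega> z" "v + w z"] by (simp add: algebra_simps)
  next
    fix z
    obtain s where s: "norm (\<omega> z - (s * \<delta>) *\<^sub>R (outer f m + outer m f)) \<le> e1" using w(4)[of z] by auto
    have "trace (\<omega> z - (s * \<delta>) *\<^sub>R (outer f m + outer m f)) = trace (\<omega> z)"
      using mf by (simp add: trace_sub trace_scaleR trace_add trace_outer inner_commute)
    then have "\<bar>trace (\<omega> z)\<bar> \<le> ?n * e1"
      using abs_trace_le[of "\<omega> z - (s * \<delta>) *\<^sub>R (outer f m + outer m f)"] s n by (smt (verit) mult_left_mono)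
    then show "\<bar>trace (\<omega> z)\<bar> \<le> \<eta> / 40" using e1(4) by simp
  next
    have "gain CARD('n) DIM((real^'n) \<times> real) * (trace ?R)\<^sup>2 = \<delta>\<^sup>2 * ((3/4)^6 / (4 * (2 * real DIM((real^'n) \<times> real)) ^ DIM((real^'n) \<times> real)))"
      by (simp add: gain_def \<delta>_def \<mu>_def power_divide power_mult_distrib)
    then show "gain CARD('n) DIM((real^'n) \<times> real) * (trace (defect v0 \<sigma>0))\<^sup>2 * measure lborel (cbox a b) \<le> (\<integral>z. w z \<bullet> w z \<partial>lborel)"
      using w(5) by simp
  next
    fix g assume "g \<in> H" then show "\<bar>\<integral>z. w z \<bullet> g z \<partial>lborel\<bar> \<le> \<epsilon>" using w(6)[of g] by simp
  qed
qed

section \<open>Subsolutions\<close>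

text \<open>One parameter measures both the positivity of the defect and the slack in the trace
  bound, so passing to a smaller \<open>\<eta>\<close> makes room for the next change of trace.
  Positivity is imposed on all of space-time; off the cube the defect is the identity divided by the
  dimension. The bound 1/2 on the trace gives both the ceiling 3/2 on the squared speed and its
  floor in the limit.\<close>

definition strict_subsolution where
  "strict_subsolution \<eta> (v :: (real^'n) \<times> real \<Rightarrow> real^'n) \<sigma> \<longleftrightarrow> linear_euler v \<sigma> \<and>
    (\<forall>z. z \<notin> box 0 One \<longrightarrow> v z = 0 \<and> \<sigma> z = 0) \<and> 0 < \<eta> \<and>
    (\<forall>z x. \<eta> * (x \<bullet> x) \<le> quad (defect (v z) (\<sigma> z)) x) \<and> (\<forall>z. \<bar>trace (\<sigma> z)\<bar> \<le> 1/2 - \<eta>)"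

lemma continuous_on_trace:
  "continuous_on A \<sigma> \<Longrightarrow> continuous_on A (\<lambda>z. trace (\<sigma> z :: real^'n^'n))"
  unfolding trace_def by (intro continuous_intros)

lemma strict_subsolution_continuous_defect:
  assumes "strict_subsolution \<eta> v \<sigma>"
  shows "continuous_on A (\<lambda>z. trace (defect (v z) (\<sigma> z)))"
  using assms unfolding trace_defect strict_subsolution_def linear_euler_def
  by (intro continuous_intros continuous_on_trace Cc_continuous) auto

lemma localized_sum:
  assumes "finite Q"
    and disj: "\<And>k k'. k \<in> Q \<Longrightarrow> k' \<in> Q \<Longrightarrow> k \<noteq> k' \<Longrightarrow> S k \<inter> S k' = {}"
    and supp: "\<And>k z. k \<in> Q \<Longrightarrow> z \<notin> S k \<Longrightarrow> f k z = (0::'b::comm_monoid_add)"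
  shows "k \<in> Q \<Longrightarrow> z \<in> S k \<Longrightarrow> (\<Sum>k\<in>Q. f k z) = f k z"
    and "z \<notin> (\<Union>k\<in>Q. S k) \<Longrightarrow> (\<Sum>k\<in>Q. f k z) = 0"
proof -
  assume k: "k \<in> Q" "z \<in> S k"
  have "f k' z = 0" if "k' \<in> Q - {k}" for k'
    using that supp[of k' z] disj[of k k'] k by auto
  then show "(\<Sum>k\<in>Q. f k z) = f k z"
    using sum.remove[OF assms(1) k(1), of "\<lambda>k. f k z"] by simp
next
  assume "z \<notin> (\<Union>k\<in>Q. S k)"
  then show "(\<Sum>k\<in>Q. f k z) = 0" using supp by (intro sum.neutral) auto
qed

text \<open>The gains of the single boxes add up to a Riemann sum of the squared trace at the tags.
  A gauge chosen for the integral of that function turns the sum into the integral, and the tags are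
  the points at which the fields are frozen.\<close>

lemma improve_subsolution:
  fixes v :: "(real^'n) \<times> real \<Rightarrow> real^'n"
  assumes card: "2 \<le> CARD('n)"
    and sub: "strict_subsolution \<eta> v \<sigma>"
    and H: "finite H" "\<And>g. g \<in> H \<Longrightarrow> Cc (g :: (real^'n) \<times> real \<Rightarrow> real^'n)" and \<epsilon>: "0 < \<epsilon>"
  obtains v' \<sigma>' where "strict_subsolution (\<eta> / 4) v' \<sigma>'"
    "\<And>g. g \<in> H \<Longrightarrow> \<bar>\<integral>z. (v' z - v z) \<bullet> g z \<partial>lborel\<bar> \<le> \<epsilon>"
    "gain CARD('n) DIM((real^'n) \<times> real) * integral (cbox 0 One) (\<lambda>z. (trace (defect (v z) (\<sigma> z)))\<^sup>2) - \<epsilon>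
      \<le> (\<integral>z. (v' z - v z) \<bullet> (v' z - v z) \<partial>lborel)"
proof -
  let ?G = "gain CARD('n) DIM((real^'n) \<times> real)"
  define \<rho> where "\<rho> z = (trace (defect (v z) (\<sigma> z)))\<^sup>2" for z
  have sub': "linear_euler v \<sigma>" "\<And>z. z \<notin> box 0 One \<Longrightarrow> v z = 0" "\<And>z. z \<notin> box 0 One \<Longrightarrow> \<sigma> z = 0" "0 < \<eta>"
    "\<And>z x. \<eta> * (x \<bullet> x) \<le> quad (defect (v z) (\<sigma> z)) x" "\<And>z. \<bar>trace (\<sigma> z)\<bar> \<le> 1/2 - \<eta>"
    using sub by (auto simp: strict_subsolution_def)
  have \<eta>: "\<eta> \<le> 1/2" using sub'(6)[of 0] by linarith
  have c: "Cc v" "Cc \<sigma>" and sym: "\<And>z i j. \<sigma> z $ i $ j = \<sigma> z $ j $ i"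
    using sub'(1) by (auto simp: linear_euler_def)
  have G: "0 < ?G" by (simp add: gain_def)
  define e1 where "e1 = \<eta> / (40 * real CARD('n))"
  have e1: "0 < e1" using sub'(4) by (simp add: e1_def)
  obtain d1 where d1: "0 < d1" "\<And>x y. dist x y < d1 \<Longrightarrow> dist (v x) (v y) < e1"
    using Cc_uniformly_continuous[OF c(1) e1] by metis
  obtain d2 where d2: "0 < d2" "\<And>x y. dist x y < d2 \<Longrightarrow> dist (\<sigma> x) (\<sigma> y) < e1"
    using Cc_uniformly_continuous[OF c(2) e1] by metis
  have "\<rho> integrable_on cbox 0 One"
    unfolding \<rho>_def by (intro integrable_continuous continuous_intros strict_subsolution_continuous_defect[OF sub])
  then have \<rho>I: "(\<rho> has_integral integral (cbox 0 One) \<rho>) (cbox 0 One)" by (rule integrable_integral)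
  \<comment> \<open>The error of the Riemann sum will be multiplied by \<open>?G\<close>.\<close>
  have "0 < \<epsilon> / ?G" using \<epsilon> G by simp
  then obtain \<gamma> where \<gamma>: "gauge \<gamma>"
    "\<And>p. p tagged_division_of cbox 0 One \<Longrightarrow> \<gamma> fine p \<Longrightarrow>
      norm ((\<Sum>(x,k)\<in>p. measure lborel k *\<^sub>R \<rho> x) - integral (cbox 0 One) \<rho>) < \<epsilon> / ?G"
    using has_integralD[OF \<rho>I] by metis
  \<comment> \<open>The balls keep \<open>v\<close> and \<open>\<sigma>\<close> within
    \<open>e1\<close> of their values at the tag, which is the tolerance granted by
    \<open>box_perturbation\<close>.\<close>
  have "gauge (\<lambda>x. \<gamma> x \<inter> ball x (min d1 d2))"
    using \<gamma>(1) d1 d2 by (intro gauge_Int gauge_ball) auto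
  then obtain p where p: "p tagged_division_of cbox 0 One" "(\<lambda>x. \<gamma> x \<inter> ball x (min d1 d2)) fine p"
    using fine_division_exists by blast
  then have p\<gamma>: "\<gamma> fine p" and pb: "(\<lambda>x. ball x (min d1 d2)) fine p" by (auto simp: fine_Int)
  have finp: "finite p" using p(1) by auto
  \<comment> \<open>Degenerate boxes contribute nothing to the Riemann sum, and waves are
    constructed only in boxes with positive side lengths.\<close>
  define Q where "Q = {k\<in>p. measure lborel (snd k) \<noteq> 0}"
  define \<epsilon>' where "\<epsilon>' = \<epsilon> / (real (card Q) + 1)"
  have finQ: "finite Q" using finp by (simp add: Q_def)
  have \<epsilon>': "0 < \<epsilon>'" "real (card Q) * \<epsilon>' \<le> \<epsilon>" using \<epsilon> by (auto simp: \<epsilon>'_def field_simps)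
  define Pr where "Pr k w \<omega> \<longleftrightarrow> linear_euler w \<omega> \<and> (\<forall>z. z \<notin> interior (snd k) \<longrightarrow> w z = 0 \<and> \<omega> z = 0) \<and>
      (\<forall>z x. z \<in> interior (snd k) \<longrightarrow> \<eta> / 4 * (x \<bullet> x) \<le> quad (defect (v z + w z) (\<sigma> z + \<omega> z)) x) \<and>
      (\<forall>z. \<bar>trace (\<omega> z)\<bar> \<le> \<eta> / 40) \<and>
      ?G * (\<rho> (fst k) * measure lborel (snd k)) \<le> (\<integral>z. w z \<bullet> w z \<partial>lborel) \<and>
      (\<forall>g\<in>H. \<bar>\<integral>z. w z \<bullet> g z \<partial>lborel\<bar> \<le> \<epsilon>')" for k w \<omega>
  have "\<exists>w \<omega>. Pr k w \<omega>" if "k \<in> Q" for k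
  proof -
    obtain x K where k: "k = (x, K)" by (cases k)
    have xK: "(x, K) \<in> p" "measure lborel K \<noteq> 0" using that by (auto simp: Q_def k)
    obtain a b where K: "K = cbox a b" using p(1) xK(1) by blast
    have "0 < measure lborel (cbox a b)"
      using xK(2) unfolding K zero_less_measure_iff .
    then have ab: "a \<bullet> i < b \<bullet> i" if "i \<in> Basis" for i
      using that unfolding content_pos_lt_eq by blast
    have tr: "\<bar>trace (\<sigma> x)\<bar> \<le> 1/2" using sub'(6)[of x] sub'(4) by linarith
    obtain w \<omega> where w: "linear_euler w \<omega>"
      "\<And>z. z \<notin> box a b \<Longrightarrow> w z = 0" "\<And>z. z \<notin> box a b \<Longrightarrow> \<omega> z = 0"
      "\<And>z v' \<sigma>' y. norm (v' - v x) \<le> \<eta> / (40 * real CARD('n)) \<Longrightarrow> norm (\<sigma>' - \<sigma> x) \<le> \<eta> / (40 * real CARD('n))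
        \<Longrightarrow> \<eta> / 4 * (y \<bullet> y) \<le> quad (defect (v' + w z) (\<sigma>' + \<omega> z)) y"
      "\<And>z. \<bar>trace (\<omega> z)\<bar> \<le> \<eta> / 40"
      "?G * (trace (defect (v x) (\<sigma> x)))\<^sup>2 * measure lborel (cbox a b) \<le> (\<integral>z. w z \<bullet> w z \<partial>lborel)"
      "\<And>g. g \<in> H \<Longrightarrow> \<bar>\<integral>z. w z \<bullet> g z \<partial>lborel\<bar> \<le> \<epsilon>'"
      by (rule box_perturbation[where a=a and b=b and H=H and \<epsilon>=\<epsilon>', OF card sym sub'(4) \<eta> sub'(5) tr ab \<epsilon>'(1) H])
        (assumption | rule that)+
    have near: "norm (v z - v x) \<le> e1" "norm (\<sigma> z - \<sigma> x) \<le> e1" if "z \<in> interior K" for z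
    proof -
      have "K \<subseteq> ball x (min d1 d2)" using pb xK(1) unfolding fine_def by fastforce
      then have "z \<in> ball x (min d1 d2)" using interior_subset that by blast
      then have "dist z x < d1" "dist z x < d2" by (auto simp: dist_commute)
      then show "norm (v z - v x) \<le> e1" "norm (\<sigma> z - \<sigma> x) \<le> e1"
        using d1(2)[of z x] d2(2)[of z x] by (auto simp: dist_norm)
    qed
    show ?thesis
      unfolding Pr_def using w(1,2,3,5,6,7) w(4)[OF near[unfolded e1_def]]
      by (intro exI[of _ w] exI[of _ \<omega>]) (auto simp: k K \<rho>_def interior_cbox mult.assoc)
  qed
  then obtain W \<Omega> where Pr: "\<And>k. k \<in> Q \<Longrightarrow> Pr k (W k) (\<Omega> k)" by metis
  have W: "\<And>k. k \<in> Q \<Longrightarrow> linear_euler (W k) (\<Omega> k)"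
    "\<And>k z. k \<in> Q \<Longrightarrow> z \<notin> interior (snd k) \<Longrightarrow> W k z = 0" "\<And>k z. k \<in> Q \<Longrightarrow> z \<notin> interior (snd k) \<Longrightarrow> \<Omega> k z = 0"
    "\<And>k z x. k \<in> Q \<Longrightarrow> z \<in> interior (snd k) \<Longrightarrow> \<eta> / 4 * (x \<bullet> x) \<le> quad (defect (v z + W k z) (\<sigma> z + \<Omega> k z)) x"
    "\<And>k z. k \<in> Q \<Longrightarrow> \<bar>trace (\<Omega> k z)\<bar> \<le> \<eta> / 40"
    "\<And>k. k \<in> Q \<Longrightarrow> ?G * (\<rho> (fst k) * measure lborel (snd k)) \<le> (\<integral>z. W k z \<bullet> W k z \<partial>lborel)"
    "\<And>k g. k \<in> Q \<Longrightarrow> g \<in> H \<Longrightarrow> \<bar>\<integral>z. W k z \<bullet> g z \<partial>lborel\<bar> \<le> \<epsilon>'"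
    using Pr unfolding Pr_def by blast+
  have disj: "interior (snd k) \<inter> interior (snd k') = {}" if "k \<in> Q" "k' \<in> Q" "k \<noteq> k'" for k k'
    using tagged_division_ofD(5)[OF p(1), of "fst k" "snd k" "fst k'" "snd k'"] that by (auto simp: Q_def)
  define w where "w z = (\<Sum>k\<in>Q. W k z)" for z
  define \<omega> where "\<omega> z = (\<Sum>k\<in>Q. \<Omega> k z)" for z
  have CW: "Cc (W k)" if "k \<in> Q" for k using W(1)[OF that] by (simp add: linear_euler_def)
  have w_in: "w z = W k z" "\<omega> z = \<Omega> k z" if "k \<in> Q" "z \<in> interior (snd k)" for k z
    unfolding w_def \<omega>_def
    by (rule localized_sum(1)[where S="\<lambda>k. interior (snd k)", OF finQ disj]; use W(2,3) that in simp)+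
  have w_out: "w z = 0" "\<omega> z = 0" if "z \<notin> (\<Union>k\<in>Q. interior (snd k))" for z
    unfolding w_def \<omega>_def
    by (rule localized_sum(2)[where S="\<lambda>k. interior (snd k)", OF finQ disj]; use W(2,3) that in simp)+
  have le: "linear_euler w \<omega>"
    unfolding w_def \<omega>_def by (intro linear_euler_sum finQ W(1))
  \<comment> \<open>The second alternative includes the faces between boxes: every wave vanishes
    there, so the old subsolution is unchanged.\<close>
  have cases: "(\<exists>k\<in>Q. z \<in> interior (snd k) \<and> w z = W k z \<and> \<omega> z = \<Omega> k z) \<or>
      (z \<notin> (\<Union>k\<in>Q. interior (snd k)) \<and> w z = 0 \<and> \<omega> z = 0)" for z
    using w_in w_out by (cases "z \<in> (\<Union>k\<in>Q. interior (snd k))") blast+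
  have sub_box: "interior (snd k) \<subseteq> box 0 One" if "k \<in> Q" for k
  proof -
    have "snd k \<subseteq> cbox 0 One" using tagged_division_ofD(3)[OF p(1), of "fst k" "snd k"] that by (simp add: Q_def)
    from interior_mono[OF this] show ?thesis by (simp add: interior_cbox)
  qed
  show ?thesis
  proof (rule that[of "\<lambda>z. v z + w z" "\<lambda>z. \<sigma> z + \<omega> z"])
    show "strict_subsolution (\<eta> / 4) (\<lambda>z. v z + w z) (\<lambda>z. \<sigma> z + \<omega> z)"
      unfolding strict_subsolution_def
    proof (intro conjI allI impI)
      show "linear_euler (\<lambda>z. v z + w z) (\<lambda>z. \<sigma> z + \<omega> z)" by (intro linear_euler_add sub' le)
      show "0 < \<eta> / 4" using sub'(4) by simp
      fix z
      show "v z + w z = 0" "\<sigma> z + \<omega> z = 0" if "z \<notin> box 0 One"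
        using cases[of z] sub'(2,3)[OF that] sub_box that by auto
      show "\<eta> / 4 * (x \<bullet> x) \<le> quad (defect (v z + w z) (\<sigma> z + \<omega> z)) x" for x
        using cases[of z]
      proof (elim disjE bexE conjE)
        fix k assume "k \<in> Q" "z \<in> interior (snd k)" "w z = W k z" "\<omega> z = \<Omega> k z"
        then show ?thesis using W(4)[of k z x] by simp
      next
        assume "w z = 0" "\<omega> z = 0"
        moreover have "\<eta> / 4 * (x \<bullet> x) \<le> \<eta> * (x \<bullet> x)" using sub'(4) by (intro mult_right_mono) auto
        ultimately show ?thesis using sub'(5)[of x z] by simp
      qed
      have "\<bar>trace (\<omega> z)\<bar> \<le> \<eta> / 40"
        using cases[of z] W(5)[of _ z] sub'(4) by (auto simp: trace_0[simplified])
      then show "\<bar>trace (\<sigma> z + \<omega> z)\<bar> \<le> 1 / 2 - \<eta> / 4"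
        using sub'(6)[of z] sub'(4) unfolding trace_add by linarith
    qed
  next
    fix g assume g: "g \<in> H"
    have "(\<integral>z. w z \<bullet> g z \<partial>lborel) = (\<Sum>k\<in>Q. \<integral>z. W k z \<bullet> g z \<partial>lborel)"
      unfolding w_def inner_sum_left
      by (intro Bochner_Integration.integral_sum Cc_integrable Cc_inner CW Cc_continuous H(2) g)
    also have "\<bar>\<dots>\<bar> \<le> (\<Sum>k\<in>Q. \<bar>\<integral>z. W k z \<bullet> g z \<partial>lborel\<bar>)" by (rule sum_abs)
    also have "\<dots> \<le> real (card Q) * \<epsilon>'" by (rule sum_bounded_above) (rule W(7)[OF _ g])
    finally show "\<bar>\<integral>z. (v z + w z - v z) \<bullet> g z \<partial>lborel\<bar> \<le> \<epsilon>" using \<epsilon>'(2) by simp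
  next
    \<comment> \<open>Waves in different boxes have disjoint supports up to faces, so no cross terms
      appear and the energies add exactly.\<close>
    have ww: "w z \<bullet> w z = (\<Sum>k\<in>Q. W k z \<bullet> W k z)" for z
      using cases[of z]
    proof (elim disjE bexE conjE)
      fix k assume k: "k \<in> Q" "z \<in> interior (snd k)" "w z = W k z"
      have "(\<Sum>k\<in>Q. W k z \<bullet> W k z) = W k z \<bullet> W k z"
        by (rule localized_sum(1)[where S="\<lambda>k. interior (snd k)", OF finQ disj]) (use W(2) k in auto)
      then show ?thesis using k by simp
    next
      assume "z \<notin> (\<Union>k\<in>Q. interior (snd k))" "w z = 0"
      then show ?thesis using W(2) by (simp add: sum.neutral)
    qed
    have "\<bar>(\<Sum>(x,k)\<in>p. measure lborel k *\<^sub>R \<rho> x) - integral (cbox 0 One) \<rho>\<bar> < \<epsilon> / ?G"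
      using \<gamma>(2)[OF p(1) p\<gamma>] by simp
    then have "integral (cbox 0 One) \<rho> - \<epsilon> / ?G \<le> (\<Sum>(x,k)\<in>p. measure lborel k *\<^sub>R \<rho> x)"
      by linarith
    then have "?G * (integral (cbox 0 One) \<rho> - \<epsilon> / ?G) \<le> ?G * (\<Sum>(x,k)\<in>p. measure lborel k *\<^sub>R \<rho> x)"
      using G by (intro mult_left_mono) auto
    also have "(\<Sum>(x,k)\<in>p. measure lborel k *\<^sub>R \<rho> x) = (\<Sum>k\<in>Q. \<rho> (fst k) * measure lborel (snd k))"
      unfolding Q_def by (intro sum.mono_neutral_cong_right finp) auto
    also have "?G * \<dots> = (\<Sum>k\<in>Q. ?G * (\<rho> (fst k) * measure lborel (snd k)))" by (rule sum_distrib_left)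
    also have "\<dots> \<le> (\<Sum>k\<in>Q. \<integral>z. W k z \<bullet> W k z \<partial>lborel)" by (intro sum_mono W(6))
    also have "\<dots> = (\<integral>z. w z \<bullet> w z \<partial>lborel)"
      unfolding ww
      by (intro Bochner_Integration.integral_sum[symmetric] Cc_integrable Cc_inner CW Cc_continuous)
    finally have "?G * integral (cbox 0 One) \<rho> - \<epsilon> \<le> (\<integral>z. w z \<bullet> w z \<partial>lborel)"
      using G by (simp add: right_diff_distrib)
    then show "?G * integral (cbox 0 One) (\<lambda>z. (trace (defect (v z) (\<sigma> z)))\<^sup>2) - \<epsilon>
      \<le> (\<integral>z. (v z + w z - v z) \<bullet> (v z + w z - v z) \<partial>lborel)"
      by (simp add: \<rho>_def[abs_def])
  qed
qed

section \<open>The iteration and its uniform bounds\<close>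

lemma strict_subsolution_zero:
  assumes "2 \<le> CARD('n)"
  shows "strict_subsolution (1 / real CARD('n)) (\<lambda>_. 0 :: real^'n) (\<lambda>_. 0)"
proof -
  have n: "2 \<le> real CARD('n)" using assms by linarith
  have "defect (0::real^'n) 0 = (1 / real CARD('n)) *\<^sub>R mat 1"
    by (simp add: defect_def outer_def mat_def vec_eq_iff)
  then have "quad (defect (0::real^'n) 0) x = 1 / real CARD('n) * (x \<bullet> x)" for x
    by (simp add: quad_def scaleR_matrix_vector_assoc[symmetric])
  \<comment> \<open>With zero matrix field, the trace condition says exactly that the margin is at
    most 1/2.\<close>
  moreover have "1 / real CARD('n) \<le> 1 / 2" using n by (intro divide_left_mono) auto
  ultimately show ?thesis
    by (simp add: strict_subsolution_def linear_euler_zero trace_def)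
qed

text \<open>The state of the recursion carries a finite set \<open>H\<close> of all fields met so
  far, so that each increment is almost orthogonal to every one of them and not just to the current
  field. The tolerances are geometric in order to be summable.\<close>

lemma subsolution_sequence:
  assumes card: "2 \<le> CARD('n)"
  obtains \<eta> and v :: "nat \<Rightarrow> (real^'n) \<times> real \<Rightarrow> real^'n" and \<sigma> where
    "\<And>k. strict_subsolution (\<eta> k) (v k) (\<sigma> k)"
    "\<And>k j. k \<le> j \<Longrightarrow> \<bar>\<integral>z. (v (Suc j) z - v j z) \<bullet> v k z \<partial>lborel\<bar> \<le> (1/2) ^ j"
    "\<And>j. gain CARD('n) DIM((real^'n) \<times> real) * integral (cbox 0 One) (\<lambda>z. (trace (defect (v j z) (\<sigma> j z)))\<^sup>2) - (1/2) ^ j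
      \<le> (\<integral>z. (v (Suc j) z - v j z) \<bullet> (v (Suc j) z - v j z) \<partial>lborel)"
proof -
  define P where "P = (\<lambda>(n::nat) (\<eta>, v :: (real^'n) \<times> real \<Rightarrow> real^'n, \<sigma>, H).
    strict_subsolution \<eta> v \<sigma> \<and> finite H \<and> (\<forall>g\<in>H. Cc g) \<and> v \<in> H)"
  define T where "T = (\<lambda>(j::nat) (\<eta>::real, v :: (real^'n) \<times> real \<Rightarrow> real^'n, \<sigma>, H) (\<eta>'::real, v', \<sigma>' :: (real^'n) \<times> real \<Rightarrow> real^'n^'n, H').
    H' = insert v' H \<and> (\<forall>g\<in>H. \<bar>\<integral>z. (v' z - v z) \<bullet> g z \<partial>lborel\<bar> \<le> (1/2) ^ j) \<and>
    gain CARD('n) DIM((real^'n) \<times> real) * integral (cbox 0 One) (\<lambda>z. (trace (defect (v z) (\<sigma> z)))\<^sup>2) - (1/2) ^ j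
      \<le> (\<integral>z. (v' z - v z) \<bullet> (v' z - v z) \<partial>lborel))"
  have "\<exists>f. \<forall>n. P n (f n) \<and> T n (f n) (f (Suc n))"
  proof (rule dependent_nat_choice)
    show "\<exists>x. P 0 x"
      by (rule exI[of _ "(1 / real CARD('n), \<lambda>_. 0, \<lambda>_. 0, {\<lambda>_. 0})"])
        (simp add: P_def strict_subsolution_zero[OF card] Cc_def)
    fix x j assume Px: "P j x"
    obtain \<eta> v \<sigma> H where x: "x = (\<eta>, v, \<sigma>, H)" by (cases x) auto
    have 1: "strict_subsolution \<eta> v \<sigma>" "finite H" "\<And>g. g \<in> H \<Longrightarrow> Cc g" using Px by (auto simp: P_def x)
    obtain v' \<sigma>' where 2: "strict_subsolution (\<eta> / 4) v' \<sigma>'"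
      "\<And>g. g \<in> H \<Longrightarrow> \<bar>\<integral>z. (v' z - v z) \<bullet> g z \<partial>lborel\<bar> \<le> (1/2) ^ j"
      "gain CARD('n) DIM((real^'n) \<times> real) * integral (cbox 0 One) (\<lambda>z. (trace (defect (v z) (\<sigma> z)))\<^sup>2) - (1/2) ^ j
        \<le> (\<integral>z. (v' z - v z) \<bullet> (v' z - v z) \<partial>lborel)"
      by (rule improve_subsolution[OF card 1(1) 1(2,3), of "(1/2)^j"]) (assumption | rule that | simp)+
    have "Cc v'" using 2(1) by (simp add: strict_subsolution_def linear_euler_def)
    then have "P (Suc j) (\<eta> / 4, v', \<sigma>', insert v' H) \<and> T j x (\<eta> / 4, v', \<sigma>', insert v' H)"
      using 1 2 by (simp add: P_def T_def x)
    then show "\<exists>y. P (Suc j) y \<and> T j x y" by blast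
  qed
  then obtain f where f: "\<And>n. P n (f n)" "\<And>n. T n (f n) (f (Suc n))" by blast
  define \<eta> v \<sigma> H where "\<eta> k = fst (f k)" and "v k = fst (snd (f k))"
    and "\<sigma> k = fst (snd (snd (f k)))" and "H k = snd (snd (snd (f k)))" for k
  have fk: "f k = (\<eta> k, v k, \<sigma> k, H k)" for k by (simp add: \<eta>_def v_def \<sigma>_def H_def)
  have vH: "v k \<in> H j" if "k \<le> j" for k j
    using that
  proof (induction j rule: dec_induct)
    case base
    then show ?case using f(1)[of k] by (simp add: P_def fk)
  next
    case (step m)
    then show ?case using f(2)[of m] by (simp add: T_def fk)
  qed
  show ?thesis
  proof (rule that[of \<eta> v \<sigma>])
    fix k j :: nat
    show "strict_subsolution (\<eta> k) (v k) (\<sigma> k)" using f(1)[of k] by (simp add: P_def fk)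
    show "\<bar>\<integral>z. (v (Suc j) z - v j z) \<bullet> v k z \<partial>lborel\<bar> \<le> (1/2) ^ j" if "k \<le> j"
      using f(2)[of j] vH[OF that] by (simp add: T_def fk)
    show "gain CARD('n) DIM((real^'n) \<times> real) * integral (cbox 0 One) (\<lambda>z. (trace (defect (v j z) (\<sigma> j z)))\<^sup>2) - (1/2) ^ j
      \<le> (\<integral>z. (v (Suc j) z - v j z) \<bullet> (v (Suc j) z - v j z) \<partial>lborel)"
      using f(2)[of j] by (simp add: T_def fk)
  qed
qed

text \<open>Testing with the sum and the difference of two basis vectors bounds twice the entry by
  two diagonal entries, each at most the trace. Thus convergence of the trace to 0 forces the whole
  defect to 0.\<close>

lemma positive_matrix_entry_le_trace:
  fixes R :: "real^'n^'n"
  assumes sym: "\<And>i j. R $ i $ j = R $ j $ i" and pos: "\<And>x. 0 \<le> quad R x"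
  shows "\<bar>R $ i $ j\<bar> \<le> trace R"
proof -
  have q: "quad R (axis i 1 + s *\<^sub>R axis j 1) = R $ i $ i + 2 * s * R $ i $ j + s\<^sup>2 * R $ j $ j" for i j s
    using sym[of i j]
    by (simp add: quad_def matrix_vector_right_distrib matrix_vector_mult_scaleR inner_add_left inner_add_right
        inner_axis' inner_axis matrix_vector_mul_component power2_eq_square algebra_simps)
  have diag: "0 \<le> R $ i $ i" for i using pos[of "axis i 1 + 0 *\<^sub>R axis i 1"] unfolding q by simp
  have le: "R $ i $ i \<le> trace R" for i
    unfolding trace_def by (rule member_le_sum) (use diag in auto)
  have "0 \<le> R $ i $ i + 2 * R $ i $ j + R $ j $ j" "0 \<le> R $ i $ i - 2 * R $ i $ j + R $ j $ j"
    using pos[of "axis i 1 + 1 *\<^sub>R axis j 1"] pos[of "axis i 1 + (-1) *\<^sub>R axis j 1"] unfolding q by simp_all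
  then show ?thesis using le[of i] le[of j] by linarith
qed

lemma strict_subsolution_bounds:
  fixes v :: "(real^'n) \<times> real \<Rightarrow> real^'n"
  assumes "strict_subsolution \<eta> v \<sigma>"
  shows "\<bar>defect (v z) (\<sigma> z) $ i $ j\<bar> \<le> trace (defect (v z) (\<sigma> z))"
    and "0 \<le> trace (defect (v z) (\<sigma> z))" "trace (defect (v z) (\<sigma> z)) \<le> 3/2"
    and "v z \<bullet> v z \<le> 3/2" "1/2 - trace (defect (v z) (\<sigma> z)) \<le> v z \<bullet> v z"
    and "norm (v z) \<le> 2" "\<bar>\<sigma> z $ i $ j\<bar> \<le> 7"
proof -
  have s: "linear_euler v \<sigma>" "0 < \<eta>" "\<And>x. \<eta> * (x \<bullet> x) \<le> quad (defect (v z) (\<sigma> z)) x" "\<bar>trace (\<sigma> z)\<bar> \<le> 1/2 - \<eta>"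
    using assms unfolding strict_subsolution_def by blast+
  have sym: "defect (v z) (\<sigma> z) $ i $ j = defect (v z) (\<sigma> z) $ j $ i" for i j
  proof -
    have "\<sigma> z $ i $ j = \<sigma> z $ j $ i" using s(1) unfolding linear_euler_def by blast
    then show ?thesis by (simp add: defect_def mat_def)
  qed
  have pos: "0 \<le> quad (defect (v z) (\<sigma> z)) x" for x
    by (rule order_trans[OF _ s(3)]) (use s(2) in simp)
  show e: "\<bar>defect (v z) (\<sigma> z) $ i $ j\<bar> \<le> trace (defect (v z) (\<sigma> z))"
    by (rule positive_matrix_entry_le_trace[OF sym pos])
  then show t: "0 \<le> trace (defect (v z) (\<sigma> z))" by linarith
  show t2: "trace (defect (v z) (\<sigma> z)) \<le> 3/2" and vv: "v z \<bullet> v z \<le> 3/2" and "1/2 - trace (defect (v z) (\<sigma> z)) \<le> v z \<bullet> v z"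
    using t s(2,4) inner_ge_zero[of "v z"] unfolding trace_defect by linarith+
  show nv: "norm (v z) \<le> 2"
    by (rule power2_le_imp_le) (use vv in \<open>simp_all add: power2_norm_eq_inner\<close>)
  have "\<bar>v z $ i * v z $ j\<bar> \<le> 2 * 2"
    unfolding abs_mult using component_le_norm_cart[of "v z" i] component_le_norm_cart[of "v z" j] nv by (intro mult_mono) linarith+
  moreover have "\<bar>mat (1 / real CARD('n)) $ i $ j\<bar> \<le> (1::real)" by (simp add: mat_def)
  moreover have "\<sigma> z $ i $ j = defect (v z) (\<sigma> z) $ i $ j - mat (1 / real CARD('n)) $ i $ j + v z $ i * v z $ j"
    by (simp add: defect_def)
  \<comment> \<open>The three contributions are 3/2 from the defect, 1 from the multiple of the
    identity and 4 from the velocities. Any bound independent of the index would do for dominated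
    convergence.\<close>
  ultimately show "\<bar>\<sigma> z $ i $ j\<bar> \<le> 7" using e t2 by linarith
qed

lemma strict_subsolution_outside:
  assumes "strict_subsolution \<eta> v \<sigma>" "z \<notin> cbox 0 One"
  shows "v z = 0" "\<sigma> z = 0"
  using assms box_subset_cbox[of 0 One] unfolding strict_subsolution_def by blast+

section \<open>Strong convergence and passage to the limit\<close>

lemma measure_unit_box: "measure lborel (cbox 0 One :: 'a::euclidean_space set) = 1"
  by (simp add: content_cbox)

text \<open>The squared distance is the energy difference minus twice the product of
  \<open>v m - v k\<close> with \<open>v k\<close>. Near-orthogonality bounds that product by a
  geometric tail, which is absorbed by correcting the energies. The corrected energies increase and
  are bounded by 3/2, hence converge.\<close>

lemma subsolution_sequence_L2_Cauchy:
  fixes v :: "nat \<Rightarrow> (real^'n) \<times> real \<Rightarrow> real^'n"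
  assumes sub: "\<And>k. strict_subsolution (\<eta> k) (v k) (\<sigma> k)"
    and orth: "\<And>k j. k \<le> j \<Longrightarrow> \<bar>\<integral>z. (v (Suc j) z - v j z) \<bullet> v k z \<partial>lborel\<bar> \<le> (1/2) ^ j"
  obtains a where "Cauchy a"
    "\<And>k m. k \<le> m \<Longrightarrow> (\<integral>z. (v m z - v k z) \<bullet> (v m z - v k z) \<partial>lborel) \<le> a m - (a k :: real)"
proof -
  define E where "E k = (\<integral>z. v k z \<bullet> v k z \<partial>lborel)" for k
  \<comment> \<open>Twice the tail \<open>2 * (1/2) ^ k\<close> of the tolerances, because the
    product enters the square with factor 2.\<close>
  define a where "a k = E k - 4 * (1/2) ^ k" for k
  have C: "Cc (v k)" for k using sub[of k] by (simp add: strict_subsolution_def linear_euler_def)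
  have int: "integrable lborel (\<lambda>z. v k z \<bullet> v m z)" for k m
    by (intro Cc_integrable Cc_inner C Cc_continuous)
  have diffk: "\<bar>\<integral>z. (v m z - v k z) \<bullet> v k z \<partial>lborel\<bar> \<le> 2 * (1/2) ^ k - 2 * (1/2) ^ m" if "k \<le> m" for k m
    using that
  proof (induction m rule: dec_induct)
    case base
    then show ?case by simp
  next
    case (step m)
    have "(\<integral>z. (v (Suc m) z - v k z) \<bullet> v k z \<partial>lborel)
      = (\<integral>z. (v (Suc m) z - v m z) \<bullet> v k z \<partial>lborel) + (\<integral>z. (v m z - v k z) \<bullet> v k z \<partial>lborel)"
      by (simp add: inner_diff_left int)
    then show ?case using step.IH orth[of k m] step.hyps by simp
  qed
  have key: "(\<integral>z. (v m z - v k z) \<bullet> (v m z - v k z) \<partial>lborel) \<le> a m - a k" if "k \<le> m" for k m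
  proof -
    have "(\<integral>z. (v m z - v k z) \<bullet> (v m z - v k z) \<partial>lborel) = E m - E k - 2 * (\<integral>z. (v m z - v k z) \<bullet> v k z \<partial>lborel)"
      by (simp add: E_def inner_diff_left inner_diff_right int inner_commute[of "v m _" "v k _"])
    then show ?thesis using diffk[OF that] unfolding a_def by linarith
  qed
  have "a k \<le> a (Suc k)" for k
  proof -
    have "0 \<le> (\<integral>z. (v (Suc k) z - v k z) \<bullet> (v (Suc k) z - v k z) \<partial>lborel)"
      by (rule Bochner_Integration.integral_nonneg) simp
    then show ?thesis using key[OF le_SucI[OF le_refl], of k] by linarith
  qed
  then have "incseq a" by (rule incseq_SucI)
  moreover have "a k \<le> 3/2" for k
  proof -
    have "E k \<le> (\<integral>z. 3/2 * indicator (cbox 0 One) z \<partial>(lborel :: ((real^'n) \<times> real) measure))"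
      unfolding E_def
    proof (rule integral_mono)
      show "v k z \<bullet> v k z \<le> 3/2 * indicator (cbox 0 One) z" for z
        using strict_subsolution_bounds(4)[OF sub[of k], of z] strict_subsolution_outside(1)[OF sub[of k], of z]
        by (cases "z \<in> cbox 0 One") auto
    qed (auto intro!: int integrable_mult_right integrable_indicator_cbox)
    also have "\<dots> = 3/2" using measure_unit_box[where 'a="(real^'n) \<times> real"] by simp
    finally have "E k \<le> 3/2" .
    moreover have "0 \<le> (1/2 :: real) ^ k" by simp
    ultimately show ?thesis unfolding a_def by linarith
  qed
  ultimately have "convergent a"
    unfolding convergent_def by (metis incseq_convergent)
  then show ?thesis using that key convergent_Cauchy by blast
qed

lemma compact_ess_supp:
  assumes "AE z in lborel. z \<notin> cbox a b \<longrightarrow> f z = 0"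
  shows "compact (ess_supp f)"
proof -
  have "- cbox a b \<subseteq> \<Union>{U. open U \<and> (AE z in lborel. z \<in> U \<longrightarrow> f z = 0)}"
    using assms by (intro Union_upper) (auto intro: open_Compl closed_cbox)
  then have "ess_supp f \<subseteq> cbox a b" unfolding ess_supp_def by blast
  moreover have "closed (ess_supp f)"
    unfolding ess_supp_def by (intro closed_Compl open_Union) auto
  ultimately show ?thesis
    using compact_eq_bounded_closed bounded_subset bounded_cbox by metis
qed

lemma frechet_derivative_test_components:
  fixes \<phi> :: "(real^'n) \<times> real \<Rightarrow> real"
  assumes "test_function \<phi>"
  shows "frechet_derivative \<phi> (at z) (y, t)
    = (\<Sum>j\<in>UNIV. y $ j * dir_deriv (axis j 1, 0) \<phi> z) + t * dir_deriv (0, 1) \<phi> z"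
proof -
  note lin = test_function_linear[OF assms, of z]
  have "y = (\<Sum>j\<in>UNIV. y $ j *\<^sub>R axis j 1)"
    using basis_expansion[of y] by (simp add: scalar_mult_eq_scaleR)
  then have "(y, t) = (\<Sum>j\<in>UNIV. y $ j *\<^sub>R (axis j 1, 0)) + t *\<^sub>R (0, 1)"
    by (simp add: scaleR_Pair sum_prod fst_sum snd_sum prod_eq_iff)
  then have "frechet_derivative \<phi> (at z) (y, t)
    = frechet_derivative \<phi> (at z) ((\<Sum>j\<in>UNIV. y $ j *\<^sub>R (axis j 1, 0)) + t *\<^sub>R (0, 1))" by (rule arg_cong)
  also have "\<dots> = (\<Sum>j\<in>UNIV. y $ j * dir_deriv (axis j 1, 0) \<phi> z) + t * dir_deriv (0, 1) \<phi> z"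
    by (simp only: linear_add[OF lin] linear_sum[OF lin] linear_cmul[OF lin] real_scaleR_def)
  finally show ?thesis .
qed

text \<open>All \<open>F k\<close> live in one box, on which \<open>g\<close> is bounded; this
  supplies the dominating function. It is applied with \<open>g\<close> a derivative of a test
  function.\<close>

lemma bounded_limit_against_continuous:
  fixes f :: "'a::euclidean_space \<Rightarrow> real"
  assumes "\<And>k. F k \<in> borel_measurable borel" "f \<in> borel_measurable borel" "continuous_on UNIV g"
    and bound: "\<And>k z. \<bar>F k z\<bar> \<le> C * indicator (cbox a b) z"
    and lim: "AE z in lborel. (\<lambda>k. F k z) \<longlonglongrightarrow> f z"
  shows "integrable lborel (\<lambda>z. f z * g z)" "\<And>k. integrable lborel (\<lambda>z. F k z * g z)"
    "(\<lambda>k. \<integral>z. F k z * g z \<partial>lborel) \<longlonglongrightarrow> (\<integral>z. f z * g z \<partial>lborel)"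
proof -
  have "bounded (g ` cbox a b)"
    by (intro compact_imp_bounded compact_continuous_image continuous_on_subset[OF assms(3)]) auto
  then obtain D where D: "0 < D" "\<And>z. z \<in> cbox a b \<Longrightarrow> \<bar>g z\<bar> \<le> D" by (auto simp: bounded_pos)
  define w where "w z = C * D * indicator (cbox a b) z" for z
  have g: "g \<in> borel_measurable borel" using assms(3) by (rule borel_measurable_continuous_onI)
  have "norm (F k z * g z) \<le> w z" for k z
  proof (cases "z \<in> cbox a b")
    case True
    then show ?thesis using bound[of k z] D(2)[OF True] unfolding w_def norm_mult
      by (auto intro!: mult_mono intro: order_trans[OF abs_ge_zero])
  next
    case False then show ?thesis using bound[of k z] by (simp add: w_def)
  qed
  then have b: "AE z in lborel. norm (F k z * g z) \<le> w z" for k by simp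
  have l: "AE z in lborel. (\<lambda>k. F k z * g z) \<longlonglongrightarrow> f z * g z"
    using lim by eventually_elim (intro tendsto_intros)
  have m: "(\<lambda>z. f z * g z) \<in> borel_measurable lborel" "\<And>k. (\<lambda>z. F k z * g z) \<in> borel_measurable lborel"
    using assms(1,2) g by auto
  have iw: "integrable lborel w" unfolding w_def by (intro integrable_mult_right integrable_indicator_cbox)
  show "integrable lborel (\<lambda>z. f z * g z)" "\<And>k. integrable lborel (\<lambda>z. F k z * g z)"
    "(\<lambda>k. \<integral>z. F k z * g z \<partial>lborel) \<longlonglongrightarrow> (\<integral>z. f z * g z \<partial>lborel)"
    using integrable_dominated_convergence[OF m iw l b] integrable_dominated_convergence2[OF m iw l b]
      integral_dominated_convergence[OF m iw l b] by auto
qed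

text \<open>On a cube of volume 1, the weighted inequality |d| <= e/2 + |d|^2/(2e) turns a bound
  \<open>e\<^sup>2\<close> on the squared distance into a bound \<open>e\<close> in L1, the norm
  from which an almost everywhere convergent subsequence is then extracted.\<close>

lemma L2_Cauchy_imp_L1_Cauchy:
  fixes v :: "nat \<Rightarrow> 'a::euclidean_space \<Rightarrow> 'b::euclidean_space"
  assumes C: "\<And>k. Cc (v k)" and supp: "\<And>k z. z \<notin> cbox 0 One \<Longrightarrow> v k z = 0"
    and a: "Cauchy a" "\<And>k m. k \<le> m \<Longrightarrow> (\<integral>z. (v m z - v k z) \<bullet> (v m z - v k z) \<partial>lborel) \<le> a m - (a k :: real)"
    and e: "0 < e"
  shows "\<exists>N. \<forall>i\<ge>N. \<forall>j\<ge>N. (\<integral>z. norm (v i z - v j z) \<partial>lborel) < e"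
proof -
  obtain N where N: "\<And>i j. N \<le> i \<Longrightarrow> N \<le> j \<Longrightarrow> dist (a i) (a j) < e\<^sup>2"
    using a(1) e unfolding Cauchy_def by (metis zero_less_power)
  have ordered: "(\<integral>z. norm (v i z - v j z) \<partial>lborel) < e" if "N \<le> j" "j \<le> i" for i j
  proof -
    let ?d = "\<lambda>z. v i z - v j z"
    have Cd: "Cc ?d" by (intro Cc_diff C)
    have int: "integrable lborel (\<lambda>z. ?d z \<bullet> ?d z)" by (intro Cc_integrable Cc_inner Cd Cc_continuous)
    have "norm (?d z) \<le> e / 2 * indicator (cbox 0 One) z + (?d z \<bullet> ?d z) / (2 * e)" for z
    proof (cases "z \<in> cbox 0 One")
      case True
      have "2 * e * norm (?d z) \<le> e * e + norm (?d z) * norm (?d z)"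
        using zero_le_square[of "e - norm (?d z)"] by (simp add: algebra_simps)
      then have "norm (?d z) \<le> (e * e + norm (?d z) * norm (?d z)) / (2 * e)"
        using e by (simp add: pos_le_divide_eq mult.commute)
      also have "\<dots> = e / 2 + (?d z \<bullet> ?d z) / (2 * e)"
        using e by (simp add: add_divide_distrib power2_norm_eq_inner[symmetric] power2_eq_square)
      finally show ?thesis using True by simp
    next
      case False
      then show ?thesis using supp by simp
    qed
    then have "(\<integral>z. norm (?d z) \<partial>lborel) \<le> (\<integral>z. e / 2 * indicator (cbox 0 One) z + (?d z \<bullet> ?d z) / (2 * e) \<partial>lborel)"
      by (intro integral_mono integrable_norm Cc_integrable[OF Cd] Bochner_Integration.integrable_add
          integrable_mult_right integrable_indicator_cbox integrable_divide int)
    also have "\<dots> = e / 2 + (\<integral>z. ?d z \<bullet> ?d z \<partial>lborel) / (2 * e)"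
      using measure_unit_box[where 'a='a]
      by (subst Bochner_Integration.integral_add) (auto intro!: integrable_mult_right integrable_indicator_cbox integrable_divide int)
    also have "\<dots> < e / 2 + e\<^sup>2 / (2 * e)"
    proof -
      have "(\<integral>z. ?d z \<bullet> ?d z \<partial>lborel) \<le> a i - a j" using a(2)[OF that(2)] .
      also have "\<dots> < e\<^sup>2" using N[of i j] that by (auto simp: dist_real_def)
      finally show ?thesis using e by (simp add: divide_strict_right_mono)
    qed
    also have "\<dots> = e" using e by (simp add: power2_eq_square)
    finally show ?thesis .
  qed
  have "(\<integral>z. norm (v i z - v j z) \<partial>lborel) < e" if "N \<le> i" "N \<le> j" for i j
  proof (cases "j \<le> i")
    case True then show ?thesis using ordered[of j i] that by simp
  next
    case False
    then have "(\<integral>z. norm (v j z - v i z) \<partial>lborel) < e" using ordered[of i j] that by simp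
    then show ?thesis by (simp add: norm_minus_commute)
  qed
  then show ?thesis by blast
qed

text \<open>Consecutive fields become close, so the gain inequality read backwards forces the
  integral of the squared trace to 0. One subsequence makes the fields converge almost everywhere, a
  further one the traces. The claim on traces is confined to the cube, because off it the trace of
  the defect is 1.\<close>

lemma subsolution_sequence_AE_convergent:
  assumes card: "2 \<le> CARD('n)"
  obtains \<eta> and v :: "nat \<Rightarrow> (real^'n) \<times> real \<Rightarrow> real^'n" and \<sigma> where
    "\<And>k. strict_subsolution (\<eta> k) (v k) (\<sigma> k)"
    "AE z in lborel. convergent (\<lambda>k. v k z) \<and> (z \<in> cbox 0 One \<longrightarrow> (\<lambda>k. trace (defect (v k z) (\<sigma> k z))) \<longlonglongrightarrow> 0)"
proof -
  let ?G = "gain CARD('n) DIM((real^'n) \<times> real)"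
  obtain \<eta> and v :: "nat \<Rightarrow> (real^'n) \<times> real \<Rightarrow> real^'n" and \<sigma> where
    sub: "\<And>k. strict_subsolution (\<eta> k) (v k) (\<sigma> k)" and
    orth: "\<And>k j. k \<le> j \<Longrightarrow> \<bar>\<integral>z. (v (Suc j) z - v j z) \<bullet> v k z \<partial>lborel\<bar> \<le> (1/2) ^ j" and
    gain: "\<And>j. ?G * integral (cbox 0 One) (\<lambda>z. (trace (defect (v j z) (\<sigma> j z)))\<^sup>2) - (1/2) ^ j
      \<le> (\<integral>z. (v (Suc j) z - v j z) \<bullet> (v (Suc j) z - v j z) \<partial>lborel)"
    by (rule subsolution_sequence[OF card]) (rule that; assumption)
  obtain a where a: "Cauchy a"
    "\<And>k m. k \<le> m \<Longrightarrow> (\<integral>z. (v m z - v k z) \<bullet> (v m z - v k z) \<partial>lborel) \<le> a m - (a k :: real)"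
    by (rule subsolution_sequence_L2_Cauchy[OF sub orth]) (assumption | rule that)+
  have C: "Cc (v k)" for k using sub[of k] by (simp add: strict_subsolution_def linear_euler_def)
  have supp: "v k z = 0" if "z \<notin> cbox 0 One" for k z
    by (rule strict_subsolution_outside[OF sub that])
  obtain r where r: "strict_mono r" "AE z in lborel. Cauchy (\<lambda>i. v (r i) z)"
  proof (rule cauchy_L1_AE_cauchy_subseq[of lborel v])
    show "integrable lborel (v k)" for k by (rule Cc_integrable[OF C])
    show "\<exists>N. \<forall>i\<ge>N. \<forall>j\<ge>N. (\<integral>z. norm (v i z - v j z) \<partial>lborel) < e" if "0 < e" for e
      by (rule L2_Cauchy_imp_L1_Cauchy[OF C supp a that])
  qed (rule that)
  define R where "R k z = (trace (defect (v k z) (\<sigma> k z)))\<^sup>2" for k z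
  define t where "t k z = indicator (cbox 0 One) z *\<^sub>R R k z" for k z
  have contR: "continuous_on (cbox 0 One) (R k)" for k
    unfolding R_def by (intro continuous_intros strict_subsolution_continuous_defect[OF sub])
  have int_t: "integrable lborel (t k)" for k
    unfolding t_def by (intro borel_integrable_compact contR) simp
  have t_int: "(\<integral>z. norm (t k z) \<partial>lborel) = integral (cbox 0 One) (R k)" for k
  proof -
    have "(\<integral>z. norm (t k z) \<partial>lborel) = (\<integral>z. t k z \<partial>lborel)"
      by (intro Bochner_Integration.integral_cong) (auto simp: t_def R_def indicator_def)
    also have "\<dots> = integral (cbox 0 One) (R k)"
      using set_borel_integral_eq_integral(2)[of "cbox 0 One" "R k"] int_t[of k]
      by (simp add: t_def[abs_def] set_lebesgue_integral_def set_integrable_def)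
    finally show ?thesis .
  qed
  have G: "0 < ?G" by (simp add: gain_def)
  have "(\<lambda>k. integral (cbox 0 One) (R k)) \<longlonglongrightarrow> 0"
  proof (rule tendsto_sandwich)
    show "\<forall>\<^sub>F k in sequentially. 0 \<le> integral (cbox 0 One) (R k)"
      unfolding t_int[symmetric] by (simp add: Bochner_Integration.integral_nonneg)
    have "integral (cbox 0 One) (R k) \<le> (a (Suc k) - a k + (1/2)^k) / ?G" for k
      using gain[of k] a(2)[of k "Suc k"] G
      by (simp add: R_def[abs_def] pos_le_divide_eq mult.commute)
    then show "\<forall>\<^sub>F k in sequentially. integral (cbox 0 One) (R k) \<le> (a (Suc k) - a k + (1/2)^k) / ?G"
      by simp
    obtain L where "a \<longlonglongrightarrow> L" using a(1) Cauchy_convergent_iff convergent_def by metis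
    then have "(\<lambda>k. (a (Suc k) - a k + (1/2)^k) / ?G) \<longlonglongrightarrow> (L - L + 0) / ?G"
      using G by (intro tendsto_intros LIMSEQ_Suc LIMSEQ_realpow_zero) auto
    then show "(\<lambda>k. (a (Suc k) - a k + (1/2)^k) / ?G) \<longlonglongrightarrow> 0" by simp
  qed simp
  then have "(\<lambda>k. \<integral>z. norm (t (r k) z) \<partial>lborel) \<longlonglongrightarrow> 0"
    unfolding t_int using LIMSEQ_subseq_LIMSEQ[OF _ r(1)] by (fastforce simp: o_def)
  then obtain r' where r': "strict_mono r'" "AE z in lborel. (\<lambda>k. t (r (r' k)) z) \<longlonglongrightarrow> 0"
    using tendsto_L1_AE_subseq[of lborel "\<lambda>k. t (r k)", OF int_t] by blast
  show ?thesis
  proof (rule that[of "\<lambda>k. \<eta> (r (r' k))" "\<lambda>k. v (r (r' k))" "\<lambda>k. \<sigma> (r (r' k))"])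
    show "strict_subsolution (\<eta> (r (r' k))) (v (r (r' k))) (\<sigma> (r (r' k)))" for k by (rule sub)
    show "AE z in lborel. convergent (\<lambda>k. v (r (r' k)) z) \<and>
      (z \<in> cbox 0 One \<longrightarrow> (\<lambda>k. trace (defect (v (r (r' k)) z) (\<sigma> (r (r' k)) z))) \<longlonglongrightarrow> 0)"
      using r(2) r'(2)
    proof eventually_elim
      case (elim z)
      have "convergent (\<lambda>i. v (r i) z)" using elim(1) by (simp add: Cauchy_convergent_iff)
      then have "convergent ((\<lambda>i. v (r i) z) \<circ> r')" by (rule convergent_subseq_convergent) (rule r')
      then have 1: "convergent (\<lambda>k. v (r (r' k)) z)" by (simp add: o_def)
      have "(\<lambda>k. trace (defect (v (r (r' k)) z) (\<sigma> (r (r' k)) z))) \<longlonglongrightarrow> 0" if "z \<in> cbox 0 One"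
      proof -
        have "(\<lambda>k. (trace (defect (v (r (r' k)) z) (\<sigma> (r (r' k)) z)))\<^sup>2) \<longlonglongrightarrow> 0"
          using elim(2) that by (simp add: t_def R_def)
        from tendsto_real_sqrt[OF this] show ?thesis by (simp add: tendsto_rabs_zero_iff)
      qed
      with 1 show ?case by blast
    qed
  qed
qed

theorem theorem1p1:
  assumes "2 \<le> CARD('n::finite)"
  shows "\<exists>(v :: (real ^ 'n) \<times> real \<Rightarrow> real ^ 'n) (p :: (real ^ 'n) \<times> real \<Rightarrow> real).
           Linfty v \<and> Linfty p
           \<and> euler_distributional_solution v p
           \<and> \<not> (AE z in lborel. v z = 0)
           \<and> compact (ess_supp v) \<and> compact (ess_supp p)"
proof -
  let ?Q = "cbox 0 One :: ((real^'n) \<times> real) set"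
  obtain \<eta> and v :: "nat \<Rightarrow> (real^'n) \<times> real \<Rightarrow> real^'n" and \<sigma> where
    sub: "\<And>k. strict_subsolution (\<eta> k) (v k) (\<sigma> k)" and
    conv: "AE z in lborel. convergent (\<lambda>k. v k z) \<and> (z \<in> ?Q \<longrightarrow> (\<lambda>k. trace (defect (v k z) (\<sigma> k z))) \<longlonglongrightarrow> 0)"
    by (rule subsolution_sequence_AE_convergent[OF assms]) (rule that; assumption)
  have le: "linear_euler (v k) (\<sigma> k)" and C: "Cc (v k)" "Cc (\<sigma> k)" for k
    using sub[of k] by (auto simp: strict_subsolution_def linear_euler_def)
  have supp: "v k z = 0" "\<sigma> k z = 0" if "z \<notin> ?Q" for k z
    by (rule strict_subsolution_outside[OF sub that])+
  note bounds = strict_subsolution_bounds[OF sub]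
  \<comment> \<open>Where the sequence diverges, on a null set, \<open>lim\<close> has no useful
    value. Off the cube the sequence is constantly 0, so \<open>V\<close> vanishes there without
    exception.\<close>
  define V where "V z = lim (\<lambda>k. v k z)" for z
  \<comment> \<open>Vanishing defect means that \<open>\<sigma> k\<close> tends to V (x) V minus the
    identity over the dimension on the cube; off the cube everything is 0. This \<open>p\<close> is
    therefore the scalar left over on the diagonal, with a jump across the boundary of the
    cube.\<close>
  define p where "p z = - (1 / real CARD('n)) * indicator ?Q z" for z
  have meas_v: "v k \<in> borel_measurable borel" "\<sigma> k \<in> borel_measurable borel" for k
    by (intro Cc_measurable C)+
  have meas_V: "V \<in> borel_measurable borel"
    unfolding V_def using meas_v(1) by (intro borel_measurable_lim_metric)
  have meas_p: "p \<in> borel_measurable borel"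
    unfolding p_def by simp
  have meas_nth: "(\<lambda>z. f z $ i) \<in> borel_measurable borel" if "f \<in> borel_measurable borel"
    for f :: "(real^'n) \<times> real \<Rightarrow> real^'n" and i
    by (rule measurable_compose[OF that borel_measurable_continuous_onI]) (intro continuous_intros)
  have V0: "V z = 0" if "z \<notin> ?Q" for z using supp(1)[OF that] by (simp add: V_def)
  have lim: "AE z in lborel. (\<lambda>k. v k z) \<longlonglongrightarrow> V z \<and> (z \<in> ?Q \<longrightarrow> (\<lambda>k. trace (defect (v k z) (\<sigma> k z))) \<longlonglongrightarrow> 0)"
    using conv by eventually_elim (simp add: V_def convergent_LIMSEQ_iff)
  have lim_v: "AE z in lborel. (\<lambda>k. v k z $ i) \<longlonglongrightarrow> V z $ i" for i
    using lim by eventually_elim (auto intro: tendsto_intros)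
  have lim_\<sigma>: "AE z in lborel. (\<lambda>k. \<sigma> k z $ i $ j) \<longlonglongrightarrow> V z $ i * V z $ j + (if i = j then p z else 0)" for i j
    using lim
  proof eventually_elim
    case (elim z)
    show ?case
    proof (cases "z \<in> ?Q")
      case True
      have "(\<lambda>k. defect (v k z) (\<sigma> k z) $ i $ j) \<longlonglongrightarrow> 0"
        \<comment> \<open>Every entry of the defect is squeezed by its trace.\<close>
        by (rule Lim_null_comparison[of _ "\<lambda>k. trace (defect (v k z) (\<sigma> k z))"])
          (use elim True bounds(1)[where z=z] in auto)
      moreover have "(\<lambda>k. v k z) \<longlonglongrightarrow> V z" using elim by simp
      ultimately have "(\<lambda>k. defect (v k z) (\<sigma> k z) $ i $ j - mat (1 / real CARD('n)) $ i $ j + v k z $ i * v k z $ j)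
        \<longlonglongrightarrow> 0 - mat (1 / real CARD('n)) $ i $ j + V z $ i * V z $ j"
        by (intro tendsto_intros)
      then show ?thesis using True by (simp add: defect_def p_def mat_def algebra_simps split: if_splits)
    next
      case False
      then show ?thesis by (simp add: supp V0 p_def)
    qed
  qed
  have bV: "AE z in lborel. norm (V z) \<le> 2"
    using lim
  proof eventually_elim
    case (elim z)
    show ?case by (rule LIMSEQ_le_const2[OF tendsto_norm]) (use elim bounds(6)[where z=z] in auto)
  qed
  have nonzero: "AE z in lborel. z \<in> ?Q \<longrightarrow> V z \<noteq> 0"
    using lim
  proof eventually_elim
    case (elim z)
    show ?case
    proof
      assume "z \<in> ?Q"
      then have "(\<lambda>k. trace (defect (v k z) (\<sigma> k z))) \<longlonglongrightarrow> 0" using elim by simp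
      then have t: "(\<lambda>k. 1/2 - trace (defect (v k z) (\<sigma> k z))) \<longlonglongrightarrow> 1/2 - 0" by (intro tendsto_intros)
      moreover have "(\<lambda>k. v k z) \<longlonglongrightarrow> V z" using elim by simp
      \<comment> \<open>The squared speed of each approximation is at least 1/2 minus the trace of
        its defect, so the limit is nonzero almost everywhere in the cube.\<close>
      ultimately have "1/2 - 0 \<le> V z \<bullet> V z"
        by (intro LIMSEQ_le[OF t tendsto_inner]) (use bounds(5)[where z=z] in auto)
      then show "V z \<noteq> 0" by auto
    qed
  qed
  have euler: "euler_distributional_solution V p"
    unfolding euler_distributional_solution_def
  proof (intro allI impI conjI)
    fix \<phi> :: "(real^'n) \<times> real \<Rightarrow> real" and i :: 'n
    assume \<phi>: "test_function \<phi>"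
    have cont: "continuous_on UNIV (dir_deriv b \<phi>)" for b by (rule test_function_dir_deriv_continuous[OF \<phi>])
    have bv: "\<bar>v k z $ i\<bar> \<le> 2 * indicator ?Q z" for k z i
      using component_le_norm_cart[of "v k z" i] bounds(6)[of k z] supp(1)[of z k] by (cases "z \<in> ?Q") auto
    have b\<sigma>: "\<bar>\<sigma> k z $ i $ j\<bar> \<le> 7 * indicator ?Q z" for k z i j
      using bounds(7)[of k z i j] supp(2)[of z k] by (cases "z \<in> ?Q") auto
    have m\<sigma>: "(\<lambda>z. \<sigma> k z $ i $ j) \<in> borel_measurable borel" for k i j
      by (intro borel_measurable_continuous_onI continuous_intros Cc_continuous C)
    have mv: "(\<lambda>z. v k z $ i) \<in> borel_measurable borel" for k i by (intro meas_nth meas_v)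
    have mV: "(\<lambda>z. V z $ i) \<in> borel_measurable borel" for i by (intro meas_nth meas_V)
    have mS: "(\<lambda>z. V z $ i * V z $ j + (if i = j then p z else 0)) \<in> borel_measurable borel" for i j
      using mV meas_p by simp
    note Lv = bounded_limit_against_continuous[OF mv mV cont bv lim_v]
    note L\<sigma> = bounded_limit_against_continuous[OF m\<sigma> mS cont b\<sigma> lim_\<sigma>]
    have ip: "integrable lborel (\<lambda>z. p z * dir_deriv b \<phi> z)" for b
    proof -
      have "integrable lborel (\<lambda>z. - (1 / real CARD('n)) * (indicator ?Q z *\<^sub>R dir_deriv b \<phi> z))"
        by (intro integrable_mult_right borel_integrable_compact continuous_on_subset[OF cont]) auto
      then show ?thesis by (simp add: p_def mult.assoc)
    qed
    have iVV: "integrable lborel (\<lambda>z. V z $ i * V z $ j * dir_deriv b \<phi> z)" for b j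
    proof -
      have "integrable lborel (\<lambda>z. (V z $ i * V z $ j + (if i = j then p z else 0)) * dir_deriv b \<phi> z
          - (if i = j then p z * dir_deriv b \<phi> z else 0))"
        using L\<sigma>(1)[of i j b] ip[of b] by (cases "i = j") auto
      then show ?thesis by (cases "i = j") (simp_all add: distrib_right)
    qed
    \<comment> \<open>The pressure sits only on the diagonal, so summing over \<open>j\<close>
      leaves the single term with the derivative along \<open>i\<close>, which is the gradient
      component of the Euler equation.\<close>
    have split: "(\<integral>z. (V z $ i * V z $ j + (if i = j then p z else 0)) * dir_deriv b \<phi> z \<partial>lborel)
        = (\<integral>z. V z $ i * V z $ j * dir_deriv b \<phi> z \<partial>lborel) + (if i = j then \<integral>z. p z * dir_deriv b \<phi> z \<partial>lborel else 0)" for b j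
      using iVV[of j b] ip[of b] by (cases "i = j") (simp_all add: distrib_right)
    have "(\<lambda>k. (\<Sum>j\<in>UNIV. \<integral>z. \<sigma> k z $ i $ j * dir_deriv (axis j 1, 0) \<phi> z \<partial>lborel) + (\<integral>z. v k z $ i * dir_deriv (0, 1) \<phi> z \<partial>lborel))
      \<longlonglongrightarrow> (\<Sum>j\<in>UNIV. \<integral>z. (V z $ i * V z $ j + (if i = j then p z else 0)) * dir_deriv (axis j 1, 0) \<phi> z \<partial>lborel) + (\<integral>z. V z $ i * dir_deriv (0, 1) \<phi> z \<partial>lborel)"
      by (intro tendsto_intros Lv(3) L\<sigma>(3))
    \<comment> \<open>Each approximation solves the linear system exactly; the nonlinearity arises
      only through the limit of \<open>\<sigma> k\<close>.\<close>
    moreover have "(\<Sum>j\<in>UNIV. \<integral>z. \<sigma> k z $ i $ j * dir_deriv (axis j 1, 0) \<phi> z \<partial>lborel) + (\<integral>z. v k z $ i * dir_deriv (0, 1) \<phi> z \<partial>lborel) = 0" for k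
    proof -
      have "(\<integral>z. frechet_derivative \<phi> (at z) (\<sigma> k z $ i, v k z $ i) \<partial>lborel) = 0"
        using le[of k] \<phi> by (simp add: linear_euler_def)
      then have "(\<integral>z. (\<Sum>j\<in>UNIV. \<sigma> k z $ i $ j * dir_deriv (axis j 1, 0) \<phi> z) + v k z $ i * dir_deriv (0, 1) \<phi> z \<partial>lborel) = 0"
        by (simp only: frechet_derivative_test_components[OF \<phi>, of _ "\<sigma> k _ $ i"])
      then show ?thesis by (simp add: Lv(2) L\<sigma>(2))
    qed
    ultimately have "(\<Sum>j\<in>UNIV. \<integral>z. (V z $ i * V z $ j + (if i = j then p z else 0)) * dir_deriv (axis j 1, 0) \<phi> z \<partial>lborel) + (\<integral>z. V z $ i * dir_deriv (0, 1) \<phi> z \<partial>lborel) = 0"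
      using LIMSEQ_unique[OF _ tendsto_const[of 0]] by simp
    then show "D_t (distr_of (\<lambda>z. V z $ i)) \<phi> + (\<Sum>j\<in>UNIV. D_x j (distr_of (\<lambda>z. V z $ i * V z $ j)) \<phi>) + D_x i (distr_of p) \<phi> = 0"
      unfolding split by (simp add: distr_deriv_def distr_of_def sum.distrib sum_negf)
    have "(\<lambda>k. \<Sum>j\<in>UNIV. \<integral>z. v k z $ j * dir_deriv (axis j 1, 0) \<phi> z \<partial>lborel)
      \<longlonglongrightarrow> (\<Sum>j\<in>UNIV. \<integral>z. V z $ j * dir_deriv (axis j 1, 0) \<phi> z \<partial>lborel)"
      by (intro tendsto_intros Lv(3))
    moreover have "(\<Sum>j\<in>UNIV. \<integral>z. v k z $ j * dir_deriv (axis j 1, 0) \<phi> z \<partial>lborel) = 0" for k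
    proof -
      have "(\<integral>z. frechet_derivative \<phi> (at z) (v k z, 0) \<partial>lborel) = 0"
        using le[of k] \<phi> by (simp add: linear_euler_def)
      then have "(\<integral>z. (\<Sum>j\<in>UNIV. v k z $ j * dir_deriv (axis j 1, 0) \<phi> z) + 0 * dir_deriv (0, 1) \<phi> z \<partial>lborel) = 0"
        by (simp only: frechet_derivative_test_components[OF \<phi>, of _ "v k _"])
      then show ?thesis by (simp add: Lv(2))
    qed
    ultimately show "(\<Sum>j\<in>UNIV. D_x j (distr_of (\<lambda>z. V z $ j)) \<phi>) = 0"
      using LIMSEQ_unique[OF _ tendsto_const[of 0]] by (simp add: distr_deriv_def distr_of_def sum_negf)
  qed
  have "\<not> (AE z in lborel. V z = 0)"
  proof
    assume "AE z in lborel. V z = 0"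
    with nonzero have "AE z in lborel. z \<notin> ?Q" by eventually_elim auto
    then have "emeasure lborel ?Q = 0" by (subst (asm) AE_iff_measurable[OF _ refl]) auto
    then show False using measure_unit_box[where 'a="(real^'n) \<times> real"] by (simp add: measure_def)
  qed
  moreover have "Linfty V" unfolding Linfty_def using bV meas_V by auto
  moreover have "Linfty p"
    unfolding Linfty_def using meas_p
    by (auto intro!: exI[of _ "1 / real CARD('n)"] simp: p_def indicator_def)
  moreover have "compact (ess_supp V)" "compact (ess_supp p)"
    by (rule compact_ess_supp[of 0 One]; simp add: V0 p_def)+
  ultimately show ?thesis using euler by blast
qed

end
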